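(* Let $(l,Q,\omega,\varphi)$ be admissible data (see context), $m\in(0,1)$, $s\in(0,\infty)$, and let $w_{m,s}$ be the minimizer of $sc^-G_{m,s}$ and $\lambda_{m,s}$ the associated constant (see context). Then $$\mathfrak G_s(m):=sc^-G_{m,s}(w_{m,s})=2\int_m^1\big(\vartheta(t)|w_{m,s}'|^2+\omega(1-t)\big)^{1/2}dt+2\vartheta^{1/2}(m)\Big(w_{m,s}(m^+)-\frac s2\Big),$$ and exactly one of the following two cases occurs. Either $w_{m,s}\in W^{1,1}((2m-1,1))$, which holds if and only if $s=B(m,\lambda_{m,s})$, and in this case $$\mathfrak G_s(m)=2\int_m^1\Big(\frac{\vartheta(t)\,\omega(1-t)}{\vartheta(t)-\lambda_{m,s}^2}\Big)^{1/2}dt=\mathscr G(m,\lambda_{m,s})=A(m,\lambda_{m,s})+\lambda_{m,s}s;$$ or $w_{m,s}\in SBV\setminus W^{1,1}((2m-1,1))$, which holds if and only if $s>B(m,\vartheta^{1/2}(m))$, and in this case $w_{m,s}(m^+)=s-\frac12B(m,\vartheta^{1/2}(m))$ and $$\mathfrak G_s(m)=2\int_m^1\Big(\frac{\vartheta(t)\,\omega(1-t)}{\vartheta(t)-\vartheta(m)}\Big)^{1/2}dt+\vartheta^{1/2}(m)\big(s-B(m,\vartheta^{1/2}(m))\big)$$ $$=\mathscr G(m,\vartheta^{1/2}(m))+\vartheta^{1/2}(m)\big(s-B(m,\vartheta^{1/2}(m))\big)=A(m,\vartheta^{1/2}(m))+\vartheta^{1/2}(m)s .$$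
   Context: Convention: $0\cdot\infty=0$. Admissible data: $l,Q\in C^0([0,1],[0,\infty))$ with $l(1)=1$, $l^{-1}(\{0\})=Q^{-1}(\{0\})=\{0\}$, $Q$ increasing in a right neighbourhood of $0$, and $t\mapsto (l(t)/Q(1-t))^{1/2}$ (on $[0,1)$) increasing in a right neighbourhood of $0$; $\omega\in C^0([0,1],[0,\infty))$ with $\omega^{-1}(\{0\})=\{0\}$ such that the limit $\bar\varsigma:=\lim_{t\to0^+}(\omega(t)/Q(t))^{1/2}\in[0,\infty]$ exists; $\varphi\in C^0([0,\infty),[0,\infty))$ non-decreasing with $\lim_{t\to\infty}\varphi(t)\in(0,\infty)$, $\varphi^{-1}(0)=\{0\}$, right-differentiable at $0$ with $\varphi'(0^+)=1$; and the function $\vartheta(t):=\frac{\omega(1-t)}{Q(1-t)}l(t)$ is strictly increasing on $[0,1)$. Then $\vartheta$ is continuous, $\vartheta(0)=0$ and $\vartheta(1^-)=\bar\varsigma^2\in(0,\infty]$; set $\vartheta(1):=\vartheta(1^-)$. For $m\in(0,1)$, $t\in[2m-1,1]$: $\vartheta_m(t):=\vartheta(m+|t-m|)$, $\omega_m(1-t):=\omega(1-m-|t-m|)$. For $w\in BV((2m-1,1))$ $$sc^-G_{m,s}(w):=\int_{2m-1}^1\big(\vartheta_m(t)|w'|^2+\omega_m(1-t)\big)^{1/2}dt+\int_{2m-1}^1\vartheta_m^{1/2}\,d|D^sw|+\vartheta^{1/2}(1^-)|w((2m-1)^+)|+\vartheta^{1/2}(1^-)|w(1^-)-s|,$$ and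 $+\infty$ on $L^1\setminus BV$. This functional has a unique minimizer $w_{m,s}$ on $L^1((2m-1,1))$. It belongs to $SBV((2m-1,1))$, is strictly increasing, satisfies $w_{m,s}(2m-t)=s-w_{m,s}(t)$, $w_{m,s}(2m-1)=0$, $w_{m,s}(1)=s$, has singular derivative at most at $t=m$, and for a unique $\lambda_{m,s}\in(0,\vartheta^{1/2}(m)]$ one has $w_{m,s}'(t)=\Big(\frac{\lambda_{m,s}^2\,\omega_m(1-t)}{\vartheta_m(t)(\vartheta_m(t)-\lambda_{m,s}^2)}\Big)^{1/2}$ for a.e. $t$; if $w_{m,s}\notin W^{1,1}$ then $\lambda_{m,s}=\vartheta^{1/2}(m)$. For $m\in(0,1)$ and $\lambda\in(0,\vartheta^{1/2}(m)]$: $A(m,\lambda):=2\int_m^1\Big(\frac{\vartheta(t)-\lambda^2}{\vartheta(t)}\omega(1-t)\Big)^{1/2}dt$, $B(m,\lambda):=2\int_m^1\Big(\frac{\lambda^2\omega(1-t)}{\vartheta(t)(\vartheta(t)-\lambda^2)}\Big)^{1/2}dt\in[0,\infty]$, $\mathscr G(m,\lambda):=A(m,\lambda)+\lambda B(m,\lambda)$. *)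

theory Defs
  imports "HOL-Analysis.Analysis"
begin

section \<open>Functions of bounded variation on an open interval\<close>

text \<open>
  Functions are arbitrary representatives of their Lebesgue classes; every notion below
  is invariant under modification on a null set and ignores the values outside the interval.
\<close>

definition L1 :: "real \<Rightarrow> real \<Rightarrow> (real \<Rightarrow> real) set" where
  "L1 a b = {u. u absolutely_integrable_on {a<..<b}}"

definition test_funs :: "real \<Rightarrow> real \<Rightarrow> (real \<Rightarrow> real) set" where
  "test_funs a b = {g. g C1_differentiable_on UNIV \<and> closure {x. g x \<noteq> 0} \<subseteq> {a<..<b}}"

definition finite_borel_on :: "real \<Rightarrow> real \<Rightarrow> real measure \<Rightarrow> bool" where
  "finite_borel_on a b \<mu> \<longleftrightarrow>
     finite_measure \<mu> \<and> sets \<mu> = sets borel \<and> emeasure \<mu> (- {a<..<b}) = 0"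

definition sign_fun :: "(real \<Rightarrow> real) \<Rightarrow> bool" where
  "sign_fun \<sigma> \<longleftrightarrow> \<sigma> \<in> borel_measurable borel \<and> (\<forall>x. \<bar>\<sigma> x\<bar> = 1)"

text \<open>
  A finite signed measure is represented by its polar decomposition \<open>\<sigma> \<mu>\<close>, with \<open>\<mu>\<close> its
  total variation and \<open>\<sigma>\<close> a sign. Thus \<open>u\<close> is in \<open>BV\<close> iff it is in \<open>L1\<close> and its
  distributional derivative is a finite signed measure.
\<close>

definition BV :: "real \<Rightarrow> real \<Rightarrow> (real \<Rightarrow> real) set" where
  "BV a b = {u \<in> L1 a b. \<exists>\<mu> \<sigma>. finite_borel_on a b \<mu> \<and> sign_fun \<sigma> \<and>
     (\<forall>g\<in>test_funs a b.
        (LINT x:{a<..<b}|lebesgue. u x * deriv g x) = - (LINT x|\<mu>. g x * \<sigma> x))}"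

definition W11 :: "real \<Rightarrow> real \<Rightarrow> (real \<Rightarrow> real) set" where
  "W11 a b = {u \<in> L1 a b. \<exists>p\<in>L1 a b. \<forall>g\<in>test_funs a b.
     (LINT x:{a<..<b}|lebesgue. u x * deriv g x) = - (LINT x:{a<..<b}|lebesgue. g x * p x)}"

text \<open>
  The Lebesgue decomposition of the derivative of \<open>u\<close> into the absolutely continuous part
  with density \<open>p\<close> and the singular part, the latter in polar form \<open>\<sigma> \<nu>\<close>. For \<open>u\<close> in \<open>BV\<close>
  such a decomposition exists, \<open>p\<close> is unique up to null sets, and \<open>\<nu>\<close>, the total variation
  of the singular part, is unique.
\<close>

definition bv_decomp ::
    "real \<Rightarrow> real \<Rightarrow> (real \<Rightarrow> real) \<Rightarrow> (real \<Rightarrow> real) \<Rightarrow> real measure \<Rightarrow> (real \<Rightarrow> real) \<Rightarrow> bool" where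
  "bv_decomp a b u p \<nu> \<sigma> \<longleftrightarrow>
     p \<in> L1 a b \<and> finite_borel_on a b \<nu> \<and> sign_fun \<sigma> \<and>
     (\<exists>N\<in>null_sets lborel. emeasure \<nu> (- N) = 0) \<and>
     (\<forall>g\<in>test_funs a b.
        (LINT x:{a<..<b}|lebesgue. u x * deriv g x) =
        - ((LINT x:{a<..<b}|lebesgue. g x * p x) + (LINT x|\<nu>. g x * \<sigma> x)))"

definition ac_deriv :: "real \<Rightarrow> real \<Rightarrow> (real \<Rightarrow> real) \<Rightarrow> real \<Rightarrow> real" where
  "ac_deriv a b u = (SOME p. \<exists>\<nu> \<sigma>. bv_decomp a b u p \<nu> \<sigma>)"

definition sing_var :: "real \<Rightarrow> real \<Rightarrow> (real \<Rightarrow> real) \<Rightarrow> real measure" where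
  "sing_var a b u = (THE \<nu>. \<exists>p \<sigma>. bv_decomp a b u p \<nu> \<sigma>)"

text \<open>
  The one-sided traces \<open>u(t\<^sup>+)\<close>, \<open>u(t\<^sup>-)\<close> are the one-sided limits of a good representative,
  that is, the one-sided limits off a Lebesgue null set.
\<close>

definition trace_right :: "(real \<Rightarrow> real) \<Rightarrow> real \<Rightarrow> real" where
  "trace_right u t = Lim (inf (at_right t) (ae_filter lborel)) u"

definition trace_left :: "(real \<Rightarrow> real) \<Rightarrow> real \<Rightarrow> real" where
  "trace_left u t = Lim (inf (at_left t) (ae_filter lborel)) u"

definition jump_set :: "real \<Rightarrow> real \<Rightarrow> (real \<Rightarrow> real) \<Rightarrow> real set" where
  "jump_set a b u = {t \<in> {a<..<b}. trace_left u t \<noteq> trace_right u t}"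

text \<open>
  The Cantor part of the derivative is the restriction of the singular part to the
  complement of the jump set; a function is in \<open>SBV\<close> iff its Cantor part vanishes.
\<close>

definition SBV :: "real \<Rightarrow> real \<Rightarrow> (real \<Rightarrow> real) set" where
  "SBV a b = {u \<in> BV a b. emeasure (sing_var a b u) ({a<..<b} - jump_set a b u) = 0}"


section \<open>Admissible data\<close>

text \<open>
  On \<open>[0,1)\<close> this is the function \<open>\<vartheta>\<close>. The extension \<open>\<vartheta>(1) = \<vartheta>(1\<^sup>-)\<close> may be infinite and is
  not the value of this function at \<open>1\<close>; only its square root enters, as \<open>sqrt_theta_end\<close>.
\<close>

definition theta :: "(real \<Rightarrow> real) \<Rightarrow> (real \<Rightarrow> real) \<Rightarrow> (real \<Rightarrow> real) \<Rightarrow> real \<Rightarrow> real" where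
  "theta l Q \<omega> t = \<omega> (1 - t) / Q (1 - t) * l t"

definition sqrt_theta_end :: "(real \<Rightarrow> real) \<Rightarrow> (real \<Rightarrow> real) \<Rightarrow> (real \<Rightarrow> real) \<Rightarrow> ereal" where
  "sqrt_theta_end l Q \<omega> = Lim (at_left 1) (\<lambda>t. ereal (sqrt (theta l Q \<omega> t)))"

text \<open>``Increasing in a right neighbourhood of 0'' is understood in the non-strict sense.\<close>

definition admissible ::
    "(real \<Rightarrow> real) \<Rightarrow> (real \<Rightarrow> real) \<Rightarrow> (real \<Rightarrow> real) \<Rightarrow> (real \<Rightarrow> real) \<Rightarrow> bool" where
  "admissible l Q \<omega> \<phi> \<longleftrightarrow>
     continuous_on {0..1} l \<and> (\<forall>t\<in>{0..1}. 0 \<le> l t) \<and> l 1 = 1 \<and>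
     (\<forall>t\<in>{0..1}. l t = 0 \<longleftrightarrow> t = 0) \<and>
     continuous_on {0..1} Q \<and> (\<forall>t\<in>{0..1}. 0 \<le> Q t) \<and> (\<forall>t\<in>{0..1}. Q t = 0 \<longleftrightarrow> t = 0) \<and>
     (\<exists>\<delta>\<in>{0<..1}. mono_on {0..<\<delta>} Q) \<and>
     (\<exists>\<delta>\<in>{0<..1}. mono_on {0..<\<delta>} (\<lambda>t. sqrt (l t / Q (1 - t)))) \<and>
     continuous_on {0..1} \<omega> \<and> (\<forall>t\<in>{0..1}. 0 \<le> \<omega> t) \<and> (\<forall>t\<in>{0..1}. \<omega> t = 0 \<longleftrightarrow> t = 0) \<and>
     (\<exists>c::ereal. ((\<lambda>t. ereal (sqrt (\<omega> t / Q t))) \<longlongrightarrow> c) (at_right 0)) \<and>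
     continuous_on {0..} \<phi> \<and> (\<forall>t\<in>{0..}. 0 \<le> \<phi> t) \<and> mono_on {0..} \<phi> \<and>
     (\<exists>c>0. (\<phi> \<longlongrightarrow> c) at_top) \<and> (\<forall>t\<in>{0..}. \<phi> t = 0 \<longleftrightarrow> t = 0) \<and>
     (\<phi> has_real_derivative 1) (at_right 0) \<and>
     strict_mono_on {0..<1} (theta l Q \<omega>)"


section \<open>The functional\<close>

definition theta_m :: "(real \<Rightarrow> real) \<Rightarrow> (real \<Rightarrow> real) \<Rightarrow> (real \<Rightarrow> real) \<Rightarrow> real \<Rightarrow> real \<Rightarrow> real" where
  "theta_m l Q \<omega> m t = theta l Q \<omega> (m + \<bar>t - m\<bar>)"

text \<open>Chosen such that \<open>omega_m \<omega> m (1 - t) = \<omega> (1 - m - \<bar>t - m\<bar>)\<close>.\<close>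

definition omega_m :: "(real \<Rightarrow> real) \<Rightarrow> real \<Rightarrow> real \<Rightarrow> real" where
  "omega_m \<omega> m r = \<omega> (1 - m - \<bar>(1 - r) - m\<bar>)"

text \<open>The integral of a nonnegative function over \<open>(a,b)\<close>, with values in \<open>[0,\<infinity>]\<close>.\<close>

definition eint :: "real \<Rightarrow> real \<Rightarrow> (real \<Rightarrow> real) \<Rightarrow> ereal" where
  "eint a b f = enn2ereal (\<integral>\<^sup>+t\<in>{a<..<b}. ennreal (f t) \<partial>lborel)"

text \<open>In \<open>ereal\<close>, \<open>0 * \<infinity> = 0\<close>, as required in the boundary terms when \<open>\<vartheta>(1\<^sup>-) = \<infinity>\<close>.\<close>

definition scG ::
    "(real \<Rightarrow> real) \<Rightarrow> (real \<Rightarrow> real) \<Rightarrow> (real \<Rightarrow> real) \<Rightarrow> real \<Rightarrow> real \<Rightarrow> (real \<Rightarrow> real) \<Rightarrow> ereal" where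
  "scG l Q \<omega> m s w =
     (if w \<in> BV (2*m - 1) 1 then
        eint (2*m - 1) 1
          (\<lambda>t. sqrt (theta_m l Q \<omega> m t * \<bar>ac_deriv (2*m - 1) 1 w t\<bar>\<^sup>2 + omega_m \<omega> m (1 - t)))
        + enn2ereal (\<integral>\<^sup>+t\<in>{2*m - 1<..<1}. ennreal (sqrt (theta_m l Q \<omega> m t))
                       \<partial>(sing_var (2*m - 1) 1 w))
        + sqrt_theta_end l Q \<omega> * ereal \<bar>trace_right w (2*m - 1)\<bar>
        + sqrt_theta_end l Q \<omega> * ereal \<bar>trace_left w 1 - s\<bar>
      else \<infinity>)"

definition is_minimizer ::
    "(real \<Rightarrow> real) \<Rightarrow> (real \<Rightarrow> real) \<Rightarrow> (real \<Rightarrow> real) \<Rightarrow> real \<Rightarrow> real \<Rightarrow> (real \<Rightarrow> real) \<Rightarrow> bool" where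
  "is_minimizer l Q \<omega> m s w \<longleftrightarrow>
     w \<in> L1 (2*m - 1) 1 \<and> (\<forall>v\<in>L1 (2*m - 1) 1. scG l Q \<omega> m s w \<le> scG l Q \<omega> m s v)"

text \<open>For a minimizer \<open>w\<close> these conditions determine the constant \<open>lam\<close> uniquely.\<close>

definition is_lambda ::
    "(real \<Rightarrow> real) \<Rightarrow> (real \<Rightarrow> real) \<Rightarrow> (real \<Rightarrow> real) \<Rightarrow> real \<Rightarrow> (real \<Rightarrow> real) \<Rightarrow> real \<Rightarrow> bool" where
  "is_lambda l Q \<omega> m w lam \<longleftrightarrow>
     lam \<in> {0<..sqrt (theta l Q \<omega> m)} \<and>
     (AE t in lborel. t \<in> {2*m - 1<..<1} \<longrightarrow>
        ac_deriv (2*m - 1) 1 w t =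
        sqrt (lam\<^sup>2 * omega_m \<omega> m (1 - t) / (theta_m l Q \<omega> m t * (theta_m l Q \<omega> m t - lam\<^sup>2))))"

definition A_fun ::
    "(real \<Rightarrow> real) \<Rightarrow> (real \<Rightarrow> real) \<Rightarrow> (real \<Rightarrow> real) \<Rightarrow> real \<Rightarrow> real \<Rightarrow> ereal" where
  "A_fun l Q \<omega> m lam =
     2 * eint m 1 (\<lambda>t. sqrt ((theta l Q \<omega> t - lam\<^sup>2) / theta l Q \<omega> t * \<omega> (1 - t)))"

definition B_fun ::
    "(real \<Rightarrow> real) \<Rightarrow> (real \<Rightarrow> real) \<Rightarrow> (real \<Rightarrow> real) \<Rightarrow> real \<Rightarrow> real \<Rightarrow> ereal" where
  "B_fun l Q \<omega> m lam =
     2 * eint m 1 (\<lambda>t. sqrt (lam\<^sup>2 * \<omega> (1 - t) / (theta l Q \<omega> t * (theta l Q \<omega> t - lam\<^sup>2))))"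

definition scriptG ::
    "(real \<Rightarrow> real) \<Rightarrow> (real \<Rightarrow> real) \<Rightarrow> (real \<Rightarrow> real) \<Rightarrow> real \<Rightarrow> real \<Rightarrow> ereal" where
  "scriptG l Q \<omega> m lam = A_fun l Q \<omega> m lam + ereal lam * B_fun l Q \<omega> m lam"

end

theory Submission
  imports Defs "HOL-Probability.Giry_Monad"
begin

text \<open>
  For \<open>0 < \<lambda>\<^sup>2 \<le> \<vartheta>(m)\<close> put \<open>h = \<lambda> (\<omega>\<^sub>m / (\<vartheta>\<^sub>m (\<vartheta>\<^sub>m - \<lambda>\<^sup>2)))\<^sup>1\<^sup>/\<^sup>2\<close>, the density of a minimizer \<open>w\<close> with
  constant \<open>\<lambda>\<close>, and \<open>b = B(m,\<lambda>)\<close>, its integral. All properties of \<open>w\<close> come from comparing it with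
  the functions that start at \<open>0\<close>, have density \<open>k h\<close>, and jump by \<open>s - k b \<ge> 0\<close> at \<open>m\<close>.
  If \<open>b > s\<close>, then \<open>k = s / b < 1\<close> gives a strictly smaller energy; so \<open>b \<le> s\<close>. With \<open>k = 1\<close>,
  since \<open>\<vartheta>\<^sub>m\<close> is strictly minimal at \<open>m\<close> and the boundary weights exceed \<open>\<vartheta>(m)\<^sup>1\<^sup>/\<^sup>2\<close>, the singular part of
  \<open>w\<close> must be a jump of height \<open>s - b\<close> at \<open>m\<close> and the boundary terms must vanish. Finally, if
  \<open>b < s\<close> and \<open>\<lambda> < \<vartheta>(m)\<^sup>1\<^sup>/\<^sup>2\<close>, some \<open>k > 1\<close> lowers the energy, because the bulk energy grows at most
  by \<open>k \<lambda> (k - 1) b\<close> while the jump saves \<open>\<vartheta>(m)\<^sup>1\<^sup>/\<^sup>2 (k - 1) b\<close>.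
\<close>

section \<open>Test functions and integration by parts\<close>

text \<open>The energy is stated through choices: \<open>ac_deriv\<close> is a \<open>SOME\<close>,
  \<open>sing_var\<close> a \<open>THE\<close>, and the traces are limits along a filter. The
  comparisons become arithmetic only once \<open>w\<close> is, almost everywhere, a constant c plus
  the primitive of its density and its singular part; the measure theory up to the weights serves
  this representation and the uniqueness of the decomposition. The comparison is then a budget for
  the rise from 0 to s. The density contributes b, so singular mass n, start value c and mismatch d
  at 1 satisfy s - b <= n + |c| + d. A unit of n costs at least q, the square root of theta at
  \<open>m\<close>, and a unit of |c| or d costs more, while the competitor with k = 1 pays exactly
  q (s - b) for the rest; all inequalities are therefore equalities. Scaling h is the right
  variation because h is the density at which the derivative of sqrt (T p^2 + W) in p equals lambda:
  to first order, one more unit of rise costs lambda through the density and q through the jump. A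
  bound that is explicit in k replaces differentiation under the integral.\<close>

lemma test_funs_outside: "g \<in> test_funs a b \<Longrightarrow> x \<notin> {a<..<b} \<Longrightarrow> g x = 0"
  unfolding test_funs_def using closure_subset[of "{x. g x \<noteq> 0}"] by blast

lemma test_funs_deriv:
  assumes "g \<in> test_funs a b"
  shows "(g has_real_derivative deriv g x) (at x)" and "continuous_on UNIV (deriv g)"
proof -
  from assms obtain D where D: "\<And>x. (g has_vector_derivative D x) (at x)" "continuous_on UNIV D"
    by (auto simp: test_funs_def C1_differentiable_on_def)
  have d: "(g has_real_derivative D x) (at x)" for x
    using D(1) by (simp add: has_real_derivative_iff_has_vector_derivative)
  have "deriv g = D" using DERIV_imp_deriv[OF d] by auto
  then show "(g has_real_derivative deriv g x) (at x)" "continuous_on UNIV (deriv g)"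
    using d D(2) by auto
qed

lemma test_funs_bounds:
  assumes "g \<in> test_funs a b"
  obtains K where "0 \<le> K" "\<And>x. \<bar>g x\<bar> \<le> K" "\<And>x. x \<in> {a..b} \<Longrightarrow> \<bar>deriv g x\<bar> \<le> K"
proof -
  have cg: "continuous_on UNIV g"
    using test_funs_deriv(1)[OF assms] by (meson DERIV_isCont continuous_at_imp_continuous_on)
  have "bounded (g ` {a..b})" "bounded (deriv g ` {a..b})"
    by (intro compact_imp_bounded compact_continuous_image compact_Icc
        continuous_on_subset[OF cg] continuous_on_subset[OF test_funs_deriv(2)[OF assms]]; simp)+
  then obtain K1 K2 where K: "\<forall>x\<in>{a..b}. \<bar>g x\<bar> \<le> K1" "\<forall>x\<in>{a..b}. \<bar>deriv g x\<bar> \<le> K2"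
    by (auto simp: bounded_iff)
  show ?thesis
  proof (rule that[of "max 0 (max K1 K2)"])
    show "\<bar>g x\<bar> \<le> max 0 (max K1 K2)" for x
      using K(1) test_funs_outside[OF assms, of x] by (cases "x \<in> {a<..<b}") (auto simp: le_max_iff_disj)
  qed (use K in \<open>auto simp: le_max_iff_disj\<close>)
qed

lemma test_funs_measurable:
  assumes "g \<in> test_funs a b"
  shows "g \<in> borel_measurable borel" "deriv g \<in> borel_measurable borel"
proof -
  have cg: "continuous_on UNIV g"
    using test_funs_deriv(1)[OF assms] by (meson DERIV_isCont continuous_at_imp_continuous_on)
  show "g \<in> borel_measurable borel" "deriv g \<in> borel_measurable borel"
    using cg test_funs_deriv(2)[OF assms] by (auto intro: borel_measurable_continuous_onI)
qed

text \<open>The fundamental theorem on [x,b]: a test function vanishes at \<open>b\<close>, and the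
  endpoint is a null set. The indicators are arranged to match the Fubini kernel of the next
  lemma.\<close>

lemma integral_test_funs_deriv:
  assumes g: "g \<in> test_funs a b" and x: "x \<in> {a<..<b}"
  shows "(LINT t|lborel. indicator {a<..<b} t * (indicator {x..} t * deriv g t)) = - g x"
proof -
  have "(LINT t|lborel. indicator {x..b} t *\<^sub>R deriv g t) = g b - g x"
  proof (rule integral_FTC_atLeastAtMost)
    show "continuous_on {x..b} (deriv g)"
      using test_funs_deriv(2)[OF g] continuous_on_subset by blast
    show "(g has_vector_derivative deriv g t) (at t within {x..b})" for t
      using test_funs_deriv(1)[OF g] has_field_derivative_at_within has_real_derivative_iff_has_vector_derivative by blast
  qed (use x in auto)
  moreover have "(LINT t|lborel. indicator {a<..<b} t * (indicator {x..} t * deriv g t))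
     = (LINT t|lborel. indicator {x..b} t *\<^sub>R deriv g t)"
    using x by (intro integral_cong_AE) (use test_funs_measurable[OF g] in \<open>auto simp: indicator_def intro!: AE_I'[of "{b}"]\<close>)
  ultimately show ?thesis using test_funs_outside[OF g, of b] by simp
qed

text \<open>Fubini on the triangle x <= t, with - g x written as the integral of
  \<open>deriv g\<close> over (x,b). A general sigma-finite \<open>M\<close> serves both Lebesgue
  measure with an integrable density and a finite singular measure with a sign.\<close>

lemma integral_by_parts_test_funs:
  assumes M: "sigma_finite_measure M" and sets: "sets M = sets borel"
    and f: "integrable M f" and g: "g \<in> test_funs a b"
  shows "(LINT x|M. g x * f x)
      = - (LINT t:{a<..<b}|lebesgue. (LINT x:{a<..t}|M. f x) * deriv g t)"
    and "set_integrable lebesgue {a<..<b} (\<lambda>t. (LINT x:{a<..t}|M. f x) * deriv g t)"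
proof -
  interpret M: sigma_finite_measure M by fact
  interpret pair_sigma_finite M lborel ..
  note [measurable_cong] = sets
  have [measurable]: "g \<in> borel_measurable borel" "deriv g \<in> borel_measurable borel"
    using test_funs_measurable[OF g] .
  have [measurable]: "f \<in> borel_measurable M" using f by auto
  obtain K where K: "0 \<le> K" "\<And>x. x \<in> {a..b} \<Longrightarrow> \<bar>deriv g x\<bar> \<le> K"
    using test_funs_bounds[OF g] by metis
  define H where "H = (\<lambda>(x, t). indicator {a<..<b} x * f x *
      (indicator {a<..<b} t * (indicator {x..} t * deriv g t)))"
  have Hm [measurable]: "H \<in> borel_measurable (M \<Otimes>\<^sub>M lborel)"
  proof -
    \<comment> \<open>Turning \<open>indicator {x..} t\<close> into the condition x <= t exposes
      joint measurability in the pair.\<close>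
    have eq: "H = (\<lambda>(x, t). indicator {a<..<b} x * f x *
      (indicator {a<..<b} t * ((if x \<le> t then 1 else 0) * deriv g t)))"
      by (auto simp: H_def indicator_def)
    show ?thesis unfolding eq by measurable
  qed
  have iI: "integrable lborel (\<lambda>t. K * indicator {a<..<b} t)"
    by (cases "a \<le> b") auto
  have i1: "integrable lborel (\<lambda>t. indicator {a<..<b} t * (indicator {x..} t * deriv g t))" for x
    by (rule Bochner_Integration.integrable_bound[OF iI]) (use K in \<open>auto simp: indicator_def\<close>)
  have Hint: "integrable (M \<Otimes>\<^sub>M lborel) H"
  proof (rule Fubini_integrable[OF Hm])
    show "AE x in M. integrable lborel (\<lambda>t. H (x, t))"
      using i1 by (auto simp: H_def)
    show "integrable M (\<lambda>x. LINT t|lborel. norm (H (x, t)))"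
    proof (rule Bochner_Integration.integrable_bound[of M "\<lambda>x. f x * (K * (b - a))"], goal_cases)
      case 3
      show ?case
      proof (rule AE_I2)
        fix x
        have "(LINT t|lborel. norm (H (x, t))) \<le> (LINT t|lborel. \<bar>f x\<bar> * (K * indicator {a<..<b} t))"
        proof (rule integral_mono_AE')
          show "integrable lborel (\<lambda>t. \<bar>f x\<bar> * (K * indicator {a<..<b} t))"
            using iI by simp
          show "AE t in lborel. norm (H (x, t)) \<le> \<bar>f x\<bar> * (K * indicator {a<..<b} t)"
            using K by (auto simp: H_def indicator_def abs_mult intro!: mult_left_mono)
        qed (use K in auto)
        also have "\<dots> \<le> norm (f x * (K * (b - a)))"
          using K(1) by (cases "a \<le> b") (auto simp: abs_mult)
        finally show "norm (LINT t|lborel. norm (H (x, t))) \<le> norm (f x * (K * (b - a)))"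
          by (simp add: integral_nonneg_AE)
      qed
    qed (use f in auto)
  qed
  have 1: "(LINT t|lborel. H (x, t)) = - (g x * f x)" for x
    using integral_test_funs_deriv[OF g, of x] test_funs_outside[OF g, of x]
    by (cases "x \<in> {a<..<b}") (auto simp: H_def)
  have 2: "(LINT x|M. H (x, t)) = indicator {a<..<b} t *\<^sub>R ((LINT x:{a<..t}|M. f x) * deriv g t)" for t
  proof (cases "t \<in> {a<..<b}")
    case True
    then have "H (x, t) = (indicator {a<..t} x *\<^sub>R f x) * deriv g t" for x
      by (auto simp: H_def indicator_def)
    then show ?thesis using True by (simp add: set_lebesgue_integral_def)
  qed (simp add: H_def)
  have 3: "integrable lborel (\<lambda>t. LINT x|M. H (x, t))"
    using integrable_snd[of "\<lambda>x t. H (x, t)"] Hint by simp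
  have 4: "(LINT t|lborel. LINT x|M. H (x, t)) = (LINT x|M. LINT t|lborel. H (x, t))"
    using Fubini_integral[of "\<lambda>x t. H (x, t)"] Hint by simp
  show "set_integrable lebesgue {a<..<b} (\<lambda>t. (LINT x:{a<..t}|M. f x) * deriv g t)"
    using 3 unfolding 2 set_integrable_def
    by (subst integrable_completion) auto
  show "(LINT x|M. g x * f x)
      = - (LINT t:{a<..<b}|lebesgue. (LINT x:{a<..t}|M. f x) * deriv g t)"
    using 3 4 unfolding 1 2 set_lebesgue_integral_def
    by (subst integral_completion) auto
qed

section \<open>Signed set functions on the Borel sets\<close>

lemma set_integral_sums:
  fixes f :: "'a \<Rightarrow> real"
  assumes f: "integrable M f" and A: "range A \<subseteq> sets M" "disjoint_family A"
  shows "(\<lambda>i::nat. LINT x:A i|M. f x) sums (LINT x:(\<Union>i. A i)|M. f x)"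
proof -
  have int: "set_integrable M B f" if "B \<in> sets M" for B
    using integrable_mult_indicator[OF that f] by (simp add: set_integrable_def)
  have "(\<lambda>n. LINT x:(\<Union>i<n. A i)|M. f x) \<longlonglongrightarrow> (LINT x:(\<Union>n. \<Union>i<n. A i)|M. f x)"
  proof (rule set_integral_cont_up)
    show "incseq (\<lambda>n. \<Union>i<n. A i)" by (force simp: incseq_def)
    show "set_integrable M (\<Union>n. \<Union>i<n. A i) f" using A by (intro int) auto
  qed (use A in auto)
  moreover have "(\<Union>n. \<Union>i<n. A i) = (\<Union>i. A i)" by blast
  moreover have "(LINT x:(\<Union>i<n. A i)|M. f x) = (\<Sum>i<n. LINT x:A i|M. f x)" for n
  proof (rule set_integral_finite_Union)
    show "disjoint_family_on A {..<n}" using A(2) by (auto simp: disjoint_family_on_def)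
  qed (use A int in auto)
  ultimately show ?thesis by (simp add: sums_def)
qed

lemma sigma_additive_empty:
  fixes F :: "real set \<Rightarrow> real"
  assumes add: "\<And>A::nat \<Rightarrow> real set. range A \<subseteq> sets borel \<Longrightarrow> disjoint_family A \<Longrightarrow>
      (\<lambda>i. F (A i)) sums F (\<Union>i. A i)"
  shows "F {} = 0"
proof -
  have "summable (\<lambda>i::nat. F {})"
    using add[of "\<lambda>i. {}"] by (auto simp: disjoint_family_on_def sums_iff)
  then show ?thesis by (simp add: summable_const_iff)
qed

text \<open>Dynkin's argument: closed half-lines are stable under intersection and generate the
  Borel sets, and the sets on which \<open>F\<close> vanishes are closed under complement, because
  \<open>F UNIV = 0\<close>, and under countable disjoint unions. \<open>F\<close> may change
  sign.\<close>

lemma sigma_additive_eq_0: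
  fixes F :: "real set \<Rightarrow> real"
  assumes add: "\<And>A::nat \<Rightarrow> real set. range A \<subseteq> sets borel \<Longrightarrow> disjoint_family A \<Longrightarrow>
      (\<lambda>i. F (A i)) sums F (\<Union>i. A i)"
    and zero: "\<And>x. F {..x} = 0" and all: "F UNIV = 0" and E: "E \<in> sets borel"
  shows "F E = 0"
proof -
  note F0 = sigma_additive_empty[OF add]
  have diff: "F (UNIV - B) = F UNIV - F B" if "B \<in> sets borel" for B
  proof -
    have "(\<lambda>i. F (binaryset B (UNIV - B) i)) sums F (\<Union>i. binaryset B (UNIV - B) i)"
      using that by (intro add) (auto simp: range_binaryset_eq disjoint_family_on_def binaryset_def)
    moreover have "(\<lambda>i. F (binaryset B (UNIV - B) i)) sums (F B + F (UNIV - B))"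
      using F0 by (intro binaryset_sums)
    ultimately show ?thesis using sums_unique2 by (fastforce simp: UN_binaryset_eq)
  qed
  have "Int_stable (range (\<lambda>x::real. {..x}))"
    by (auto simp: Int_stable_def)
  moreover have "range (\<lambda>x::real. {..x}) \<subseteq> Pow UNIV" by simp
  moreover have "E \<in> sigma_sets UNIV (range (\<lambda>x::real. {..x}))"
    using E by (simp add: borel_eq_atMost)
  ultimately show ?thesis
  proof (induction rule: sigma_sets_induct_disjoint)
    case (compl A)
    then have "A \<in> sets borel" by (simp add: borel_eq_atMost)
    with compl show ?case using diff all by simp
  next
    case (union A)
    then have "range A \<subseteq> sets borel" by (simp add: borel_eq_atMost)
    from add[OF this union(1)] union(3) show ?case by (simp add: sums_iff)
  qed (use zero F0 in auto)
qed

text \<open>A half-line meets (a,b) in the empty set, in some (a,x], or in all of (a,b). The value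
  on the last set is not given directly and comes from the left limit at \<open>b\<close>.\<close>

lemma sigma_additive_eq_0_interval:
  fixes F :: "real set \<Rightarrow> real"
  assumes add: "\<And>A::nat \<Rightarrow> real set. range A \<subseteq> sets borel \<Longrightarrow> disjoint_family A \<Longrightarrow>
      (\<lambda>i. F (A i)) sums F (\<Union>i. A i)"
    and ab: "a < b"
    and local: "\<And>E. E \<in> sets borel \<Longrightarrow> F E = F (E \<inter> {a<..<b})"
    and lim: "((\<lambda>x. F {a<..x}) \<longlongrightarrow> F {a<..<b}) (at_left b)"
    and zero: "\<And>x. x \<in> {a<..<b} \<Longrightarrow> F {a<..x} = 0" and E: "E \<in> sets borel"
  shows "F E = 0"
proof -
  have "\<forall>\<^sub>F x in at_left b. F {a<..x} = 0"
    using eventually_at_left_real[OF ab] by eventually_elim (rule zero, auto)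
  then have I: "F {a<..<b} = 0"
    using tendsto_unique[OF _ lim tendsto_eventually] trivial_limit_at_left_real by blast
  show ?thesis
  proof (rule sigma_additive_eq_0[OF add _ _ E])
    show "F UNIV = 0" using local[of UNIV] I by simp
    show "F {..x} = 0" for x
    proof -
      consider "x \<le> a" | "x \<in> {a<..<b}" | "x \<ge> b" by fastforce
      then show ?thesis
      proof cases
        case 1
        then have "{..x} \<inter> {a<..<b} = {}" by auto
        then show ?thesis using local[of "{..x}"] sigma_additive_empty[OF add] by simp
      next
        case 2
        then have "{..x} \<inter> {a<..<b} = {a<..x}" by auto
        then show ?thesis using local[of "{..x}"] zero[OF 2] by simp
      next
        case 3
        then have "{..x} \<inter> {a<..<b} = {a<..<b}" by auto
        then show ?thesis using local[of "{..x}"] I by simp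
      qed
    qed
  qed
qed

text \<open>The sets (a,x] shrink to (a,x0] as x decreases to x0, so an atom of \<open>M\<close> at
  x0 is counted in the limit.\<close>

lemma tendsto_set_integral_Ioc_right:
  fixes f :: "real \<Rightarrow> real"
  assumes f: "integrable M f" and sets: "sets M = sets borel"
  shows "((\<lambda>x. LINT y:{a<..x}|M. f y) \<longlongrightarrow> (LINT y:{a<..x0}|M. f y)) (at_right x0)"
  unfolding tendsto_at_iff_sequentially comp_def
proof (intro allI impI)
  fix X :: "nat \<Rightarrow> real" assume X: "\<forall>i. X i \<in> {x0<..} - {x0}" "X \<longlonglongrightarrow> x0"
  note [measurable_cong] = sets
  have [measurable]: "f \<in> borel_measurable M" using f by auto
  show "(\<lambda>i. LINT y:{a<..X i}|M. f y) \<longlonglongrightarrow> (LINT y:{a<..x0}|M. f y)"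
    unfolding set_lebesgue_integral_def
  proof (rule integral_dominated_convergence[where w="\<lambda>y. \<bar>f y\<bar>"])
    show "AE y in M. (\<lambda>i. indicator {a<..X i} y *\<^sub>R f y) \<longlonglongrightarrow> indicator {a<..x0} y *\<^sub>R f y"
    proof (rule AE_I2)
      fix y
      have "\<forall>\<^sub>F i in sequentially. indicator {a<..x0} y *\<^sub>R f y = indicator {a<..X i} y *\<^sub>R f y"
      proof (cases "y \<le> x0")
        case True
        then have "y \<le> X i" for i using X(1)[rule_format, of i] by auto
        then show ?thesis using True by (auto simp: indicator_def)
      next
        case False
        then have "\<forall>\<^sub>F i in sequentially. X i < y" using order_tendstoD(2)[OF X(2), of y] by simp
        then show ?thesis by (rule eventually_mono) (use False in \<open>auto simp: indicator_def\<close>)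
      qed
      then show "(\<lambda>i. indicator {a<..X i} y *\<^sub>R f y) \<longlonglongrightarrow> indicator {a<..x0} y *\<^sub>R f y"
        by (rule Lim_transform_eventually[rotated]) simp
    qed
  qed (use f in \<open>auto simp: indicator_def\<close>)
qed

text \<open>From the left the sets exhaust only (a,x0), so an atom at x0 is lost. The difference to
  the right limit is the jump of the primitive.\<close>

lemma tendsto_set_integral_Ioc_left:
  fixes f :: "real \<Rightarrow> real"
  assumes f: "integrable M f" and sets: "sets M = sets borel"
  shows "((\<lambda>x. LINT y:{a<..x}|M. f y) \<longlongrightarrow> (LINT y:{a<..<x0}|M. f y)) (at_left x0)"
  unfolding tendsto_at_iff_sequentially comp_def
proof (intro allI impI)
  fix X :: "nat \<Rightarrow> real" assume X: "\<forall>i. X i \<in> {..<x0} - {x0}" "X \<longlonglongrightarrow> x0"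
  note [measurable_cong] = sets
  have [measurable]: "f \<in> borel_measurable M" using f by auto
  show "(\<lambda>i. LINT y:{a<..X i}|M. f y) \<longlonglongrightarrow> (LINT y:{a<..<x0}|M. f y)"
    unfolding set_lebesgue_integral_def
  proof (rule integral_dominated_convergence[where w="\<lambda>y. \<bar>f y\<bar>"])
    show "AE y in M. (\<lambda>i. indicator {a<..X i} y *\<^sub>R f y) \<longlonglongrightarrow> indicator {a<..<x0} y *\<^sub>R f y"
    proof (rule AE_I2)
      fix y
      have "\<forall>\<^sub>F i in sequentially. indicator {a<..<x0} y *\<^sub>R f y = indicator {a<..X i} y *\<^sub>R f y"
      proof (cases "y < x0")
        case False
        then have "\<not> y \<le> X i" for i using X(1)[rule_format, of i] by auto
        then show ?thesis using False by (auto simp: indicator_def)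
      next
        case True
        then have "\<forall>\<^sub>F i in sequentially. y < X i" using order_tendstoD(1)[OF X(2), of y] by simp
        then show ?thesis by (rule eventually_mono) (use True in \<open>auto simp: indicator_def\<close>)
      qed
      then show "(\<lambda>i. indicator {a<..X i} y *\<^sub>R f y) \<longlonglongrightarrow> indicator {a<..<x0} y *\<^sub>R f y"
        by (rule Lim_transform_eventually[rotated]) simp
    qed
  qed (use f in \<open>auto simp: indicator_def\<close>)
qed

text \<open>Members of \<open>L1\<close> are only Lebesgue measurable and arbitrary off the
  interval. A Borel representative extended by 0 makes Fubini and density arguments with
  \<open>lborel\<close> available.\<close>

lemma L1_borel:
  assumes "u \<in> L1 a b"
  obtains u' where "integrable lborel u'" "\<And>x. x \<notin> {a<..<b} \<Longrightarrow> u' x = 0"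
    "AE x in lborel. x \<in> {a<..<b} \<longrightarrow> u x = u' x"
proof -
  let ?f = "\<lambda>x. indicator {a<..<b} x *\<^sub>R u x"
  have int: "integrable lebesgue ?f" using assms by (simp add: L1_def set_integrable_def)
  then obtain v where v: "v \<in> borel_measurable lborel" "AE x in lborel. ?f x = v x"
    using completion_ex_borel_measurable_real by blast
  let ?v = "\<lambda>x. indicator {a<..<b} x * v x"
  have [measurable]: "v \<in> borel_measurable borel" using v by simp
  show ?thesis
  proof (rule that[of ?v])
    have ae: "AE x in lborel. ?f x = ?v x" using v(2)
    proof eventually_elim
      case (elim x)
      then show ?case by (cases "x \<in> {a<..<b}") auto
    qed
    have "?v \<in> borel_measurable lborel" by measurable
    then have "?v \<in> borel_measurable lebesgue" by (rule measurable_completion)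
    then have "integrable lebesgue ?v"
      by (rule integrable_cong_AE_imp[OF int _ AE_completion[OF ae]])
    then show "integrable lborel ?v" by (subst (asm) integrable_completion) auto
    show "AE x in lborel. x \<in> {a<..<b} \<longrightarrow> u x = ?v x"
      using ae by eventually_elim auto
  qed auto
qed

lemma L1_integral_borel:
  assumes u: "u \<in> L1 a b" and u': "u' \<in> borel_measurable borel" and ae: "AE x in lborel. x \<in> {a<..<b} \<longrightarrow> u x = u' x"
    and h: "h \<in> borel_measurable borel" and S: "S \<in> sets borel" "S \<subseteq> {a<..<b}"
  shows "(LINT x:S|lebesgue. u x * h x) = (LINT x:S|lborel. u' x * h x)"
proof -
  have [measurable]: "(\<lambda>x. indicator {a<..<b} x *\<^sub>R u x) \<in> borel_measurable lebesgue"
    using u by (auto simp: L1_def set_integrable_def)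
  note [measurable] = u' h S(1)
  have [measurable]: "h \<in> borel_measurable lebesgue" "S \<in> sets lebesgue" "u' \<in> borel_measurable lebesgue"
    using h S u' by (auto intro: measurable_completion)
  have "(\<lambda>x. indicator S x * ((indicator {a<..<b} x *\<^sub>R u x) * h x)) \<in> borel_measurable lebesgue"
    by measurable
  \<comment> \<open>Off (a,b) nothing is known about \<open>u\<close>, so measurability is taken
    over from its truncation.\<close>
  also have "(\<lambda>x. indicator S x * ((indicator {a<..<b} x *\<^sub>R u x) * h x)) = (\<lambda>x. indicator S x *\<^sub>R (u x * h x))"
  proof
    fix x show "indicator S x * ((indicator {a<..<b} x *\<^sub>R u x) * h x) = indicator S x *\<^sub>R (u x * h x)"
      using S(2) by (cases "x \<in> S") auto
  qed
  finally have m: "(\<lambda>x. indicator S x *\<^sub>R (u x * h x)) \<in> borel_measurable lebesgue" .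
  have "(LINT x:S|lebesgue. u x * h x) = (LINT x:S|lebesgue. u' x * h x)"
    unfolding set_lebesgue_integral_def
    by (rule integral_cong_AE[OF m])
       (use ae S in \<open>auto intro!: AE_completion elim!: eventually_mono simp: indicator_def\<close>)
  then show ?thesis
    unfolding set_lebesgue_integral_def by (subst (asm) integral_completion) auto
qed

text \<open>Mean zero is what makes the antiderivative normalised at \<open>\<alpha>\<close> vanish
  beyond \<open>\<beta>\<close> as well, so that its support is compact in (a,b).\<close>

lemma test_fun_primitive:
  assumes k: "continuous_on UNIV k" "\<And>t. t \<notin> {\<alpha><..<\<beta>} \<Longrightarrow> k t = 0" and ab: "a < \<alpha>" "\<alpha> < \<beta>" "\<beta> < b"
    and int: "(LINT t|lborel. k t) = 0"
  obtains g where "g \<in> test_funs a b" "deriv g = k"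
proof -
  have "\<exists>F. \<forall>x. -\<infinity> < ereal x \<longrightarrow> ereal x < \<infinity> \<longrightarrow> (F has_vector_derivative k x) (at x)"
    by (rule einterval_antiderivative) (use k(1) in \<open>auto simp: continuous_on_eq_continuous_at\<close>)
  then obtain F where F: "\<And>x. (F has_vector_derivative k x) (at x)" by auto
  have FTC: "(LINT t|lborel. indicator {x..y} t *\<^sub>R k t) = F y - F x" if "x \<le> y" for x y
    using that has_vector_derivative_at_within[OF F] continuous_on_subset[OF k(1) subset_UNIV]
    by (intro integral_FTC_atLeastAtMost)
  define g where "g = (\<lambda>x. F x - F \<alpha>)"
  have gd: "(g has_vector_derivative k x) (at x)" for x
    using has_vector_derivative_diff[OF F[of x] has_vector_derivative_const[of "F \<alpha>"]] by (simp add: g_def)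
  have z1: "g x = 0" if "x \<le> \<alpha>" for x
  proof -
    have "indicator {x..\<alpha>} t *\<^sub>R k t = 0" for t
      using k(2)[of t] by (auto simp: indicator_def)
    then have "(LINT t|lborel. indicator {x..\<alpha>} t *\<^sub>R k t) = 0"
      by (simp only: Bochner_Integration.integral_zero)
    with FTC[OF that] show ?thesis by (simp add: g_def)
  qed
  have z2: "g x = 0" if "x \<ge> \<beta>" for x
  proof -
    have "(LINT t|lborel. indicator {\<alpha>..x} t *\<^sub>R k t) = (LINT t|lborel. k t)"
    proof (intro Bochner_Integration.integral_cong refl)
      fix t show "indicator {\<alpha>..x} t *\<^sub>R k t = k t"
        using k(2)[of t] that by (cases "t \<in> {\<alpha><..<\<beta>}") (auto simp: indicator_def)
    qed
    with FTC[of \<alpha> x] ab that int show ?thesis by (simp add: g_def)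
  qed
  have "{x. g x \<noteq> 0} \<subseteq> {\<alpha>..\<beta>}" 
  proof
    fix x assume "x \<in> {x. g x \<noteq> 0}"
    then show "x \<in> {\<alpha>..\<beta>}" using z1[of x] z2[of x] by (cases "x \<le> \<alpha>"; cases "x \<ge> \<beta>") auto
  qed
  then have "closure {x. g x \<noteq> 0} \<subseteq> {\<alpha>..\<beta>}" by (intro closure_minimal) auto
  also have "\<dots> \<subseteq> {a<..<b}" using ab by auto
  finally have "g \<in> test_funs a b"
    unfolding test_funs_def C1_differentiable_on_def mem_Collect_eq
    by (intro conjI exI[of _ k]) (use gd k(1) in simp_all)
  moreover have "deriv g = k"
    using gd by (intro ext DERIV_imp_deriv) (simp add: has_real_derivative_iff_has_vector_derivative)
  ultimately show ?thesis by (rule that)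
qed

section \<open>Functions with vanishing weak derivative\<close>

text \<open>Continuous trapezoids approximating the indicator of (a,x). Their support starts at a +
  1/n because test functions vanish near \<open>a\<close>; in the application x < b leaves room at
  the other end.\<close>

lemma tent_approx:
  fixes x a :: real assumes "0 < n"
  defines "h \<equiv> (\<lambda>t. min 1 (real n * max 0 (min (t - (a + 1 / real n)) (x - t))))"
  shows "continuous_on UNIV h" "\<And>t. t \<notin> {a + 1 / real n<..<x} \<Longrightarrow> h t = 0" "\<And>t. 0 \<le> h t" "\<And>t. h t \<le> 1"
proof -
  show "continuous_on UNIV h" unfolding h_def by (intro continuous_intros)
  show "h t = 0" if "t \<notin> {a + 1 / real n<..<x}" for t
  proof -
    have "min (t - (a + 1 / real n)) (x - t) \<le> 0" using that by auto
    then show ?thesis by (simp add: h_def max_absorb1)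
  qed
  show "0 \<le> h t" "h t \<le> 1" for t by (auto simp: h_def)
qed

lemma tent_approx_tendsto:
  fixes x a t :: real
  shows "(\<lambda>n. min 1 (real n * max 0 (min (t - (a + 1 / real n)) (x - t)))) \<longlonglongrightarrow> indicator {a<..<x} t"
proof (cases "t \<in> {a<..<x}")
  case True
  \<comment> \<open>Half the distance of \<open>t\<close> to the complement of the interval: once
    1/n < d, both distances in the trapezoid are still at least d, and n d >= 1 reaches the
    cap.\<close>
  define d where "d = min (t - a) (x - t) / 2"
  have d: "d > 0" using True by (auto simp: d_def)
  have "\<forall>\<^sub>F n in sequentially. 1 / real n < d"
    using order_tendstoD(2)[OF lim_1_over_n d] by simp
  moreover have "\<forall>\<^sub>F n in sequentially. n > 0" by (rule eventually_gt_at_top)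
  ultimately have "\<forall>\<^sub>F n in sequentially. min 1 (real n * max 0 (min (t - (a + 1 / real n)) (x - t))) = 1"
  proof eventually_elim
    case (elim n)
    have "d \<le> min (t - (a + 1 / real n)) (x - t)"
      using elim(1) True unfolding d_def min_def by (auto split: if_splits)
    then have "real n * d \<le> real n * max 0 (min (t - (a + 1 / real n)) (x - t))"
      by (intro mult_left_mono) (auto simp: max_def)
    moreover have "1 \<le> real n * d" using elim by (simp add: field_simps)
    ultimately show ?case by linarith
  qed
  then show ?thesis using True by (intro tendsto_eventually) auto
next
  case False
  have "min 1 (real n * max 0 (min (t - (a + 1 / real n)) (x - t))) = 0" for n
  proof -
    have "0 \<le> 1 / real n" by simp
    then have "t - (a + 1 / real n) \<le> 0 \<or> x - t \<le> 0" using False by (simp; linarith)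
    then have "min (t - (a + 1 / real n)) (x - t) \<le> 0" by (simp only: min_le_iff_disj)
    then show ?thesis by (simp add: max_absorb1)
  qed
  then show ?thesis using False by simp
qed

lemma integrable_bounded_support:
  fixes h :: "real \<Rightarrow> real"
  assumes "continuous_on UNIV h" "\<And>t. t \<notin> {\<alpha>..\<beta>} \<Longrightarrow> h t = 0"
  shows "integrable lborel h"
proof -
  have "set_integrable lborel {\<alpha>..\<beta>} h"
    using assms(1) by (intro borel_integrable_atLeastAtMost') (auto intro: continuous_on_subset)
  moreover have "(\<lambda>t. indicator {\<alpha>..\<beta>} t *\<^sub>R h t) = h"
  proof
    show "indicator {\<alpha>..\<beta>} t *\<^sub>R h t = h t" for t using assms(2)[of t] by (cases "t \<in> {\<alpha>..\<beta>}") auto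
  qed
  ultimately show ?thesis by (simp add: set_integrable_def)
qed

text \<open>The du Bois-Reymond lemma. Subtracting a multiple of one fixed bump gives a compactly
  supported continuous \<open>h\<close> mean zero and so makes it the derivative of a test function;
  hence \<open>u\<close> integrates \<open>h\<close> like a constant. Approximation passes to the
  indicators of (a,x), which determine \<open>u\<close>.\<close>

lemma weak_deriv_zero_imp_const:
  assumes u: "u \<in> L1 a b"
    and zero: "\<And>g. g \<in> test_funs a b \<Longrightarrow> (LINT x:{a<..<b}|lebesgue. u x * deriv g x) = 0"
  obtains c where "AE x in lborel. x \<in> {a<..<b} \<longrightarrow> u x = c"
proof (cases "a < b")
  case False
  then show ?thesis using that[of 0] by auto
next
  case True
  obtain u' where u': "integrable lborel u'" "\<And>x. x \<notin> {a<..<b} \<Longrightarrow> u' x = 0"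
    "AE x in lborel. x \<in> {a<..<b} \<longrightarrow> u x = u' x" using L1_borel[OF u] by blast
  have [measurable]: "u' \<in> borel_measurable borel" using u'(1) by auto
  have supp: "indicator {a<..<b} x *\<^sub>R (u' x * y) = u' x * y" for x y
    using u'(2)[of x] by (cases "x \<in> {a<..<b}") auto
  have zero': "(LINT x|lborel. u' x * deriv g x) = 0" if "g \<in> test_funs a b" for g
    using L1_integral_borel[OF u _ u'(3), of "deriv g" "{a<..<b}"] zero[OF that] test_funs_measurable[OF that]
    unfolding set_lebesgue_integral_def[of lborel] supp by auto
  have uh: "integrable lborel (\<lambda>x. u' x * h x)" if h: "h \<in> borel_measurable borel" "\<And>x. \<bar>h x\<bar> \<le> K" for h K
  proof (rule Bochner_Integration.integrable_bound[of _ "\<lambda>x. K * u' x"])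
    show "AE x in lborel. norm (u' x * h x) \<le> norm (K * u' x)"
    proof (rule AE_I2)
      fix x have "\<bar>u' x\<bar> * \<bar>h x\<bar> \<le> \<bar>u' x\<bar> * \<bar>K\<bar>" using h(2)[of x] by (intro mult_left_mono) auto
      then show "norm (u' x * h x) \<le> norm (K * u' x)" by (simp add: abs_mult mult.commute)
    qed
  qed (use h u'(1) in auto)
  \<comment> \<open>With a quarter of the length, the bump of half-width \<open>\<delta>\<close>
    about the midpoint is supported well inside the interval.\<close>
  define \<delta> where "\<delta> = (b - a) / 4"
  have \<delta>: "\<delta> > 0" using True by (simp add: \<delta>_def)
  define \<eta> where "\<eta> = (\<lambda>t. max 0 (\<delta> - \<bar>t - (a + b) / 2\<bar>))"
  have \<eta>c: "continuous_on UNIV \<eta>" unfolding \<eta>_def by (intro continuous_intros)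
  have \<eta>z: "\<eta> t = 0" if "t \<notin> {a + \<delta><..<b - \<delta>}" for t
    using that by (auto simp: \<eta>_def \<delta>_def max_def abs_if field_simps)
  have \<eta>i: "integrable lborel \<eta>"
    by (rule integrable_bounded_support[OF \<eta>c, of "a + \<delta>" "b - \<delta>"]) (use \<eta>z in auto)
  have \<eta>b: "\<bar>\<eta> t\<bar> \<le> \<delta>" for t using \<delta> by (auto simp: \<eta>_def)
  have \<eta>m: "\<eta> \<in> borel_measurable borel" using \<eta>i by auto
  have \<eta>p: "(LINT t|lborel. \<eta> t) > 0"
  proof -
    let ?J = "{(a + b) / 2 - \<delta> / 2..(a + b) / 2 + \<delta> / 2}"
    have "0 < \<delta> / 2 * \<delta>" using \<delta> by simp
    also have "\<dots> = (LINT t|lborel. \<delta> / 2 * indicator ?J t)" using \<delta> by simp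
    also have "\<dots> \<le> (LINT t|lborel. \<eta> t)"
    proof (rule integral_mono)
      show "integrable lborel (\<lambda>t. \<delta> / 2 * indicator ?J t)"
        by (intro integrable_mult_right integrable_real_indicator) (auto simp: emeasure_lborel_Icc_eq)
      show "\<delta> / 2 * indicator ?J t \<le> \<eta> t" for t
        using \<delta> by (cases "t \<in> ?J") (auto simp: \<eta>_def abs_if field_simps)
    qed fact
    finally show ?thesis .
  qed
  \<comment> \<open>The only possible value: the identity in \<open>key\<close> must hold for the
    bump itself.\<close>
  define c where "c = (LINT t|lborel. u' t * \<eta> t) / (LINT t|lborel. \<eta> t)"
  have key: "(LINT t|lborel. u' t * h t) = c * (LINT t|lborel. h t)"
    if h: "continuous_on UNIV h" "\<And>t. t \<notin> {\<alpha><..<\<beta>} \<Longrightarrow> h t = 0" "\<And>t. \<bar>h t\<bar> \<le> 1" and ab: "a < \<alpha>" "\<alpha> < \<beta>" "\<beta> < b"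
    for h \<alpha> \<beta>
  proof -
    have hi: "integrable lborel h"
      by (rule integrable_bounded_support[OF h(1), of \<alpha> \<beta>]) (use h in auto)
    have hm: "h \<in> borel_measurable borel" using hi by auto
    define r where "r = (LINT t|lborel. h t) / (LINT t|lborel. \<eta> t)"
    define k where "k = (\<lambda>t. h t - r * \<eta> t)"
    obtain g where g: "g \<in> test_funs a b" "deriv g = k"
    proof (rule test_fun_primitive[of k "min \<alpha> (a + \<delta>)" "max \<beta> (b - \<delta>)" a b])
      show "continuous_on UNIV k" unfolding k_def by (intro continuous_intros h \<eta>c)
      show "k t = 0" if "t \<notin> {min \<alpha> (a + \<delta>)<..<max \<beta> (b - \<delta>)}" for t
      proof -
        have "t \<notin> {\<alpha><..<\<beta>}" "t \<notin> {a + \<delta><..<b - \<delta>}" using that by auto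
        then show ?thesis using h(2)[of t] \<eta>z[of t] by (simp add: k_def)
      qed
      show "(LINT t|lborel. k t) = 0"
        using hi \<eta>i \<eta>p by (simp add: k_def r_def)
    qed (use ab \<delta> in auto)
    from zero'[OF g(1)] have "0 = (LINT t|lborel. u' t * h t - r * (u' t * \<eta> t))"
      unfolding g(2) k_def by (simp add: algebra_simps)
    also have "\<dots> = (LINT t|lborel. u' t * h t) - r * (LINT t|lborel. u' t * \<eta> t)"
      using uh[OF hm h(3)] uh[OF \<eta>m \<eta>b] by simp
    finally show ?thesis by (simp add: r_def c_def)
  qed
  have Ioo: "(LINT t|lborel. u' t * indicator {a<..<x} t) = c * (x - a)" if x: "x \<in> {a<..<b}" for x
  proof -
    define h where "h = (\<lambda>n t. min 1 (real n * max 0 (min (t - (a + 1 / real n)) (x - t))))"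
    have lim: "(\<lambda>n. h n t) \<longlonglongrightarrow> indicator {a<..<x} t" for t
      unfolding h_def by (rule tent_approx_tendsto)
    have h: "continuous_on UNIV (h n)" "\<And>t. t \<notin> {a + 1 / real n<..<x} \<Longrightarrow> h n t = 0"
      "\<And>t. 0 \<le> h n t" "\<And>t. h n t \<le> 1" if "n > 0" for n
      using tent_approx[OF that] unfolding h_def by blast+
    have [measurable]: "h n \<in> borel_measurable borel" for n
      unfolding h_def by measurable
    have hb: "\<bar>h n t\<bar> \<le> indicator {a<..<x} t" for n t
    proof (cases "n > 0 \<and> t \<in> {a + 1 / real n<..<x}")
      case True
      then have "a < a + 1 / real n" by simp
      also have "\<dots> < t" using True by simp
      finally have "t \<in> {a<..<x}" using True by simp
      with h(3,4)[of n t] True show ?thesis by auto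
    next
      case False
      then have "h n t = 0" using h(2)[of n t] by (cases "n > 0") (auto simp: h_def)
      then show ?thesis by simp
    qed
    have lim1: "(\<lambda>n. LINT t|lborel. u' t * h n t) \<longlonglongrightarrow> (LINT t|lborel. u' t * indicator {a<..<x} t)"
    proof (rule integral_dominated_convergence[where w="\<lambda>t. \<bar>u' t\<bar>"])
      show "AE t in lborel. norm (u' t * h n t) \<le> \<bar>u' t\<bar>" for n
      proof (rule AE_I2)
        fix t have "\<bar>h n t\<bar> \<le> 1" using order_trans[OF hb[of n t] indicator_le_1] by simp
        then show "norm (u' t * h n t) \<le> \<bar>u' t\<bar>" by (simp add: abs_mult mult_left_le)
      qed
      show "AE t in lborel. (\<lambda>n. u' t * h n t) \<longlonglongrightarrow> u' t * indicator {a<..<x} t"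
        by (intro AE_I2 tendsto_intros lim)
    qed (use u'(1) in auto)
    have lim2: "(\<lambda>n. c * (LINT t|lborel. h n t)) \<longlonglongrightarrow> c * (LINT t|lborel. indicator {a<..<x} t)"
    proof (intro tendsto_intros integral_dominated_convergence[where w="indicator {a<..<x}"])
      show "AE t in lborel. (\<lambda>n. h n t) \<longlonglongrightarrow> indicator {a<..<x} t"
        by (intro AE_I2 lim)
    qed (use hb x in auto)
    \<comment> \<open>A trapezoid is admissible in \<open>key\<close> only once n > 0 and its
      support (a + 1/n, x) is nonempty.\<close>
    have ev: "\<forall>\<^sub>F n in sequentially. c * (LINT t|lborel. h n t) = (LINT t|lborel. u' t * h n t)"
    proof -
      have "\<forall>\<^sub>F n in sequentially. 1 / real n < x - a"
        using order_tendstoD(2)[OF lim_1_over_n, of "x - a"] x by simp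
      moreover have "\<forall>\<^sub>F n in sequentially. n > 0" by (rule eventually_gt_at_top)
      ultimately show ?thesis
      proof eventually_elim
        case (elim n)
        have "\<bar>h n t\<bar> \<le> 1" for t using h(3,4)[OF elim(2), of t] by auto
        then show ?case
          using key[OF h(1)[OF elim(2)] h(2)[OF elim(2)]] elim x by simp
      qed
    qed
    show ?thesis using LIMSEQ_unique[OF Lim_transform_eventually[OF lim2 ev] lim1] x by simp
  qed
  define f where "f = (\<lambda>t. u' t - c * indicator {a<..<b} t)"
  have fi: "integrable lborel f" unfolding f_def using u'(1) True by simp
  define F where "F = (\<lambda>E. LINT t:E|lborel. f t)"
  have Fx: "F {a<..x} = 0" if x: "x \<in> {a<..<b}" for x
  proof -
    have "F {a<..x} = (LINT t:{a<..<x}|lborel. f t)"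
      unfolding F_def by (rule set_integral_discrete_difference[where X="{x}"]) auto
    also have "\<dots> = (LINT t|lborel. u' t * indicator {a<..<x} t - c * indicator {a<..<x} t)"
      unfolding set_lebesgue_integral_def f_def using x
      by (intro Bochner_Integration.integral_cong) (auto simp: indicator_def)
    also have "\<dots> = 0"
      using Ioo[OF x] x uh[of "indicator {a<..<x}" 1] by simp
    finally show ?thesis .
  qed
  have lim: "((\<lambda>x. F {a<..x}) \<longlongrightarrow> F {a<..<b}) (at_left b)"
    unfolding F_def by (rule tendsto_set_integral_Ioc_left[OF fi]) simp
  have Fint: "F E = F (E \<inter> {a<..<b})" for E
    unfolding F_def set_lebesgue_integral_def f_def using u'(2)
    by (intro Bochner_Integration.integral_cong) (auto simp: indicator_def)
  have add: "(\<lambda>i. F (A i)) sums F (\<Union>i. A i)" if "range A \<subseteq> sets borel" "disjoint_family A" for A :: "nat \<Rightarrow> real set"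
    unfolding F_def by (rule set_integral_sums[OF fi]) (use that in auto)
  have F0: "F E = 0" if "E \<in> sets borel" for E
    using add True Fint lim Fx that by (rule sigma_additive_eq_0_interval)
  have "AE t in lborel. f t = 0"
    by (rule density_unique_real[OF fi]) (use F0 in \<open>auto simp: F_def\<close>)
  with u'(3) have "AE x in lborel. x \<in> {a<..<b} \<longrightarrow> u x = c"
    by eventually_elim (auto simp: f_def)
  then show ?thesis by (rule that)
qed

section \<open>Primitives and traces\<close>

lemma set_integral_Ioc_measurable:
  fixes f :: "real \<Rightarrow> real"
  assumes M: "sigma_finite_measure M" and sets: "sets M = sets borel" and f: "f \<in> borel_measurable M"
  shows "(\<lambda>x. LINT y:{a<..x}|M. f y) \<in> borel_measurable borel"
proof -
  interpret sigma_finite_measure M by fact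
  note [measurable_cong] = sets
  note [measurable] = f
  have "(\<lambda>x. LINT y|M. (if a < y \<and> y \<le> x then f y else 0)) \<in> borel_measurable borel"
    by measurable
  also have "(\<lambda>x. LINT y|M. (if a < y \<and> y \<le> x then f y else 0)) = (\<lambda>x. LINT y:{a<..x}|M. f y)"
    unfolding set_lebesgue_integral_def
    by (intro ext Bochner_Integration.integral_cong) (auto simp: indicator_def)
  finally show ?thesis .
qed

lemma bounded_borel_L1:
  assumes "h \<in> borel_measurable borel" "\<And>x. \<bar>h x\<bar> \<le> K"
  shows "h \<in> L1 a b"
proof -
  have "integrable lborel (\<lambda>x. indicator {a<..<b} x *\<^sub>R h x)"
  proof (rule Bochner_Integration.integrable_bound[of _ "\<lambda>x. K * indicator {a<..<b} x"])
    show "integrable lborel (\<lambda>x. K * indicator {a<..<b} x)"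
      by (cases "a \<le> b") auto
    show "AE x in lborel. norm (indicator {a<..<b} x *\<^sub>R h x) \<le> norm (K * indicator {a<..<b} x)"
      using order_trans[OF assms(2) abs_ge_self] by (auto simp: indicator_def)
  qed (use assms(1) in auto)
  then show ?thesis using assms(1)
    unfolding L1_def set_integrable_def by (simp add: integrable_completion)
qed

lemma set_integral_Ioc_L1:
  fixes f :: "real \<Rightarrow> real"
  assumes M: "sigma_finite_measure M" and sets: "sets M = sets borel" and f: "integrable M f"
  shows "(\<lambda>x. LINT y:{c<..x}|M. f y) \<in> L1 a b"
proof (rule bounded_borel_L1)
  show "(\<lambda>x. LINT y:{c<..x}|M. f y) \<in> borel_measurable borel"
    by (rule set_integral_Ioc_measurable[OF M sets]) (use f in auto)
  show "\<bar>LINT y:{c<..x}|M. f y\<bar> \<le> (LINT y|M. \<bar>f y\<bar>)" for x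
  proof -
    have "norm (LINT y:{c<..x}|M. f y) \<le> (LINT y|M. norm (indicator {c<..x} y *\<^sub>R f y))"
      unfolding set_lebesgue_integral_def by (rule integral_norm_bound)
    also have "\<dots> \<le> (LINT y|M. \<bar>f y\<bar>)"
      by (rule integral_mono_AE') (use f in \<open>auto simp: indicator_def\<close>)
    finally show ?thesis by simp
  qed
qed

lemma sign_fun_integrable:
  assumes "finite_borel_on a b \<nu>" "sign_fun \<sigma>"
  shows "integrable \<nu> \<sigma>"
proof -
  interpret finite_measure \<nu> using assms by (simp add: finite_borel_on_def)
  have [measurable_cong]: "sets \<nu> = sets borel" using assms(1) by (simp add: finite_borel_on_def)
  have [measurable]: "\<sigma> \<in> borel_measurable borel" using assms(2) by (simp add: sign_fun_def)
  show ?thesis by (rule integrable_const_bound[of _ 1]) (use assms(2) in \<open>auto simp: sign_fun_def\<close>)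
qed

text \<open>For integrable \<open>p\<close> and finite \<open>\<nu>\<close> this is the
  right-continuous representative with right limit 0 at \<open>a\<close>. The interval is closed at
  \<open>x\<close>, so an atom of \<open>\<nu>\<close> counts from its own point on.\<close>

definition primitive :: "real \<Rightarrow> (real \<Rightarrow> real) \<Rightarrow> real measure \<Rightarrow> (real \<Rightarrow> real) \<Rightarrow> real \<Rightarrow> real" where
  "primitive a p \<nu> \<sigma> x = (LINT y:{a<..x}|lborel. p y) + (LINT y:{a<..x}|\<nu>. \<sigma> y)"

text \<open>Integration by parts, for the density and the singular part separately, shows that the
  primitive has the weak derivative of \<open>u\<close>; the difference is constant by the du
  Bois-Reymond lemma. Traces are read off this representative.\<close>

lemma bv_decomp_primitive:
  assumes u: "u \<in> L1 a b" and dec: "bv_decomp a b u p \<nu> \<sigma>"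
    and p': "integrable lborel p'" "AE x in lborel. x \<in> {a<..<b} \<longrightarrow> p x = p' x"
  obtains c where "AE x in lborel. x \<in> {a<..<b} \<longrightarrow> u x = c + primitive a p' \<nu> \<sigma> x"
proof -
  from dec have p: "p \<in> L1 a b" and \<nu>: "finite_borel_on a b \<nu>" and \<sigma>: "sign_fun \<sigma>"
    and weak: "\<And>g. g \<in> test_funs a b \<Longrightarrow> (LINT x:{a<..<b}|lebesgue. u x * deriv g x) =
        - ((LINT x:{a<..<b}|lebesgue. g x * p x) + (LINT x|\<nu>. g x * \<sigma> x))"
    by (auto simp: bv_decomp_def)
  interpret \<nu>: finite_measure \<nu> using \<nu> by (simp add: finite_borel_on_def)
  have s\<nu>: "sets \<nu> = sets borel" using \<nu> by (simp add: finite_borel_on_def)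
  have sf: "sigma_finite_measure \<nu>" "sigma_finite_measure (lborel::real measure)" by unfold_locales
  have [measurable]: "p' \<in> borel_measurable borel" using p'(1) by auto
  define U where "U = (\<lambda>x. primitive a p' \<nu> \<sigma> x)"
  have \<sigma>i: "integrable \<nu> \<sigma>" by (rule sign_fun_integrable[OF \<nu> \<sigma>])
  have UL: "U \<in> L1 a b"
    using set_integral_Ioc_L1[OF sf(1) s\<nu> \<sigma>i, of a a b] set_integral_Ioc_L1[OF sf(2) _ p'(1), of a a b]
    unfolding U_def primitive_def L1_def by (auto intro: set_integral_add)
  obtain c where "AE x in lborel. x \<in> {a<..<b} \<longrightarrow> u x - U x = c"
  proof (rule weak_deriv_zero_imp_const[of "\<lambda>x. u x - U x" a b])
    show "(\<lambda>x. u x - U x) \<in> L1 a b" using u UL unfolding L1_def by (auto intro: set_integral_diff)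
    fix g assume g: "g \<in> test_funs a b"
    note gm = test_funs_measurable[OF g]
    have supp: "indicator {a<..<b} x *\<^sub>R (p' x * g x) = g x * p' x" for x
      using test_funs_outside[OF g, of x] by (cases "x \<in> {a<..<b}") auto
    have gp: "(LINT x:{a<..<b}|lebesgue. g x * p x) = (LINT x|lborel. g x * p' x)"
      using L1_integral_borel[OF p _ p'(2) gm(1), of "{a<..<b}"]
      unfolding set_lebesgue_integral_def[of lborel] supp by (simp add: mult.commute)
    note ibp = integral_by_parts_test_funs[OF sf(1) s\<nu> \<sigma>i g] integral_by_parts_test_funs[OF sf(2) _ p'(1) g]
    obtain K where K: "\<And>x. x \<in> {a..b} \<Longrightarrow> \<bar>deriv g x\<bar> \<le> K"
      using test_funs_bounds[OF g] by metis
    have int_u: "set_integrable lebesgue {a<..<b} (\<lambda>x. u x * deriv g x)"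
      unfolding set_integrable_def
    proof (rule Bochner_Integration.integrable_bound[of _ "\<lambda>x. K * (indicator {a<..<b} x *\<^sub>R u x)"])
      show "integrable lebesgue (\<lambda>x. K * (indicator {a<..<b} x *\<^sub>R u x))"
        using u by (intro integrable_mult_right) (simp add: L1_def set_integrable_def)
      have "(\<lambda>x. (indicator {a<..<b} x *\<^sub>R u x) * deriv g x) \<in> borel_measurable lebesgue"
        using u gm(2) by (intro borel_measurable_times measurable_completion[of "deriv g"])
          (auto simp: L1_def set_integrable_def)
      then show "(\<lambda>x. indicator {a<..<b} x *\<^sub>R (u x * deriv g x)) \<in> borel_measurable lebesgue"
        by (simp add: mult.assoc)
      show "AE x in lebesgue. norm (indicator {a<..<b} x *\<^sub>R (u x * deriv g x)) \<le> norm (K * (indicator {a<..<b} x *\<^sub>R u x))"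
      proof (rule AE_I2)
        fix x show "norm (indicator {a<..<b} x *\<^sub>R (u x * deriv g x)) \<le> norm (K * (indicator {a<..<b} x *\<^sub>R u x))"
        proof (cases "x \<in> {a<..<b}")
          case True
          then have "\<bar>deriv g x\<bar> \<le> \<bar>K\<bar>" using K[of x] by auto
          then have "\<bar>u x\<bar> * \<bar>deriv g x\<bar> \<le> \<bar>u x\<bar> * \<bar>K\<bar>" by (intro mult_left_mono) auto
          then show ?thesis using True by (simp add: abs_mult mult.commute)
        qed simp
      qed
    qed
    have "(LINT x:{a<..<b}|lebesgue. (u x - U x) * deriv g x) =
        (LINT x:{a<..<b}|lebesgue. u x * deriv g x - ((LINT y:{a<..x}|\<nu>. \<sigma> y) * deriv g x + (LINT y:{a<..x}|lborel. p' y) * deriv g x))"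
      by (simp add: U_def primitive_def algebra_simps)
    also have "\<dots> = (LINT x:{a<..<b}|lebesgue. u x * deriv g x) -
       ((LINT x:{a<..<b}|lebesgue. (LINT y:{a<..x}|\<nu>. \<sigma> y) * deriv g x) + (LINT x:{a<..<b}|lebesgue. (LINT y:{a<..x}|lborel. p' y) * deriv g x))"
      using ibp(2,4) int_u by (subst set_integral_diff(2) set_integral_add(2); simp add: set_integral_add)+
    also have "\<dots> = 0" using weak[OF g] ibp(1,3) by (simp add: gp)
    finally show "(LINT x:{a<..<b}|lebesgue. (u x - U x) * deriv g x) = 0" .
  qed
  then have "AE x in lborel. x \<in> {a<..<b} \<longrightarrow> u x = c + primitive a p' \<nu> \<sigma> x"
    by eventually_elim (auto simp: U_def)
  then show ?thesis by (rule that)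
qed

lemma primitive_tendsto:
  assumes p: "integrable lborel p" and \<nu>: "finite_borel_on a b \<nu>" "sign_fun \<sigma>"
  shows "(primitive a p \<nu> \<sigma> \<longlongrightarrow> primitive a p \<nu> \<sigma> x) (at_right x)"
    and "(primitive a p \<nu> \<sigma> \<longlongrightarrow> (LINT y:{a<..<x}|lborel. p y) + (LINT y:{a<..<x}|\<nu>. \<sigma> y)) (at_left x)"
proof -
  have s\<nu>: "sets \<nu> = sets borel" using \<nu> by (simp add: finite_borel_on_def)
  show "(primitive a p \<nu> \<sigma> \<longlongrightarrow> primitive a p \<nu> \<sigma> x) (at_right x)"
    "(primitive a p \<nu> \<sigma> \<longlongrightarrow> (LINT y:{a<..<x}|lborel. p y) + (LINT y:{a<..<x}|\<nu>. \<sigma> y)) (at_left x)"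
    unfolding primitive_def
    by (intro tendsto_add tendsto_set_integral_Ioc_right tendsto_set_integral_Ioc_left p s\<nu>
        sign_fun_integrable[OF \<nu>]; simp)+
qed

lemma primitive_start: "primitive a p \<nu> \<sigma> a = 0"
  by (simp add: primitive_def set_lebesgue_integral_def)

lemma interval_not_null:
  assumes "N \<in> null_sets lborel" "(x::real) < y"
  shows "\<exists>z. z \<in> {x<..<y} \<and> z \<notin> N"
proof (rule ccontr)
  assume "\<not> ?thesis"
  then have "{x<..<y} \<subseteq> N" by blast
  then have "{x<..<y} \<in> null_sets lborel" by (intro null_sets_subset[OF assms(1)]) auto
  then show False using assms(2) by (auto simp: null_sets_def)
qed

text \<open>A one-sided neighbourhood of \<open>t\<close> has positive measure and so meets every
  set of full measure. This makes limits along the trace filter unique, hence \<open>Lim\<close>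
  computable.\<close>

lemma at_right_ae_neq_bot: "inf (at_right (t::real)) (ae_filter lborel) \<noteq> bot"
proof
  assume "inf (at_right t) (ae_filter lborel) = bot"
  then have "\<forall>\<^sub>F x in inf (at_right t) (ae_filter lborel). False" by simp
  then obtain P R where PR: "\<forall>\<^sub>F x in at_right t. P x" "AE x in lborel. R x" "\<And>x. P x \<Longrightarrow> R x \<Longrightarrow> False"
    unfolding eventually_inf by blast
  from PR(1) obtain y where y: "y > t" "\<And>x. x > t \<Longrightarrow> x < y \<Longrightarrow> P x"
    unfolding eventually_at_right_field by blast
  from PR(2) obtain N where N: "N \<in> null_sets lborel" "{x. \<not> R x} \<subseteq> N"
    unfolding eventually_ae_filter by auto
  from interval_not_null[OF N(1) y(1)] N(2) y(2) PR(3) show False by auto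
qed

lemma at_left_ae_neq_bot: "inf (at_left (t::real)) (ae_filter lborel) \<noteq> bot"
proof
  assume "inf (at_left t) (ae_filter lborel) = bot"
  then have "\<forall>\<^sub>F x in inf (at_left t) (ae_filter lborel). False" by simp
  then obtain P R where PR: "\<forall>\<^sub>F x in at_left t. P x" "AE x in lborel. R x" "\<And>x. P x \<Longrightarrow> R x \<Longrightarrow> False"
    unfolding eventually_inf by blast
  from PR(1) obtain y where y: "y < t" "\<And>x. x > y \<Longrightarrow> x < t \<Longrightarrow> P x"
    unfolding eventually_at_left_field by blast
  from PR(2) obtain N where N: "N \<in> null_sets lborel" "{x. \<not> R x} \<subseteq> N"
    unfolding eventually_ae_filter by auto
  from interval_not_null[OF N(1) y(1)] N(2) y(2) PR(3) show False by auto
qed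

text \<open>The trace filter ignores null sets, so an ordinary one-sided limit of any almost
  everywhere equal function computes the trace.\<close>

lemma trace_right_eq:
  assumes ae: "AE x in lborel. x \<in> {a<..<b} \<longrightarrow> u x = v x" and t: "a \<le> t" "t < b"
    and v: "(v \<longlongrightarrow> L) (at_right t)"
  shows "trace_right u t = L"
  unfolding trace_right_def
proof (rule tendsto_Lim[OF at_right_ae_neq_bot])
  have "\<forall>\<^sub>F x in inf (at_right t) (ae_filter lborel). v x = u x"
    unfolding eventually_inf
  proof (intro exI conjI)
    show "\<forall>\<^sub>F x in at_right t. x \<in> {t<..<b}" using t by (intro eventually_at_right_real)
    show "AE x in lborel. x \<in> {a<..<b} \<longrightarrow> u x = v x" by fact
  qed (use t in auto)
  moreover have "(v \<longlongrightarrow> L) (inf (at_right t) (ae_filter lborel))"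
    by (rule tendsto_mono[OF inf_le1 v])
  ultimately show "(u \<longlongrightarrow> L) (inf (at_right t) (ae_filter lborel))"
    by (rule Lim_transform_eventually[rotated])
qed

lemma trace_left_eq:
  assumes ae: "AE x in lborel. x \<in> {a<..<b} \<longrightarrow> u x = v x" and t: "a < t" "t \<le> b"
    and v: "(v \<longlongrightarrow> L) (at_left t)"
  shows "trace_left u t = L"
  unfolding trace_left_def
proof (rule tendsto_Lim[OF at_left_ae_neq_bot])
  have "\<forall>\<^sub>F x in inf (at_left t) (ae_filter lborel). v x = u x"
    unfolding eventually_inf
  proof (intro exI conjI)
    show "\<forall>\<^sub>F x in at_left t. x \<in> {a<..<t}" using t by (intro eventually_at_left_real)
    show "AE x in lborel. x \<in> {a<..<b} \<longrightarrow> u x = v x" by fact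
  qed (use t in auto)
  moreover have "(v \<longlongrightarrow> L) (inf (at_left t) (ae_filter lborel))"
    by (rule tendsto_mono[OF inf_le1 v])
  ultimately show "(u \<longlongrightarrow> L) (inf (at_left t) (ae_filter lborel))"
    by (rule Lim_transform_eventually[rotated])
qed

section \<open>Uniqueness of the decomposition of the derivative\<close>

lemma trace_right_bv:
  assumes "AE x in lborel. x \<in> {a<..<b} \<longrightarrow> u x = c + primitive a p \<nu> \<sigma> x"
    and "integrable lborel p" "finite_borel_on a b \<nu>" "sign_fun \<sigma>" "a \<le> t" "t < b"
  shows "trace_right u t = c + primitive a p \<nu> \<sigma> t"
  by (rule trace_right_eq[OF assms(1,5,6)])
     (intro tendsto_intros primitive_tendsto(1)[OF assms(2-4)])

lemma trace_left_bv:
  assumes "AE x in lborel. x \<in> {a<..<b} \<longrightarrow> u x = c + primitive a p \<nu> \<sigma> x"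
    and "integrable lborel p" "finite_borel_on a b \<nu>" "sign_fun \<sigma>" "a < t" "t \<le> b"
  shows "trace_left u t = c + ((LINT y:{a<..<t}|lborel. p y) + (LINT y:{a<..<t}|\<nu>. \<sigma> y))"
  by (rule trace_left_eq[OF assms(1,5,6)])
     (intro tendsto_intros primitive_tendsto(2)[OF assms(2-4)])

lemma null_imp_set_integral_zero:
  fixes f :: "real \<Rightarrow> real"
  assumes "emeasure M A = 0" "A \<in> sets M"
  shows "(LINT x:A|M. f x) = 0"
proof -
  have "AE x in M. x \<notin> A" using assms by (auto intro: AE_not_in)
  then have "AE x in M. indicator A x *\<^sub>R f x = 0" by eventually_elim simp
  then show ?thesis unfolding set_lebesgue_integral_def by (rule integral_eq_zero_AE)
qed

text \<open>A finite signed measure is determined by its distribution function: the difference of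
  the two measures is a signed set function concentrated on (a,b), and equality of the primitives
  makes it vanish on every (a,x].\<close>

lemma primitive_eq_imp_set_integral_eq:
  assumes p: "integrable lborel p1" "integrable lborel p2"
      "\<And>x. x \<notin> {a<..<b} \<Longrightarrow> p1 x = 0" "\<And>x. x \<notin> {a<..<b} \<Longrightarrow> p2 x = 0"
    and \<nu>: "finite_borel_on a b \<nu>1" "finite_borel_on a b \<nu>2" "sign_fun \<sigma>1" "sign_fun \<sigma>2"
    and ab: "a < b"
    and eq: "\<And>x. x \<in> {a<..<b} \<Longrightarrow> primitive a p1 \<nu>1 \<sigma>1 x = primitive a p2 \<nu>2 \<sigma>2 x"
    and E: "E \<in> sets borel"
  shows "(LINT x:E|lborel. p1 x) + (LINT x:E|\<nu>1. \<sigma>1 x) = (LINT x:E|lborel. p2 x) + (LINT x:E|\<nu>2. \<sigma>2 x)"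
proof -
  have s: "sets \<nu>1 = sets borel" "sets \<nu>2 = sets borel" using \<nu> by (auto simp: finite_borel_on_def)
  have \<sigma>: "integrable \<nu>1 \<sigma>1" "integrable \<nu>2 \<sigma>2" using \<nu> sign_fun_integrable by blast+
  define F where "F = (\<lambda>E. ((LINT x:E|lborel. p1 x) + (LINT x:E|\<nu>1. \<sigma>1 x)) -
      ((LINT x:E|lborel. p2 x) + (LINT x:E|\<nu>2. \<sigma>2 x)))"
  have add: "(\<lambda>i. F (A i)) sums F (\<Union>i. A i)" if "range A \<subseteq> sets borel" "disjoint_family A" for A :: "nat \<Rightarrow> real set"
    unfolding F_def using that
    by (intro sums_diff sums_add set_integral_sums p \<sigma>) (auto simp: s)
  have Fx: "F {a<..x} = 0" if "x \<in> {a<..<b}" for x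
    using eq[OF that] by (simp add: F_def primitive_def)
  have lim: "((\<lambda>x. F {a<..x}) \<longlongrightarrow> F {a<..<b}) (at_left b)"
    unfolding F_def by (intro tendsto_intros tendsto_set_integral_Ioc_left p \<sigma> s) simp_all
  have Fint: "F E = F (E \<inter> {a<..<b})" if E: "E \<in> sets borel" for E
  proof -
    have 1: "(LINT x:E|lborel. p x) = (LINT x:E \<inter> {a<..<b}|lborel. p x)"
      if "\<And>x. x \<notin> {a<..<b} \<Longrightarrow> p x = 0" for p :: "real \<Rightarrow> real"
      unfolding set_lebesgue_integral_def using that
      by (intro Bochner_Integration.integral_cong) (auto simp: indicator_def)
    have 2: "(LINT x:E|\<nu>. \<sigma> x) = (LINT x:E \<inter> {a<..<b}|\<nu>. \<sigma> x)"
      if "finite_borel_on a b \<nu>" "integrable \<nu> \<sigma>" for \<nu> and \<sigma> :: "real \<Rightarrow> real"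
    proof -
      have s': "sets \<nu> = sets borel" "emeasure \<nu> (- {a<..<b}) = 0"
        using that(1) by (auto simp: finite_borel_on_def)
      have "emeasure \<nu> (E - {a<..<b}) \<le> emeasure \<nu> (- {a<..<b})"
        by (intro emeasure_mono) (auto simp: s')
      moreover have "sym_diff E (E \<inter> {a<..<b}) = E - {a<..<b}" by blast
      ultimately have "emeasure \<nu> (sym_diff E (E \<inter> {a<..<b})) = 0"
        using s'(2) by simp
      then have "sym_diff E (E \<inter> {a<..<b}) \<in> null_sets \<nu>"
        using E s'(1) by (auto simp: null_sets_def)
      then show ?thesis by (intro set_integral_null_delta that(2)) (use E s'(1) in auto)
    qed
    show ?thesis unfolding F_def using 1[of p1] 1[of p2] p(3,4) 2[OF \<nu>(1) \<sigma>(1)] 2[OF \<nu>(2) \<sigma>(2)]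
      by simp
  qed
  have "F E = 0"
    using add ab Fint lim Fx E by (rule sigma_additive_eq_0_interval)
  then show ?thesis by (simp add: F_def)
qed

lemma polar_integral_bound:
  assumes "finite_borel_on a b \<nu>" "sign_fun \<sigma>" "E \<in> sets borel"
  shows "\<bar>LINT x:E|\<nu>. \<sigma> x\<bar> \<le> measure \<nu> E"
proof -
  have s: "sets \<nu> = sets borel" using assms(1) by (simp add: finite_borel_on_def)
  have "norm (LINT x:E|\<nu>. \<sigma> x) \<le> (LINT x|\<nu>. norm (indicator E x *\<^sub>R \<sigma> x))"
    unfolding set_lebesgue_integral_def by (rule integral_norm_bound)
  also have "\<dots> = (LINT x|\<nu>. indicator E x)"
    using assms(2) by (intro Bochner_Integration.integral_cong) (auto simp: sign_fun_def abs_mult)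
  finally show ?thesis using assms(3) by (simp add: s sets_eq_imp_space_eq[OF s])
qed

text \<open>Where \<open>\<sigma>1\<close> is 1, and on the complement, where it is -1,
  \<open>\<nu>1\<close> is plus or minus the signed measure and so bounded by the other total
  variation. Exchanging the roles gives uniqueness of the total variation.\<close>

lemma polar_measure_le:
  assumes \<nu>: "finite_borel_on a b \<nu>1" "finite_borel_on a b \<nu>2" "sign_fun \<sigma>1" "sign_fun \<sigma>2"
    and eq: "\<And>E. E \<in> sets borel \<Longrightarrow> (LINT x:E|\<nu>1. \<sigma>1 x) = (LINT x:E|\<nu>2. \<sigma>2 x)"
    and E: "E \<in> sets borel"
  shows "measure \<nu>1 E \<le> measure \<nu>2 E"
proof -
  interpret \<nu>1: finite_measure \<nu>1 using \<nu> by (simp add: finite_borel_on_def)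
  interpret \<nu>2: finite_measure \<nu>2 using \<nu> by (simp add: finite_borel_on_def)
  have s: "sets \<nu>1 = sets borel" "sets \<nu>2 = sets borel" using \<nu> by (auto simp: finite_borel_on_def)
  have m: "\<sigma>1 \<in> borel_measurable borel" using \<nu> by (simp add: sign_fun_def)
  note le = polar_integral_bound[OF \<nu>(2,4)]
  let ?P = "E \<inter> {x. \<sigma>1 x = 1}" and ?N = "E \<inter> {x. \<sigma>1 x \<noteq> 1}"
  have [measurable]: "?P \<in> sets borel" "?N \<in> sets borel"
    using E m by measurable
  have "measure \<nu>1 ?P = (LINT x:?P|\<nu>1. \<sigma>1 x)"
  proof -
    have "(LINT x:?P|\<nu>1. \<sigma>1 x) = (LINT x|\<nu>1. indicator ?P x)"
      unfolding set_lebesgue_integral_def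
      by (intro Bochner_Integration.integral_cong) (auto simp: indicator_def)
    then show ?thesis by (simp add: s sets_eq_imp_space_eq[OF s(1)])
  qed
  then have P: "measure \<nu>1 ?P \<le> measure \<nu>2 ?P" using eq[of ?P] le[of ?P] by simp
  have "measure \<nu>1 ?N = - (LINT x:?N|\<nu>1. \<sigma>1 x)"
  proof -
    have "\<sigma>1 x = -1" if "\<sigma>1 x \<noteq> 1" for x using \<nu>(3) that unfolding sign_fun_def by (metis abs_eq_iff  abs_one)
    then have "(LINT x:?N|\<nu>1. \<sigma>1 x) = (LINT x|\<nu>1. - indicator ?N x)"
      unfolding set_lebesgue_integral_def
      by (intro Bochner_Integration.integral_cong) (auto simp: indicator_def)
    then show ?thesis by (simp add: s sets_eq_imp_space_eq[OF s(1)])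
  qed
  then have N: "measure \<nu>1 ?N \<le> measure \<nu>2 ?N" using eq[of ?N] le[of ?N] by simp
  have E': "E = ?P \<union> ?N" "?P \<inter> ?N = {}" by auto
  have "measure \<nu>1 E = measure \<nu>1 ?P + measure \<nu>1 ?N"
    using E'(2) by (subst E'(1), intro \<nu>1.finite_measure_Union) (auto simp: s)
  moreover have "measure \<nu>2 E = measure \<nu>2 ?P + measure \<nu>2 ?N"
    using E'(2) by (subst E'(1), intro \<nu>2.finite_measure_Union) (auto simp: s)
  ultimately show ?thesis using P N by linarith
qed

text \<open>The right traces at \<open>a\<close> identify the constants, the primitives then
  identify the signed measures, and the null set \<open>N1 \<union> N2\<close> separates the parts:
  densities do not see it, and both singular parts vanish off it.\<close>

lemma bv_decomp_unique:
  assumes u: "u \<in> L1 a b" and ab: "a < b"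
    and d1: "bv_decomp a b u p1 \<nu>1 \<sigma>1" and d2: "bv_decomp a b u p2 \<nu>2 \<sigma>2"
  shows "\<nu>1 = \<nu>2" and "AE x in lborel. x \<in> {a<..<b} \<longrightarrow> p1 x = p2 x"
proof -
  have p: "p1 \<in> L1 a b" "p2 \<in> L1 a b" and \<nu>: "finite_borel_on a b \<nu>1" "finite_borel_on a b \<nu>2"
    and \<sigma>: "sign_fun \<sigma>1" "sign_fun \<sigma>2" using d1 d2 by (auto simp: bv_decomp_def)
  obtain N1 N2 where N: "N1 \<in> null_sets lborel" "N2 \<in> null_sets lborel"
    "emeasure \<nu>1 (- N1) = 0" "emeasure \<nu>2 (- N2) = 0" using d1 d2 by (auto simp: bv_decomp_def)
  have s: "sets \<nu>1 = sets borel" "sets \<nu>2 = sets borel" using \<nu> by (auto simp: finite_borel_on_def)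
  obtain q1 where q1: "integrable lborel q1" "\<And>x. x \<notin> {a<..<b} \<Longrightarrow> q1 x = 0"
    "AE x in lborel. x \<in> {a<..<b} \<longrightarrow> p1 x = q1 x" using L1_borel[OF p(1)] by blast
  obtain q2 where q2: "integrable lborel q2" "\<And>x. x \<notin> {a<..<b} \<Longrightarrow> q2 x = 0"
    "AE x in lborel. x \<in> {a<..<b} \<longrightarrow> p2 x = q2 x" using L1_borel[OF p(2)] by blast
  obtain c1 where c1: "AE x in lborel. x \<in> {a<..<b} \<longrightarrow> u x = c1 + primitive a q1 \<nu>1 \<sigma>1 x"
    using bv_decomp_primitive[OF u d1 q1(1,3)] by blast
  obtain c2 where c2: "AE x in lborel. x \<in> {a<..<b} \<longrightarrow> u x = c2 + primitive a q2 \<nu>2 \<sigma>2 x"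
    using bv_decomp_primitive[OF u d2 q2(1,3)] by blast
  have tr: "c1 + primitive a q1 \<nu>1 \<sigma>1 t = c2 + primitive a q2 \<nu>2 \<sigma>2 t" if "a \<le> t" "t < b" for t
    using trace_right_bv[OF c1 q1(1) \<nu>(1) \<sigma>(1) that] trace_right_bv[OF c2 q2(1) \<nu>(2) \<sigma>(2) that] by simp
  have "c1 = c2" using tr[of a] ab by (simp add: primitive_start)
  then have eq: "(LINT x:E|lborel. q1 x) + (LINT x:E|\<nu>1. \<sigma>1 x) = (LINT x:E|lborel. q2 x) + (LINT x:E|\<nu>2. \<sigma>2 x)"
    if "E \<in> sets borel" for E
    using tr by (intro primitive_eq_imp_set_integral_eq[OF q1(1) q2(1) q1(2) q2(2) \<nu> \<sigma> ab _ that]) auto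
  let ?N = "N1 \<union> N2"
  have Nb: "N1 \<in> sets borel" "N2 \<in> sets borel" using N by (auto simp: null_sets_def)
  have null: "E \<inter> ?N \<in> null_sets lborel" if "E \<in> sets borel" for E
    using N(1,2) that by (intro null_set_Int1 null_sets.Un) auto
  have 0: "(LINT x:E - ?N|\<nu>1. \<sigma>1 x) = 0" "(LINT x:E - ?N|\<nu>2. \<sigma>2 x) = 0" if "E \<in> sets borel" for E
  proof -
    have "emeasure \<nu>1 (E - ?N) \<le> emeasure \<nu>1 (- N1)" "emeasure \<nu>2 (E - ?N) \<le> emeasure \<nu>2 (- N2)"
      using Nb by (intro emeasure_mono; auto simp: s)+
    then show "(LINT x:E - ?N|\<nu>1. \<sigma>1 x) = 0" "(LINT x:E - ?N|\<nu>2. \<sigma>2 x) = 0"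
      using N Nb that by (auto intro!: null_imp_set_integral_zero simp: s)
  qed
  have split: "(LINT x:E|M. f x) = (LINT x:E - ?N|M. f x) + (LINT x:E \<inter> ?N|M. f x)"
    if "E \<in> sets borel" "sets M = sets borel" "integrable M f" for E M and f :: "real \<Rightarrow> real"
  proof -
    have "(LINT x:(E - ?N) \<union> (E \<inter> ?N)|M. f x) = (LINT x:E - ?N|M. f x) + (LINT x:E \<inter> ?N|M. f x)"
      using that Nb integrable_mult_indicator[OF _ that(3)]
      by (intro set_integral_Un) (auto simp: set_integrable_def)
    moreover have "(E - ?N) \<union> (E \<inter> ?N) = E" by blast
    ultimately show ?thesis by simp
  qed
  have i: "integrable \<nu>1 \<sigma>1" "integrable \<nu>2 \<sigma>2" using \<nu> \<sigma> sign_fun_integrable by blast+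
  have q0: "(LINT x:E \<inter> ?N|lborel. q x) = 0" if "E \<in> sets borel" for E and q :: "real \<Rightarrow> real"
    using null[OF that] by (intro null_imp_set_integral_zero) auto
  have s\<nu>: "(LINT x:E|\<nu>1. \<sigma>1 x) = (LINT x:E|\<nu>2. \<sigma>2 x)" if E: "E \<in> sets borel" for E
    using eq[of "E \<inter> ?N"] split[OF E s(1) i(1)] split[OF E s(2) i(2)] 0[OF E] q0[OF E] E Nb by simp
  have "measure \<nu>1 E = measure \<nu>2 E" if "E \<in> sets borel" for E
    using polar_measure_le[OF \<nu> \<sigma> s\<nu> that] polar_measure_le[OF \<nu>(2,1) \<sigma>(2,1) s\<nu>[symmetric] that] by simp
  moreover have "finite_measure \<nu>1" "finite_measure \<nu>2" using \<nu> by (auto simp: finite_borel_on_def)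
  ultimately show "\<nu>1 = \<nu>2"
    by (intro measure_eqI) (auto simp: s finite_measure.emeasure_eq_measure)
  have "(LINT x:E|lborel. q1 x) = (LINT x:E|lborel. q2 x)" if "E \<in> sets borel" for E
    using eq[OF that] s\<nu>[OF that] by simp
  then have "AE x in lborel. q1 x = q2 x"
    by (intro density_unique_real[OF q1(1) q2(1)]) auto
  with q1(3) q2(3) show "AE x in lborel. x \<in> {a<..<b} \<longrightarrow> p1 x = p2 x"
    by eventually_elim auto
qed

lemma sing_var_eq:
  assumes "u \<in> L1 a b" "a < b" "bv_decomp a b u p \<nu> \<sigma>"
  shows "sing_var a b u = \<nu>"
  unfolding sing_var_def using assms bv_decomp_unique(1)[OF assms(1,2) _ assms(3)]
  by (intro the_equality) blast+

text \<open>The choice in \<open>ac_deriv\<close> still belongs to some decomposition, so uniqueness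
  fixes it up to a null set.\<close>

lemma ac_deriv_eq:
  assumes "u \<in> L1 a b" "a < b" "bv_decomp a b u p \<nu> \<sigma>"
  shows "AE x in lborel. x \<in> {a<..<b} \<longrightarrow> ac_deriv a b u x = p x"
proof -
  have "\<exists>\<nu> \<sigma>. bv_decomp a b u (ac_deriv a b u) \<nu> \<sigma>"
    unfolding ac_deriv_def using assms(3) by (intro someI[of "\<lambda>p. \<exists>\<nu> \<sigma>. bv_decomp a b u p \<nu> \<sigma>"]) blast
  then show ?thesis using bv_decomp_unique(2)[OF assms(1,2) _ assms(3)] by blast
qed

section \<open>Existence of the decomposition\<close>

text \<open>A countable union of almost optimal null sets attains the supremum of
  \<open>\<mu>\<close> over null sets, and a null set with mass outside \<open>N\<close> would
  exceed it. For Lebesgue null sets, \<open>N\<close> thus carries the whole singular part of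
  \<open>\<mu>\<close>.\<close>

lemma maximal_null_set:
  assumes "finite_measure \<mu>" and s: "sets \<mu> = sets M"
  obtains N where "N \<in> null_sets M" "\<And>Z. Z \<in> null_sets M \<Longrightarrow> emeasure \<mu> (Z - N) = 0"
proof -
  interpret finite_measure \<mu> by fact
  define S where "S = (SUP Z\<in>null_sets M. measure \<mu> Z)"
  have bdd: "bdd_above (measure \<mu> ` null_sets M)"
    by (rule bdd_aboveI2[of _ _ "measure \<mu> (space \<mu>)"]) (rule bounded_measure)
  have "\<exists>Z\<in>null_sets M. S - 1 / real (Suc n) < measure \<mu> Z" for n
    using less_cSUP_iff[OF _ bdd, of "S - 1 / real (Suc n)"] by (auto simp: S_def)
  then obtain Z where Z: "\<And>n. Z n \<in> null_sets M" "\<And>n. S - 1 / real (Suc n) < measure \<mu> (Z n)"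
    by metis
  define N where "N = (\<Union>n. Z n)"
  have N: "N \<in> null_sets M" unfolding N_def using Z(1) by (intro null_sets_UN) auto
  have "S - 1 / real (Suc n) \<le> measure \<mu> N" for n
    using Z(2)[of n] finite_measure_mono[of "Z n" N] N by (force simp: N_def s null_sets_def)
  moreover have "(\<lambda>n. S - 1 / real (Suc n)) \<longlonglongrightarrow> S - 0"
    by (intro tendsto_intros LIMSEQ_Suc[OF lim_1_over_n])
  ultimately have SN: "S \<le> measure \<mu> N" by (intro LIMSEQ_le_const2[of _ S]) auto
  show ?thesis
  proof (rule that[OF N])
    fix Y assume Y: "Y \<in> null_sets M"
    have m: "Y - N \<in> sets \<mu>" "N \<in> sets \<mu>" using Y N by (auto simp: s null_sets_def)
    have "measure \<mu> N + measure \<mu> (Y - N) = measure \<mu> (N \<union> (Y - N))"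
      using m by (intro finite_measure_Union[symmetric]) auto
    also have "\<dots> \<le> S"
      unfolding S_def using Y N by (intro cSUP_upper[OF _ bdd]) (simp add: null_sets.Un)
    finally have "measure \<mu> (Y - N) = 0" using SN measure_nonneg[of \<mu> "Y - N"] by linarith
    then show "emeasure \<mu> (Y - N) = 0" by (simp add: emeasure_eq_measure)
  qed
qed

lemma integrable_lborel_L1:
  assumes "integrable lborel p"
  shows "p \<in> L1 a b"
proof -
  have "integrable lborel (\<lambda>x. indicator {a<..<b} x *\<^sub>R p x)"
    using assms by (intro integrable_mult_indicator) auto
  moreover have "p \<in> borel_measurable borel" using assms by auto
  ultimately show ?thesis
    unfolding L1_def set_integrable_def by (simp add: integrable_completion)
qed

lemma set_integral_test_fun_lborel:
  assumes g: "g \<in> test_funs a b" and p: "integrable lborel p"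
  shows "(LINT x:{a<..<b}|lebesgue. g x * p x) = (LINT x|lborel. g x * p x)"
proof -
  have eq: "indicator {a<..<b} x *\<^sub>R (g x * p x) = g x * p x" for x
    using test_funs_outside[OF g, of x] by (cases "x \<in> {a<..<b}") auto
  then show ?thesis using test_funs_measurable(1)[OF g] p
    unfolding set_lebesgue_integral_def eq by (intro integral_completion) auto
qed

text \<open>Lebesgue decomposition along a maximal null set: the restriction to \<open>N\<close> is
  singular, and the rest is absolutely continuous with a Radon-Nikodym density. The sign of the
  whole derivative serves both pieces.\<close>

lemma BV_bv_decomp:
  assumes "u \<in> BV a b"
  obtains p \<nu> \<sigma> where "bv_decomp a b u p \<nu> \<sigma>"
proof -
  from assms obtain \<mu> \<sigma> where \<mu>: "finite_borel_on a b \<mu>" and \<sigma>: "sign_fun \<sigma>"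
    and weak: "\<And>g. g \<in> test_funs a b \<Longrightarrow>
        (LINT x:{a<..<b}|lebesgue. u x * deriv g x) = - (LINT x|\<mu>. g x * \<sigma> x)"
    by (auto simp: BV_def)
  interpret \<mu>: finite_measure \<mu> using \<mu> by (simp add: finite_borel_on_def)
  have s [measurable_cong]: "sets \<mu> = sets borel" using \<mu> by (simp add: finite_borel_on_def)
  have [measurable]: "\<sigma> \<in> borel_measurable borel" using \<sigma> by (simp add: sign_fun_def)
  obtain N where N: "N \<in> null_sets lborel" "\<And>Z. Z \<in> null_sets lborel \<Longrightarrow> emeasure \<mu> (Z - N) = 0"
    using maximal_null_set[OF \<mu>.finite_measure_axioms, of lborel] s by auto
  have [measurable]: "N \<in> sets borel" using N(1) by (auto simp: null_sets_def)
  define \<nu> where "\<nu> = density \<mu> (\<lambda>x. ennreal (indicator N x))"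
  define \<rho> where "\<rho> = density \<mu> (\<lambda>x. ennreal (indicator (- N) x))"
  have e\<nu>: "emeasure \<nu> E = emeasure \<mu> (E \<inter> N)" if "E \<in> sets borel" for E
    using that unfolding \<nu>_def
    by (simp add: emeasure_density ennreal_indicator indicator_inter_arith[symmetric] Int_commute s)
  have e\<rho>: "emeasure \<rho> E = emeasure \<mu> (E - N)" if "E \<in> sets borel" for E
    using that unfolding \<rho>_def
    by (simp add: emeasure_density ennreal_indicator indicator_inter_arith[symmetric] Int_commute s Diff_eq)
  have s': "sets \<nu> = sets borel" "sets \<rho> = sets borel" by (simp_all add: \<nu>_def \<rho>_def s)
  have fin: "finite_measure \<nu>" "finite_measure \<rho>"
    by (rule finite_measureI; simp add: e\<nu> e\<rho> sets_eq_imp_space_eq[OF s'(1)] sets_eq_imp_space_eq[OF s'(2)])+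
  interpret \<rho>: finite_measure \<rho> by fact
  have ac: "absolutely_continuous lborel \<rho>"
    unfolding absolutely_continuous_def using N(2) e\<rho> s' by (auto simp: null_sets_def)
  have \<sigma>\<rho>: "integrable \<rho> \<sigma>"
    by (rule \<rho>.integrable_const_bound[of _ 1]) (use \<sigma> in \<open>auto simp: sign_fun_def \<rho>_def\<close>)
  define p where "p = (\<lambda>x. enn2real (RN_deriv lborel \<rho> x) * \<sigma> x)"
  have sf\<rho>: "sigma_finite_measure \<rho>" by unfold_locales
  have pi: "integrable lborel p"
    unfolding p_def using sigma_finite_measure.RN_deriv_integrable[OF sigma_finite_lborel sf\<rho> ac, of \<sigma>] \<sigma>\<rho> s' by auto
  have "bv_decomp a b u p \<nu> \<sigma>"
    unfolding bv_decomp_def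
  proof (intro conjI ballI \<sigma>)
    show "p \<in> L1 a b" by (rule integrable_lborel_L1[OF pi])
    have "emeasure \<mu> (- {a<..<b} \<inter> N) \<le> emeasure \<mu> (- {a<..<b})"
      by (intro emeasure_mono) (auto simp: s)
    then show "finite_borel_on a b \<nu>"
      using \<mu> fin s' e\<nu> by (auto simp: finite_borel_on_def)
    show "\<exists>N\<in>null_sets lborel. emeasure \<nu> (- N) = 0"
      using N(1) by (intro bexI[of _ N]) (auto simp: e\<nu>)
    fix g assume g: "g \<in> test_funs a b"
    have [measurable]: "g \<in> borel_measurable borel" by (rule test_funs_measurable[OF g])
    obtain K where K: "\<And>x. \<bar>g x\<bar> \<le> K" using test_funs_bounds[OF g] by metis
    have int: "integrable \<mu> (\<lambda>x. indicator E x * (g x * \<sigma> x))" if "E \<in> sets borel" for E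
    proof (rule \<mu>.integrable_const_bound[of _ K])
      show "AE x in \<mu>. norm (indicator E x * (g x * \<sigma> x)) \<le> K"
        using K \<sigma> order_trans[OF abs_ge_zero K] by (auto simp: indicator_def sign_fun_def abs_mult)
    qed (use that in auto)
    have "(LINT x|\<mu>. g x * \<sigma> x) =
        (LINT x|\<mu>. indicator (- N) x * (g x * \<sigma> x) + indicator N x * (g x * \<sigma> x))"
      by (intro Bochner_Integration.integral_cong) (auto simp: indicator_def)
    also have "\<dots> = (LINT x|\<mu>. indicator (- N) x * (g x * \<sigma> x)) + (LINT x|\<mu>. indicator N x * (g x * \<sigma> x))"
      by (intro Bochner_Integration.integral_add int) auto
    also have "(LINT x|\<mu>. indicator (- N) x * (g x * \<sigma> x)) = (LINT x|\<rho>. g x * \<sigma> x)"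
      unfolding \<rho>_def by (subst integral_density) auto
    also have "(LINT x|\<mu>. indicator N x * (g x * \<sigma> x)) = (LINT x|\<nu>. g x * \<sigma> x)"
      unfolding \<nu>_def by (subst integral_density) auto
    also have "(LINT x|\<rho>. g x * \<sigma> x) = (LINT x|lborel. g x * p x)"
      using sigma_finite_measure.RN_deriv_integral[OF sigma_finite_lborel sf\<rho> ac, of "\<lambda>x. g x * \<sigma> x"] s'
      by (simp add: p_def mult.left_commute)
    finally show "(LINT x:{a<..<b}|lebesgue. u x * deriv g x) =
        - ((LINT x:{a<..<b}|lebesgue. g x * p x) + (LINT x|\<nu>. g x * \<sigma> x))"
      using weak[OF g] set_integral_test_fun_lborel[OF g pi] by simp
  qed
  then show ?thesis by (rule that)
qed

text \<open>A weak derivative in \<open>L1\<close> is a decomposition whose singular part is the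
  zero measure, and uniqueness transfers this to \<open>\<nu>\<close>. Conversely, test functions
  live on (a,b), so a singular part without mass there drops out of the weak formula.\<close>

lemma W11_iff_sing_var:
  assumes u: "u \<in> L1 a b" and ab: "a < b" and dec: "bv_decomp a b u p \<nu> \<sigma>"
  shows "u \<in> W11 a b \<longleftrightarrow> emeasure \<nu> {a<..<b} = 0"
proof
  assume "u \<in> W11 a b"
  then obtain q where q: "q \<in> L1 a b" "\<And>g. g \<in> test_funs a b \<Longrightarrow>
     (LINT x:{a<..<b}|lebesgue. u x * deriv g x) = - (LINT x:{a<..<b}|lebesgue. g x * q x)"
    by (auto simp: W11_def)
  have "(LINT x|null_measure borel. g x * (1::real)) = 0" for g :: "real \<Rightarrow> real"
    by (intro integral_eq_zero_AE) (auto simp: eventually_ae_filter null_sets_def intro!: exI[of _ UNIV])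
  then have "bv_decomp a b u q (null_measure borel) (\<lambda>_. 1)"
    unfolding bv_decomp_def finite_borel_on_def sign_fun_def using q
    by (auto intro!: bexI[of _ "{}"] finite_measureI)
  from bv_decomp_unique(1)[OF u ab dec this] show "emeasure \<nu> {a<..<b} = 0" by simp
next
  assume 0: "emeasure \<nu> {a<..<b} = 0"
  have p: "p \<in> L1 a b" and \<nu>: "finite_borel_on a b \<nu>"
    and weak: "\<And>g. g \<in> test_funs a b \<Longrightarrow> (LINT x:{a<..<b}|lebesgue. u x * deriv g x) =
        - ((LINT x:{a<..<b}|lebesgue. g x * p x) + (LINT x|\<nu>. g x * \<sigma> x))"
    using dec by (auto simp: bv_decomp_def)
  have "{a<..<b} \<in> null_sets \<nu>" using 0 \<nu> by (auto simp: null_sets_def finite_borel_on_def)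
  then have ae: "AE x in \<nu>. x \<notin> {a<..<b}" by (rule AE_not_in)
  have "(LINT x|\<nu>. g x * \<sigma> x) = 0" if g: "g \<in> test_funs a b" for g
    using ae by (intro integral_eq_zero_AE) (auto elim!: eventually_mono simp: test_funs_outside[OF g])
  then show "u \<in> W11 a b" using u p weak by (auto simp: W11_def)
qed

text \<open>Converse to the representation; it manufactures comparison functions with prescribed
  density and singular part.\<close>

lemma primitive_bv_decomp:
  assumes p: "integrable lborel p" and \<nu>: "finite_borel_on a b \<nu>" and \<sigma>: "sign_fun \<sigma>"
    and sing: "N \<in> null_sets lborel" "emeasure \<nu> (- N) = 0"
  shows "primitive a p \<nu> \<sigma> \<in> L1 a b" and "bv_decomp a b (primitive a p \<nu> \<sigma>) p \<nu> \<sigma>"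
proof -
  interpret \<nu>: finite_measure \<nu> using \<nu> by (simp add: finite_borel_on_def)
  have s\<nu>: "sets \<nu> = sets borel" using \<nu> by (simp add: finite_borel_on_def)
  have sf: "sigma_finite_measure \<nu>" "sigma_finite_measure (lborel::real measure)" by unfold_locales
  have \<sigma>i: "integrable \<nu> \<sigma>" by (rule sign_fun_integrable[OF \<nu> \<sigma>])
  show "primitive a p \<nu> \<sigma> \<in> L1 a b"
    using set_integral_Ioc_L1[OF sf(1) s\<nu> \<sigma>i, of a a b] set_integral_Ioc_L1[OF sf(2) _ p, of a a b]
    unfolding primitive_def L1_def by (auto intro: set_integral_add)
  have weak: "(LINT x:{a<..<b}|lebesgue. primitive a p \<nu> \<sigma> x * deriv g x) =
        - ((LINT x:{a<..<b}|lebesgue. g x * p x) + (LINT x|\<nu>. g x * \<sigma> x))"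
    if g: "g \<in> test_funs a b" for g
  proof -
    note ibp = integral_by_parts_test_funs[OF sf(1) s\<nu> \<sigma>i g] integral_by_parts_test_funs[OF sf(2) _ p g]
    have "(LINT x:{a<..<b}|lebesgue. primitive a p \<nu> \<sigma> x * deriv g x) =
        (LINT x:{a<..<b}|lebesgue. (LINT y:{a<..x}|lborel. p y) * deriv g x + (LINT y:{a<..x}|\<nu>. \<sigma> y) * deriv g x)"
      by (simp add: primitive_def algebra_simps)
    also have "\<dots> = (LINT x:{a<..<b}|lebesgue. (LINT y:{a<..x}|lborel. p y) * deriv g x) + (LINT x:{a<..<b}|lebesgue. (LINT y:{a<..x}|\<nu>. \<sigma> y) * deriv g x)"
      using ibp(2,4) by (intro set_integral_add(2)) auto
    finally show ?thesis using ibp(1,3) set_integral_test_fun_lborel[OF g p] by simp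
  qed
  then show "bv_decomp a b (primitive a p \<nu> \<sigma>) p \<nu> \<sigma>"
    using integrable_lborel_L1[OF p] \<nu> \<sigma> sing by (auto simp: bv_decomp_def)
qed

text \<open>\<open>BV\<close> asks for one measure with one sign, whereas a primitive has two
  pieces. Both are nonnegative here, so their sum with the constant sign 1 represents the
  derivative.\<close>

lemma primitive_nonneg_BV:
  assumes p: "integrable lborel p" "\<And>x. 0 \<le> p x" "\<And>x. x \<notin> {a<..<b} \<Longrightarrow> p x = 0"
    and \<nu>: "finite_borel_on a b \<nu>"
  shows "primitive a p \<nu> (\<lambda>_. 1) \<in> BV a b"
proof -
  interpret \<nu>: finite_measure \<nu> using \<nu> by (simp add: finite_borel_on_def)
  have s\<nu>: "sets \<nu> = sets borel" "space \<nu> = UNIV" "emeasure \<nu> (- {a<..<b}) = 0"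
    using \<nu> sets_eq_imp_space_eq[of \<nu> borel] by (auto simp: finite_borel_on_def)
  have [measurable]: "p \<in> borel_measurable borel" using p(1) by auto
  define D where "D = density lborel (\<lambda>x. ennreal (p x))"
  have sD: "sets D = sets borel" "space D = UNIV" by (simp_all add: D_def)
  have eD: "emeasure D E = ennreal (LINT x:E|lborel. p x)" if "E \<in> sets borel" for E
  proof -
    have "emeasure D E = (\<integral>\<^sup>+x. ennreal (indicator E x *\<^sub>R p x) \<partial>lborel)"
      unfolding D_def using that
      by (auto simp: emeasure_density intro!: nn_integral_cong split: split_indicator)
    also have "\<dots> = ennreal (LINT x|lborel. indicator E x *\<^sub>R p x)"
      using p that by (intro nn_integral_eq_integral integrable_mult_indicator) auto
    finally show ?thesis by (simp add: set_lebesgue_integral_def)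
  qed
  define \<mu> where "\<mu> = measure_of UNIV (sets borel) (\<lambda>E. emeasure D E + emeasure \<nu> E)"
  have s\<mu>: "sets \<mu> = sets borel" "space \<mu> = UNIV"
    by (simp_all add: \<mu>_def sets.sigma_sets_eq[of borel, simplified])
  have e\<mu>: "emeasure \<mu> E = emeasure D E + emeasure \<nu> E" if "E \<in> sets borel" for E
  proof (rule emeasure_measure_of[OF \<mu>_def])
    show "positive (sets \<mu>) (\<lambda>E. emeasure D E + emeasure \<nu> E)" by (simp add: positive_def)
    show "countably_additive (sets \<mu>) (\<lambda>E. emeasure D E + emeasure \<nu> E)"
    proof (rule countably_additiveI)
      fix A :: "nat \<Rightarrow> real set" assume A: "range A \<subseteq> sets \<mu>" "disjoint_family A"
      have "(\<Sum>i. emeasure D (A i) + emeasure \<nu> (A i)) = (\<Sum>i. emeasure D (A i)) + (\<Sum>i. emeasure \<nu> (A i))"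
        by (intro suminf_add[symmetric]) auto
      then show "(\<Sum>i. emeasure D (A i) + emeasure \<nu> (A i)) = emeasure D (\<Union> (range A)) + emeasure \<nu> (\<Union> (range A))"
        using A suminf_emeasure[of A D] suminf_emeasure[of A \<nu>] by (simp add: s\<mu> sD s\<nu>)
    qed
  qed (use that s\<mu> in auto)
  have f\<mu>: "finite_measure \<mu>"
    by (rule finite_measureI) (simp add: s\<mu> e\<mu> eD \<nu>.emeasure_eq_measure)
  interpret \<mu>: finite_measure \<mu> by fact
  have out: "emeasure \<mu> (- {a<..<b}) = 0"
  proof -
    have "indicator (- {a<..<b}) x *\<^sub>R p x = 0" for x using p(3)[of x] by (auto simp: indicator_def)
    then have "(LINT x:- {a<..<b}|lborel. p x) = 0"
      unfolding set_lebesgue_integral_def by (simp only: Bochner_Integration.integral_zero)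
    then show ?thesis by (simp add: e\<mu> eD s\<nu>)
  qed
  have \<mu>: "finite_borel_on a b \<mu>" using f\<mu> s\<mu> out by (simp add: finite_borel_on_def)
  have sg: "sign_fun (\<lambda>_. 1)" by (simp add: sign_fun_def)
  have one: "(LINT y:E|M. (1::real)) = measure M E" if "finite_measure M" "E \<in> sets M" for M and E :: "real set"
    using that unfolding set_lebesgue_integral_def
    by (simp add: finite_measure.emeasure_eq_measure)
  \<comment> \<open>Against the sum measure the primitive is a single integral, to which integration
    by parts applies directly.\<close>
  have prim: "primitive a p \<nu> (\<lambda>_. 1) x = (LINT y:{a<..x}|\<mu>. 1)" for x
  proof -
    have nn: "0 \<le> (LINT y:{a<..x}|lborel. p y)"
      unfolding set_lebesgue_integral_def by (intro integral_nonneg_AE) (use p in auto)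
    have "ennreal (measure \<mu> {a<..x}) = ennreal ((LINT y:{a<..x}|lborel. p y) + measure \<nu> {a<..x})"
      using e\<mu>[of "{a<..x}"] nn by (simp add: eD \<mu>.emeasure_eq_measure \<nu>.emeasure_eq_measure)
    then have "measure \<mu> {a<..x} = (LINT y:{a<..x}|lborel. p y) + measure \<nu> {a<..x}"
      using nn by (subst (asm) ennreal_inj) auto
    then show ?thesis unfolding primitive_def by (subst (1 2) one) (auto simp: s\<mu> s\<nu> f\<mu> \<nu>.finite_measure_axioms)
  qed
  have sf: "sigma_finite_measure \<mu>" "sigma_finite_measure \<nu>" "sigma_finite_measure (lborel::real measure)" by unfold_locales
  have L: "primitive a p \<nu> (\<lambda>_. 1) \<in> L1 a b"
    unfolding prim by (rule set_integral_Ioc_L1[OF sf(1) s\<mu>(1)]) simp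
  have "(LINT x:{a<..<b}|lebesgue. primitive a p \<nu> (\<lambda>_. 1) x * deriv g x) = - (LINT x|\<mu>. g x * 1)"
    if g: "g \<in> test_funs a b" for g
    using integral_by_parts_test_funs(1)[OF sf(1) s\<mu>(1) _ g, of "\<lambda>_. 1"] unfolding prim by simp
  then show ?thesis using L \<mu> sg unfolding BV_def by blast
qed

text \<open>The singular part of a comparison function: one jump of height \<open>J\<close> at
  \<open>m\<close>, where the weight is smallest.\<close>

lemma dirac_finite_borel_on:
  assumes "m \<in> {a<..<b}"
  shows "finite_borel_on a b (scale_measure (ennreal J) (return borel m))"
    and "{m} \<in> null_sets lborel" and "emeasure (scale_measure (ennreal J) (return borel m)) (- {m}) = 0"
  using assms by (auto simp: finite_borel_on_def space_scale_measure intro!: finite_measureI)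

section \<open>The weights\<close>

text \<open>With X = sqrt (W / (T (T - lam^2))) the density is lam X, the energy T X, and the
  integrand of A equals (T - lam^2) X. After squaring, the last bound follows from (k - 1)^2 >= 0;
  it is exact to first order at k = 1.\<close>

lemma calibration_identities:
  fixes T W lam p :: real
  assumes T: "lam\<^sup>2 < T" and W: "0 < W" and lam: "0 < lam"
    and p: "p = sqrt (lam\<^sup>2 * W / (T * (T - lam\<^sup>2)))"
  shows "0 < p"
    and "sqrt (T * p\<^sup>2 + W) = sqrt (T * W / (T - lam\<^sup>2))"
    and "sqrt (T * p\<^sup>2 + W) = sqrt ((T - lam\<^sup>2) / T * W) + lam * p"
    and "0 \<le> k \<Longrightarrow> k < 1 \<Longrightarrow> sqrt (T * (k * p)\<^sup>2 + W) < sqrt (T * p\<^sup>2 + W)"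
    and "1 \<le> k \<Longrightarrow> sqrt (T * (k * p)\<^sup>2 + W) \<le> sqrt (T * p\<^sup>2 + W) + k * lam * (k - 1) * p"
proof -
  have T0: "0 < T" using T zero_le_power2[of lam] by linarith
  define X where "X = sqrt (W / (T * (T - lam\<^sup>2)))"
  have X: "0 < X" using T T0 W by (simp add: X_def)
  have "X\<^sup>2 = W / (T * (T - lam\<^sup>2))" using T T0 W by (simp add: X_def)
  then have WX: "W = T * (T - lam\<^sup>2) * X\<^sup>2" using T T0 by (simp add: field_simps)
  have pX: "p = lam * X" unfolding p X_def using lam by (simp add: real_sqrt_mult real_sqrt_divide)
  show "0 < p" using lam X pX by simp
  have 1: "T * p\<^sup>2 + W = (T * X)\<^sup>2" unfolding WX pX by (simp add: algebra_simps power2_eq_square)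
  have 2: "T * W / (T - lam\<^sup>2) = (T * X)\<^sup>2" unfolding WX using T by (simp add: power2_eq_square)
  have 3: "(T - lam\<^sup>2) / T * W = ((T - lam\<^sup>2) * X)\<^sup>2" unfolding WX using T0 by (simp add: power2_eq_square)
  have s1: "sqrt (T * p\<^sup>2 + W) = T * X" unfolding 1 using X T0 by (subst real_sqrt_unique) auto
  have s3: "sqrt ((T - lam\<^sup>2) / T * W) = (T - lam\<^sup>2) * X" unfolding 3 using X T by (subst real_sqrt_unique) auto
  show "sqrt (T * p\<^sup>2 + W) = sqrt (T * W / (T - lam\<^sup>2))" unfolding 1 2 ..
  show "sqrt (T * p\<^sup>2 + W) = sqrt ((T - lam\<^sup>2) / T * W) + lam * p"
    unfolding s1 s3 by (simp add: pX algebra_simps power2_eq_square)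
  show "sqrt (T * (k * p)\<^sup>2 + W) < sqrt (T * p\<^sup>2 + W)" if "0 \<le> k" "k < 1"
  proof -
    have "k * p < p" using that \<open>0 < p\<close> by simp
    then have "(k * p)\<^sup>2 < p\<^sup>2" using that \<open>0 < p\<close> by (intro power_strict_mono) auto
    then show ?thesis using T0 by simp
  qed
  show "sqrt (T * (k * p)\<^sup>2 + W) \<le> sqrt (T * p\<^sup>2 + W) + k * lam * (k - 1) * p" if k: "1 \<le> k"
  proof -
    let ?d = "k * (k - 1) * lam\<^sup>2"
    have d: "0 \<le> ?d" using k by simp
    have "(k\<^sup>2 - 1) \<le> 2 * (k * (k - 1))" using k zero_le_power2[of "k - 1"]
      by (simp add: power2_eq_square algebra_simps)
    then have "T * ((k\<^sup>2 - 1) * lam\<^sup>2) \<le> T * ((2 * (k * (k - 1))) * lam\<^sup>2)"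
      using T0 by (intro mult_left_mono mult_right_mono) auto
    then have "T * (k\<^sup>2 * lam\<^sup>2 + T - lam\<^sup>2) \<le> (T + ?d)\<^sup>2"
      using zero_le_power2[of ?d] by (simp add: power2_eq_square algebra_simps)
    then have "T * (k\<^sup>2 * lam\<^sup>2 + T - lam\<^sup>2) * X\<^sup>2 \<le> (T + ?d)\<^sup>2 * X\<^sup>2"
      by (intro mult_right_mono) auto
    then have "T * (k * p)\<^sup>2 + W \<le> ((T + ?d) * X)\<^sup>2"
      unfolding WX pX power_mult_distrib by (simp add: algebra_simps)
    then have "sqrt (T * (k * p)\<^sup>2 + W) \<le> (T + ?d) * X"
      using T0 d X by (intro real_le_lsqrt) auto
    also have "\<dots> = sqrt (T * p\<^sup>2 + W) + k * lam * (k - 1) * p"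
      unfolding s1 by (simp add: pX algebra_simps power2_eq_square)
    finally show ?thesis .
  qed
qed

locale admissible_data =
  fixes l Q \<omega> \<phi> :: "real \<Rightarrow> real" and m :: real
  assumes adm: "admissible l Q \<omega> \<phi>" and m: "0 < m" "m < 1"
begin

abbreviation \<theta> :: "real \<Rightarrow> real" where "\<theta> \<equiv> theta l Q \<omega>"

lemma theta_less: "0 \<le> x \<Longrightarrow> x < y \<Longrightarrow> y < 1 \<Longrightarrow> \<theta> x < \<theta> y"
  using adm by (auto simp: admissible_def strict_mono_on_def)

lemma theta_pos: "0 < x \<Longrightarrow> x < 1 \<Longrightarrow> 0 < \<theta> x"
proof -
  assume x: "0 < x" "x < 1"
  have "\<theta> 0 = 0" using adm by (auto simp: admissible_def theta_def)
  with theta_less[of 0 x] x show ?thesis by simp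
qed

lemma theta_continuous: "continuous_on {0..<1} \<theta>"
proof -
  have c: "continuous_on {0..1} l" "continuous_on {0..1} Q" "continuous_on {0..1} \<omega>"
    and Q: "\<And>t. t \<in> {0..1} \<Longrightarrow> Q t = 0 \<longleftrightarrow> t = 0"
    using adm by (auto simp: admissible_def)
  have r: "continuous_on {0..<1} (\<lambda>t. f (1 - t))" if "continuous_on {0..1} f" for f :: "real \<Rightarrow> real"
    by (rule continuous_on_compose2[OF that]) (auto intro!: continuous_intros)
  show ?thesis unfolding theta_def
    by (intro continuous_intros r c continuous_on_subset[OF c(1)]) (use Q in auto)
qed

lemma omega_pos: "0 < x \<Longrightarrow> x \<le> 1 \<Longrightarrow> 0 < \<omega> x"
  using adm by (auto simp: admissible_def order_less_le)

lemma omega_bound: obtains K where "\<And>x. x \<in> {0..1} \<Longrightarrow> \<omega> x \<le> K"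
proof -
  have "bounded (\<omega> ` {0..1})"
    using adm by (intro compact_imp_bounded compact_continuous_image) (auto simp: admissible_def)
  then obtain K where "\<forall>x\<in>{0..1}. \<bar>\<omega> x\<bar> \<le> K" by (auto simp: bounded_iff)
  then show ?thesis using that[of K] by force
qed

text \<open>Monotonicity turns the left limit at 1 into a supremum, possibly infinite, and any value
  taken beyond \<open>m\<close> is a strictly larger lower bound. A real \<open>r\<close> keeps
  later estimates in the reals.\<close>

lemma sqrt_theta_end_ge:
  obtains r where "sqrt (\<theta> m) < r" "ereal r \<le> sqrt_theta_end l Q \<omega>"
proof
  let ?x = "(m + 1) / 2"
  have x: "0 < ?x" "m < ?x" "?x < 1" using m by auto
  show "sqrt (\<theta> m) < sqrt (\<theta> ?x)" using theta_less[of m ?x] x m by simp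
  define L where "L = (SUP t\<in>{0..<1}. ereal (sqrt (\<theta> t)))"
  have "((\<lambda>t. ereal (sqrt (\<theta> t))) \<longlongrightarrow> L) (at_left 1)"
  proof (rule order_tendstoI)
    fix y assume "y < L"
    then obtain t where t: "t \<in> {0..<1}" "y < ereal (sqrt (\<theta> t))" unfolding L_def less_SUP_iff by blast
    have "\<forall>\<^sub>F u in at_left 1. u \<in> {t<..<1}" using t by (intro eventually_at_left_real) auto
    then show "\<forall>\<^sub>F u in at_left 1. y < ereal (sqrt (\<theta> u))"
    proof eventually_elim
      case (elim u)
      then have "sqrt (\<theta> t) < sqrt (\<theta> u)" using theta_less[of t u] t by simp
      with t(2) show ?case by (meson ereal_less_eq(3) less_imp_le order_less_le_trans)
    qed
  next
    fix y assume y: "L < y"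
    have "\<forall>\<^sub>F u in at_left 1. u \<in> {0<..<(1::real)}" by (intro eventually_at_left_real) auto
    then show "\<forall>\<^sub>F u in at_left 1. ereal (sqrt (\<theta> u)) < y"
    proof eventually_elim
      case (elim u)
      then have "ereal (sqrt (\<theta> u)) \<le> L" unfolding L_def by (intro SUP_upper) auto
      with y show ?case by simp
    qed
  qed
  then have "sqrt_theta_end l Q \<omega> = L" unfolding sqrt_theta_end_def by (intro tendsto_Lim) simp
  moreover have "ereal (sqrt (\<theta> ?x)) \<le> L" unfolding L_def using x by (intro SUP_upper) auto
  ultimately show "ereal (sqrt (\<theta> ?x)) \<le> sqrt_theta_end l Q \<omega>" by simp
qed

text \<open>Truncated to \<open>[m,1)\<close>, so that all integrands below are Borel functions vanishing off the interval.\<close>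

definition th :: "real \<Rightarrow> real" where "th t = indicator {m..<1} t * \<theta> t"
definition om :: "real \<Rightarrow> real" where "om t = indicator {m..<1} t * \<omega> (1 - t)"
definition reflect :: "real \<Rightarrow> real" where "reflect t = m + \<bar>t - m\<bar>"

lemma th_om_measurable [measurable]: "th \<in> borel_measurable borel" "om \<in> borel_measurable borel"
  and reflect_measurable [measurable]: "reflect \<in> borel_measurable borel"
proof -
  have "continuous_on {0..1} \<omega>" using adm by (auto simp: admissible_def)
  then have "continuous_on {m..<1} (\<lambda>t. \<omega> (1 - t))"
    by (rule continuous_on_compose2) (use m in \<open>auto intro!: continuous_intros\<close>)
  then have "(\<lambda>t. indicator {m..<1} t *\<^sub>R \<omega> (1 - t)) \<in> borel_measurable borel"
    by (intro borel_measurable_continuous_on_indicator) auto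
  then show "om \<in> borel_measurable borel" by (simp add: om_def[abs_def])
  have "continuous_on {m..<1} \<theta>" using theta_continuous by (rule continuous_on_subset) (use m in auto)
  then have "(\<lambda>t. indicator {m..<1} t *\<^sub>R \<theta> t) \<in> borel_measurable borel"
    by (intro borel_measurable_continuous_on_indicator) auto
  then show "th \<in> borel_measurable borel" by (simp add: th_def[abs_def])
  show "reflect \<in> borel_measurable borel" unfolding reflect_def[abs_def] by measurable
qed

lemma reflect_in: "reflect t \<in> {m..<1} \<longleftrightarrow> t \<in> {2*m - 1<..<1}"
  by (auto simp: reflect_def abs_if)

lemma reflect_eq_m: "reflect t = m \<longleftrightarrow> t = m" by (auto simp: reflect_def)

lemma th_om_outside: "t \<notin> {m..<1} \<Longrightarrow> th t = 0" "t \<notin> {m..<1} \<Longrightarrow> om t = 0"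
  by (auto simp: th_def om_def)

lemma th_om_inside: "t \<in> {m..<1} \<Longrightarrow> th t = \<theta> t" "t \<in> {m..<1} \<Longrightarrow> om t = \<omega> (1 - t)"
  by (auto simp: th_def om_def)

lemma theta_m_omega_m:
  assumes "t \<in> {2*m - 1<..<1}"
  shows "theta_m l Q \<omega> m t = th (reflect t)" "omega_m \<omega> m (1 - t) = om (reflect t)"
  using assms reflect_in[of t] by (auto simp: theta_m_def omega_m_def th_om_inside reflect_def algebra_simps)

lemma th_bounds:
  assumes "t \<in> {m<..<1}" shows "\<theta> m < th t" "0 < om t"
  using assms m theta_less[of m t] omega_pos[of "1 - t"] by (auto simp: th_om_inside)

lemma om_nonneg: "0 \<le> om t"
proof (cases "t \<in> {m..<1}")
  case True
  then show ?thesis using omega_pos[of "1 - t"] m by (auto simp: th_om_inside)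
qed (simp add: th_om_outside)

lemma th_ge: "t \<in> {m..<1} \<Longrightarrow> \<theta> m \<le> th t"
  using th_bounds(1)[of t] by (cases "t = m") (auto simp: th_om_inside)

lemma th_nonneg: "0 \<le> th t"
  using th_ge[of t] theta_pos[OF m] th_om_outside[of t] by (cases "t \<in> {m..<1}") auto

text \<open>The reflection x = 2m - t maps one half onto the other with Jacobian of modulus 1, and
  the point \<open>m\<close> is null. This matches the factor 2 in A and B.\<close>

lemma nn_integral_half:
  assumes [measurable]: "F \<in> borel_measurable borel" and out: "\<And>t. t \<notin> {m..<1} \<Longrightarrow> F t = (0::real)"
  shows "(\<integral>\<^sup>+t\<in>{2*m - 1<..m}. ennreal (F (reflect t)) \<partial>lborel) = (\<integral>\<^sup>+t\<in>{m<..<1}. ennreal (F t) \<partial>lborel)"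
    and "(\<integral>\<^sup>+t. ennreal (F (reflect t)) \<partial>lborel) = 2 * (\<integral>\<^sup>+t\<in>{m<..<1}. ennreal (F t) \<partial>lborel)"
proof -
  have "(\<integral>\<^sup>+t\<in>{2*m - 1<..m}. ennreal (F (reflect t)) \<partial>lborel)
      = (\<integral>\<^sup>+t. ennreal (F (reflect (2*m + (-1) * t))) * indicator {2*m - 1<..m} (2*m + (-1) * t) \<partial>lborel)"
    by (subst nn_integral_real_affine[where c="-1" and t="2*m"]) auto
  also have "\<dots> = (\<integral>\<^sup>+t\<in>{m<..<1}. ennreal (F t) \<partial>lborel)"
    by (intro nn_integral_cong_AE AE_I'[of "{m}"]) (auto simp: indicator_def reflect_def)
  finally show half: "(\<integral>\<^sup>+t\<in>{2*m - 1<..m}. ennreal (F (reflect t)) \<partial>lborel) = (\<integral>\<^sup>+t\<in>{m<..<1}. ennreal (F t) \<partial>lborel)" .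
  have "(\<integral>\<^sup>+t. ennreal (F (reflect t)) \<partial>lborel)
    = (\<integral>\<^sup>+t. ennreal (F (reflect t)) * indicator {2*m - 1<..m} t + ennreal (F t) * indicator {m<..<1} t \<partial>lborel)"
  proof (intro nn_integral_cong)
    fix t show "ennreal (F (reflect t)) = ennreal (F (reflect t)) * indicator {2*m - 1<..m} t + ennreal (F t) * indicator {m<..<1} t"
      using out[of "reflect t"] reflect_in[of t] m
      by (cases "t \<le> m") (auto simp: indicator_def reflect_def)
  qed
  also have "\<dots> = (\<integral>\<^sup>+t\<in>{2*m - 1<..m}. ennreal (F (reflect t)) \<partial>lborel) + (\<integral>\<^sup>+t\<in>{m<..<1}. ennreal (F t) \<partial>lborel)"
    by (intro nn_integral_add) auto
  finally show "(\<integral>\<^sup>+t. ennreal (F (reflect t)) \<partial>lborel) = 2 * (\<integral>\<^sup>+t\<in>{m<..<1}. ennreal (F t) \<partial>lborel)"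
    unfolding half by (simp add: mult_2)
qed

text \<open>Links the untruncated integrands on (m,1) with the folded Borel functions on the line.
  Agreement almost everywhere suffices, which also admits integrands containing
  \<open>ac_deriv\<close>.\<close>

lemma eint_half:
  assumes F: "F \<in> borel_measurable borel" "\<And>t. t \<notin> {m..<1} \<Longrightarrow> F t = 0"
    and f: "AE t in lborel. t \<in> {m<..<1} \<longrightarrow> f t = F t"
  shows "2 * eint m 1 f = enn2ereal (\<integral>\<^sup>+t. ennreal (F (reflect t)) \<partial>lborel)"
proof -
  have "(\<integral>\<^sup>+t\<in>{m<..<1}. ennreal (f t) \<partial>lborel) = (\<integral>\<^sup>+t\<in>{m<..<1}. ennreal (F t) \<partial>lborel)"
    by (intro nn_integral_cong_AE) (use f in \<open>auto elim!: eventually_mono simp: indicator_def\<close>)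
  then have "2 * eint m 1 f = enn2ereal (2 * (\<integral>\<^sup>+t\<in>{m<..<1}. ennreal (F t) \<partial>lborel))"
    by (simp add: eint_def times_ennreal.rep_eq)
  also have "2 * (\<integral>\<^sup>+t\<in>{m<..<1}. ennreal (F t) \<partial>lborel) = (\<integral>\<^sup>+t. ennreal (F (reflect t)) \<partial>lborel)"
    by (rule nn_integral_half(2)[OF F, symmetric])
  finally show ?thesis .
qed

end

section \<open>Bulk energies\<close>

lemma enn2ereal_nn_integral:
  assumes "integrable M f" "\<And>x. 0 \<le> f x"
  shows "enn2ereal (\<integral>\<^sup>+x. ennreal (f x) \<partial>M) = ereal (LINT x|M. f x)"
  using assms by (simp add: nn_integral_eq_integral integral_nonneg_AE)

lemma integral_strict_mono_AE:
  fixes f g :: "'a \<Rightarrow> real"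
  assumes fg: "integrable M f" "integrable M g" "AE x in M. f x \<le> g x"
    and A: "A \<in> sets M" "emeasure M A \<noteq> 0" "AE x in M. x \<in> A \<longrightarrow> f x \<noteq> g x"
  shows "(LINT x|M. f x) < (LINT x|M. g x)"
proof (rule ccontr)
  assume "\<not> ?thesis"
  then have "(LINT x|M. g x - f x) = 0" using integral_mono_AE[OF fg] fg by simp
  then have "AE x in M. g x - f x = 0"
    using fg by (subst (asm) integral_nonneg_eq_0_iff_AE) auto
  with A(3) have "AE x in M. x \<notin> A" by eventually_elim auto
  moreover have "{x \<in> space M. \<not> x \<notin> A} = A" using sets.sets_into_space[OF A(1)] by auto
  ultimately show False using A AE_iff_measurable[of A M "\<lambda>x. x \<notin> A"] by simp
qed

context admissible_data
begin

text \<open>The h of the overview before reflection. Division by 0 yields 0, so it vanishes off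
  [m,1) and, for the critical value of \<open>lam\<close>, where lam^2 equals theta at
  \<open>m\<close>, also at the point \<open>m\<close> itself.\<close>

definition H :: "real \<Rightarrow> real \<Rightarrow> real" where
  "H lam t = sqrt (lam\<^sup>2 * om t / (th t * (th t - lam\<^sup>2)))"

definition AA :: "real \<Rightarrow> real \<Rightarrow> real" where
  "AA lam t = sqrt ((th t - lam\<^sup>2) / th t * om t)"

definition energy :: "real \<Rightarrow> real \<Rightarrow> real \<Rightarrow> real" where
  "energy k lam t = sqrt (th t * (k * H lam t)\<^sup>2 + om t)"

lemma integrand_measurable [measurable]:
  "H lam \<in> borel_measurable borel" "AA lam \<in> borel_measurable borel" "energy k lam \<in> borel_measurable borel"
  unfolding H_def[abs_def] AA_def[abs_def] energy_def[abs_def] by measurable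

lemma integrand_outside:
  assumes "t \<notin> {m..<1}"
  shows "H lam t = 0" "AA lam t = 0" "energy k lam t = 0"
  using th_om_outside[OF assms] by (auto simp: H_def AA_def energy_def)

lemma integrand_outside_reflect:
  assumes "t \<notin> {2*m - 1<..<1}"
  shows "H lam (reflect t) = 0" "AA lam (reflect t) = 0" "energy k lam (reflect t) = 0"
  using integrand_outside[of "reflect t"] assms reflect_in[of t] by auto

lemma integrand_nonneg:
  assumes "lam\<^sup>2 \<le> \<theta> m"
  shows "0 \<le> H lam t" "0 \<le> AA lam t" "0 \<le> energy k lam t"
proof -
  have "0 \<le> H lam t \<and> 0 \<le> AA lam t"
  proof (cases "t \<in> {m..<1}")
    case True
    then have "0 \<le> th t - lam\<^sup>2" using th_ge[of t] assms by simp
    then show ?thesis using om_nonneg[of t] th_nonneg[of t] unfolding H_def AA_def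
      by (intro conjI real_sqrt_ge_zero divide_nonneg_nonneg mult_nonneg_nonneg) simp_all
  qed (simp add: integrand_outside)
  then show "0 \<le> H lam t" "0 \<le> AA lam t" by auto
  show "0 \<le> energy k lam t" using th_nonneg[of t] om_nonneg[of t] by (simp add: energy_def)
qed

text \<open>On the open interval theta strictly exceeds its value at \<open>m\<close>, so the
  pointwise identities hold even for the critical \<open>lam\<close>.\<close>

lemma energy_identities:
  assumes lam: "0 < lam" "lam\<^sup>2 \<le> \<theta> m" and t: "t \<in> {m<..<1}"
  shows "0 < H lam t"
    and "energy 1 lam t = sqrt (th t * om t / (th t - lam\<^sup>2))"
    and "energy 1 lam t = AA lam t + lam * H lam t"
    and "0 \<le> k \<Longrightarrow> k < 1 \<Longrightarrow> energy k lam t < energy 1 lam t"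
    and "1 \<le> k \<Longrightarrow> energy k lam t \<le> energy 1 lam t + k * lam * (k - 1) * H lam t"
proof -
  have "lam\<^sup>2 < th t" using lam th_bounds(1)[OF t] by linarith
  note c = calibration_identities[OF this th_bounds(2)[OF t] lam(1) H_def]
  show "0 < H lam t"
    and "energy 1 lam t = sqrt (th t * om t / (th t - lam\<^sup>2))"
    and "energy 1 lam t = AA lam t + lam * H lam t"
    and "0 \<le> k \<Longrightarrow> k < 1 \<Longrightarrow> energy k lam t < energy 1 lam t"
    and "1 \<le> k \<Longrightarrow> energy k lam t \<le> energy 1 lam t + k * lam * (k - 1) * H lam t"
    using c by (auto simp: energy_def AA_def)
qed

text \<open>The reflected argument equals \<open>m\<close> only at t = m, a null set; the degenerate
  quotients of the critical \<open>lam\<close> are confined to it.\<close>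

lemma AE_reflect:
  assumes "\<And>t. t \<in> {m<..<1} \<Longrightarrow> R t" "\<And>t. t \<notin> {m..<1} \<Longrightarrow> R t"
  shows "AE t in lborel. R (reflect t)"
proof (rule AE_I'[of "{m}"])
  show "{t \<in> space lborel. \<not> R (reflect t)} \<subseteq> {m}"
  proof
    fix t assume "t \<in> {t \<in> space lborel. \<not> R (reflect t)}"
    then have "reflect t = m" using assms[of "reflect t"] by fastforce
    then show "t \<in> {m}" by (simp add: reflect_eq_m)
  qed
qed auto

lemma bounded_reflect_integrable:
  assumes [measurable]: "F \<in> borel_measurable borel" and out: "\<And>t. t \<notin> {m..<1} \<Longrightarrow> F t = (0::real)"
    and bound: "\<And>t. t \<in> {m..<1} \<Longrightarrow> \<bar>F t\<bar> \<le> K"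
  shows "integrable lborel (\<lambda>t. F (reflect t))"
proof (rule Bochner_Integration.integrable_bound[of _ "\<lambda>t. K * indicator {2*m - 1<..<1} t"])
  show "integrable lborel (\<lambda>t. K * indicator {2*m - 1<..<1} t)" using m by simp
  show "AE t in lborel. norm (F (reflect t)) \<le> norm (K * indicator {2*m - 1<..<1} t)"
  proof (rule AE_I2)
    fix t show "norm (F (reflect t)) \<le> norm (K * indicator {2*m - 1<..<1} t)"
      using out[of "reflect t"] order_trans[OF bound abs_ge_self, of "reflect t"] reflect_in[of t]
      by (cases "t \<in> {2*m - 1<..<1}") auto
  qed
qed simp

lemma om_bound: obtains K where "0 \<le> K" "\<And>t. om t \<le> K"
proof -
  obtain K where K: "\<And>x. x \<in> {0..1} \<Longrightarrow> \<omega> x \<le> K" using omega_bound by blast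
  show ?thesis
  proof (rule that[of "max 0 K"])
    show "om t \<le> max 0 K" for t
      using K[of "1 - t"] m by (cases "t \<in> {m..<1}") (auto simp: th_om_inside th_om_outside le_max_iff_disj)
  qed simp
qed

text \<open>The factor (th - lam^2) / th lies in [0,1], so the integrand is at most the square root
  of the bounded \<open>om\<close>. Hence A is finite independently of B.\<close>

lemma AA_integrable:
  assumes "lam\<^sup>2 \<le> \<theta> m"
  shows "integrable lborel (\<lambda>t. AA lam (reflect t))"
proof -
  obtain K where K: "0 \<le> K" "\<And>t. om t \<le> K" using om_bound by blast
  show ?thesis
  proof (rule bounded_reflect_integrable[of _ "sqrt K"])
    fix t assume t: "t \<in> {m..<1}"
    have T: "0 < th t" using th_ge[OF t] theta_pos[OF m] by linarith
    then have "(th t - lam\<^sup>2) / th t \<le> 1" by simp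
    moreover have "0 \<le> (th t - lam\<^sup>2) / th t" using T th_ge[OF t] assms by simp
    ultimately have "(th t - lam\<^sup>2) / th t * om t \<le> 1 * K"
      using K om_nonneg[of t] by (intro mult_mono) auto
    then have "AA lam t \<le> sqrt K" unfolding AA_def by (intro real_sqrt_le_mono) simp
    then show "\<bar>AA lam t\<bar> \<le> sqrt K" using integrand_nonneg(2)[OF assms, of t] by simp
  qed (auto simp: integrand_outside)
qed

lemma sqrt_om_integrable: "integrable lborel (\<lambda>t. sqrt (om (reflect t)))"
proof -
  obtain K where K: "0 \<le> K" "\<And>t. om t \<le> K" using om_bound by blast
  show ?thesis
    by (rule bounded_reflect_integrable[where F="\<lambda>t. sqrt (om t)" and K="sqrt K"])
       (use K om_nonneg th_om_outside in auto)
qed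

text \<open>\<open>slope\<close> is \<open>B(m,\<lambda>)\<close>, \<open>bulk\<close> is \<open>A(m,\<lambda>)\<close>, and \<open>cost k\<close> is the bulk energy of the density \<open>k h\<close>.\<close>

definition slope :: "real \<Rightarrow> real" where "slope lam = (LINT t|lborel. H lam (reflect t))"
definition bulk :: "real \<Rightarrow> real" where "bulk lam = (LINT t|lborel. AA lam (reflect t))"
definition cost :: "real \<Rightarrow> real \<Rightarrow> real" where "cost k lam = (LINT t|lborel. energy k lam (reflect t))"

section \<open>Energies of the scaled densities when B is finite\<close>

context
  fixes lam :: real
  assumes lam: "0 < lam" "lam\<^sup>2 \<le> \<theta> m" and Hint: "integrable lborel (\<lambda>t. H lam (reflect t))"
begin

lemma energy_one_AE: "AE t in lborel. energy 1 lam (reflect t) = AA lam (reflect t) + lam * H lam (reflect t)"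
  by (rule AE_reflect) (use energy_identities(3)[OF lam] integrand_outside in auto)

lemma energy_integrable:
  assumes "0 \<le> k"
  shows "integrable lborel (\<lambda>t. energy k lam (reflect t))"
proof (rule Bochner_Integration.integrable_bound)
  \<comment> \<open>The energy at k = 1 plus k lam k h is one majorant for k < 1, by monotonicity,
    and for k >= 1, by the first-order bound with k - 1 enlarged to k.\<close>
  show "integrable lborel (\<lambda>t. (AA lam (reflect t) + lam * H lam (reflect t)) + k * lam * k * H lam (reflect t))"
    using AA_integrable[OF lam(2)] Hint by simp
  show "AE t in lborel. norm (energy k lam (reflect t)) \<le> norm ((AA lam (reflect t) + lam * H lam (reflect t)) + k * lam * k * H lam (reflect t))"
  proof (rule AE_reflect)
    fix t assume t: "t \<in> {m<..<1}"
    note e = energy_identities[OF lam t]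
    have "energy k lam t \<le> energy 1 lam t + k * lam * k * H lam t"
    proof (cases "k < 1")
      case True
      then show ?thesis using e(4)[of k] assms e(1) lam(1) by (simp add: add_increasing2 less_imp_le)
    next
      case False
      have "k * lam * (k - 1) * H lam t \<le> k * lam * k * H lam t"
        using assms lam(1) e(1) by (intro mult_right_mono mult_left_mono) auto
      then have "energy 1 lam t + k * lam * (k - 1) * H lam t \<le> energy 1 lam t + k * lam * k * H lam t"
        by (rule add_left_mono)
      with e(5)[of k] False show ?thesis by linarith
    qed
    then show "norm (energy k lam t) \<le> norm ((AA lam t + lam * H lam t) + k * lam * k * H lam t)"
      using integrand_nonneg(1,2)[OF lam(2), of t] integrand_nonneg(3)[OF lam(2), where k=k and t=t] e(3) lam(1) assms
      by simp
  qed (simp add: integrand_outside)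
qed simp

lemma cost_one: "cost 1 lam = bulk lam + lam * slope lam"
proof -
  have "cost 1 lam = (LINT t|lborel. AA lam (reflect t) + lam * H lam (reflect t))"
    unfolding cost_def by (intro integral_cong_AE energy_one_AE) auto
  then show ?thesis using AA_integrable[OF lam(2)] Hint by (simp add: bulk_def slope_def)
qed

lemma interval_pos: "emeasure lborel {m<..<1} \<noteq> 0"
  using m by simp

lemma reflect_right: "t \<in> {m<..<1} \<Longrightarrow> reflect t = t"
  by (auto simp: reflect_def)

text \<open>Strictness survives integration because the pointwise inequality is strict on (m,1), a
  set of positive measure.\<close>

lemma cost_strict:
  assumes k: "0 \<le> k" "k < 1"
  shows "cost k lam < cost 1 lam"
  unfolding cost_def
proof (rule integral_strict_mono_AE[OF energy_integrable energy_integrable _ _ interval_pos])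
  show "AE t in lborel. t \<in> {m<..<1} \<longrightarrow> energy k lam (reflect t) \<noteq> energy 1 lam (reflect t)"
  proof (rule AE_I2, rule impI)
    fix t assume t: "t \<in> {m<..<1}"
    then show "energy k lam (reflect t) \<noteq> energy 1 lam (reflect t)"
      using energy_identities(4)[OF lam t k] reflect_right[OF t] by simp
  qed
  show "AE t in lborel. energy k lam (reflect t) \<le> energy 1 lam (reflect t)"
    by (rule AE_reflect) (use energy_identities(4)[OF lam _ k] in \<open>auto simp: integrand_outside less_imp_le\<close>)
qed (use k in auto)

lemma cost_upper:
  assumes k: "1 \<le> k"
  shows "cost k lam \<le> cost 1 lam + k * lam * (k - 1) * slope lam"
proof -
  have "cost k lam \<le> (LINT t|lborel. energy 1 lam (reflect t) + k * lam * (k - 1) * H lam (reflect t))"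
    unfolding cost_def
  proof (rule integral_mono_AE)
    show "AE t in lborel. energy k lam (reflect t) \<le> energy 1 lam (reflect t) + k * lam * (k - 1) * H lam (reflect t)"
      by (rule AE_reflect) (use energy_identities(5)[OF lam _ k] in \<open>auto simp: integrand_outside\<close>)
  qed (use energy_integrable Hint k in auto)
  also have "\<dots> = cost 1 lam + k * lam * (k - 1) * slope lam"
    using energy_integrable[of 1] Hint by (simp add: cost_def slope_def)
  finally show ?thesis .
qed

lemma slope_pos: "0 < slope lam"
proof -
  have "(LINT t|lborel. (\<lambda>_::real. 0) t) < (LINT t|lborel. H lam (reflect t))"
  proof (rule integral_strict_mono_AE[of lborel "\<lambda>_. 0", OF _ Hint _ _ interval_pos])
    show "AE t in lborel. t \<in> {m<..<1} \<longrightarrow> 0 \<noteq> H lam (reflect t)"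
    proof (rule AE_I2, rule impI)
      fix t assume t: "t \<in> {m<..<1}"
      then show "0 \<noteq> H lam (reflect t)" using energy_identities(1)[OF lam t] reflect_right[OF t] by simp
    qed
  qed (use integrand_nonneg(1)[OF lam(2)] in auto)
  then show ?thesis by (simp add: slope_def)
qed

lemma B_fun_eq: "B_fun l Q \<omega> m lam = ereal (slope lam)"
proof -
  have "B_fun l Q \<omega> m lam = enn2ereal (\<integral>\<^sup>+t. ennreal (H lam (reflect t)) \<partial>lborel)"
    unfolding B_fun_def
  proof (rule eint_half[OF integrand_measurable(1) integrand_outside(1)], assumption, rule AE_I2, rule impI)
    fix t assume "t \<in> {m<..<1}"
    then have t: "t \<in> {m..<1}" by simp
    show "sqrt (lam\<^sup>2 * \<omega> (1 - t) / (\<theta> t * (\<theta> t - lam\<^sup>2))) = H lam t" unfolding H_def th_om_inside[OF t] ..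
  qed
  also have "\<dots> = ereal (slope lam)"
    unfolding slope_def by (rule enn2ereal_nn_integral[OF Hint integrand_nonneg(1)[OF lam(2)]])
  finally show ?thesis .
qed

lemma A_fun_eq: "A_fun l Q \<omega> m lam = ereal (bulk lam)"
proof -
  have out: "AA lam t = 0" if "t \<notin> {m..<1}" for t using integrand_outside(2)[OF that] .
  have ae: "AE t in lborel. t \<in> {m<..<1} \<longrightarrow> sqrt ((\<theta> t - lam\<^sup>2) / \<theta> t * \<omega> (1 - t)) = AA lam t"
  proof (rule AE_I2, rule impI)
    fix t assume "t \<in> {m<..<1}"
    then have t: "t \<in> {m..<1}" by simp
    show "sqrt ((\<theta> t - lam\<^sup>2) / \<theta> t * \<omega> (1 - t)) = AA lam t" unfolding AA_def th_om_inside[OF t] ..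
  qed
  have "A_fun l Q \<omega> m lam = enn2ereal (\<integral>\<^sup>+t. ennreal (AA lam (reflect t)) \<partial>lborel)"
    unfolding A_fun_def by (rule eint_half[OF integrand_measurable(2) out ae])
  also have "\<dots> = ereal (bulk lam)"
    using enn2ereal_nn_integral[OF AA_integrable[OF lam(2)] integrand_nonneg(2)[OF lam(2)]] by (simp only: bulk_def)
  finally show ?thesis .
qed

lemma cost_ereal: "0 \<le> k \<Longrightarrow> enn2ereal (\<integral>\<^sup>+t. ennreal (energy k lam (reflect t)) \<partial>lborel) = ereal (cost k lam)"
  unfolding cost_def using enn2ereal_nn_integral[OF energy_integrable[of k] integrand_nonneg(3)[OF lam(2)]] by blast

lemma eint_energy:
  assumes "AE t in lborel. t \<in> {m<..<1} \<longrightarrow> f t = energy 1 lam t"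
  shows "2 * eint m 1 f = ereal (bulk lam + lam * slope lam)"
proof -
  have "2 * eint m 1 f = enn2ereal (\<integral>\<^sup>+t. ennreal (energy 1 lam (reflect t)) \<partial>lborel)"
    by (rule eint_half[OF integrand_measurable(3) integrand_outside(3) assms])
  then show ?thesis by (simp add: cost_ereal cost_one)
qed

lemma eint_explicit:
  "2 * eint m 1 (\<lambda>t. sqrt (\<theta> t * \<omega> (1 - t) / (\<theta> t - lam\<^sup>2))) = ereal (bulk lam + lam * slope lam)"
proof (rule eint_energy, rule AE_I2, rule impI)
  fix t assume "t \<in> {m<..<1}"
  then show "sqrt (\<theta> t * \<omega> (1 - t) / (\<theta> t - lam\<^sup>2)) = energy 1 lam t"
    using energy_identities(2)[OF lam] th_om_inside[of t] by simp
qed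

text \<open>By symmetry about \<open>m\<close>, half of the rise of the density happens before
  \<open>m\<close>; this puts B/2 into the trace at \<open>m\<close>.\<close>

lemma half_slope: "(LINT t:{2*m - 1<..m}|lborel. H lam (reflect t)) = slope lam / 2"
proof -
  let ?n = "\<integral>\<^sup>+t\<in>{m<..<1}. ennreal (H lam t) \<partial>lborel"
  have out: "\<And>t. t \<notin> {m..<1} \<Longrightarrow> H lam t = 0" by (simp add: integrand_outside)
  have "ennreal (slope lam) = (\<integral>\<^sup>+t. ennreal (H lam (reflect t)) \<partial>lborel)"
    unfolding slope_def using nn_integral_eq_integral[OF Hint] integrand_nonneg(1)[OF lam(2)] by simp
  also have "\<dots> = 2 * ?n" by (rule nn_integral_half(2)[OF integrand_measurable(1) out])
  finally have "ennreal (slope lam) = 2 * ?n" .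
  moreover have "ennreal (LINT t:{2*m - 1<..m}|lborel. H lam (reflect t)) = ?n"
  proof -
    have i: "integrable lborel (\<lambda>t. indicator {2*m - 1<..m} t *\<^sub>R H lam (reflect t))"
      using Hint by (intro integrable_mult_indicator) auto
    have "ennreal (LINT t:{2*m - 1<..m}|lborel. H lam (reflect t))
        = (\<integral>\<^sup>+t. ennreal (indicator {2*m - 1<..m} t *\<^sub>R H lam (reflect t)) \<partial>lborel)"
      unfolding set_lebesgue_integral_def
      by (subst nn_integral_eq_integral[OF i]) (auto simp: integrand_nonneg(1)[OF lam(2)])
    also have "\<dots> = (\<integral>\<^sup>+t\<in>{2*m - 1<..m}. ennreal (H lam (reflect t)) \<partial>lborel)"
      by (intro nn_integral_cong) (auto simp: indicator_def)
    also have "\<dots> = ?n" by (rule nn_integral_half(1)[OF integrand_measurable(1) out])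
    finally show ?thesis .
  qed
  moreover have nn: "0 \<le> (LINT t:{2*m - 1<..m}|lborel. H lam (reflect t))"
    unfolding set_lebesgue_integral_def
    by (intro integral_nonneg_AE) (auto simp: integrand_nonneg(1)[OF lam(2)])
  ultimately have "ennreal (slope lam) = ennreal (2 * (LINT t:{2*m - 1<..m}|lborel. H lam (reflect t)))"
    by (simp add: ennreal_mult)
  then have "slope lam = 2 * (LINT t:{2*m - 1<..m}|lborel. H lam (reflect t))"
    using nn slope_pos by (subst (asm) ennreal_inj) auto
  then show ?thesis by simp
qed

end

end

section \<open>Comparison functions and the minimizer\<close>

context admissible_data
begin

text \<open>The primitive of \<open>P\<close> with a jump \<open>J\<close> at \<open>m\<close>
  starts at 0 and ends at \<open>s\<close>, so both boundary terms are 0 even if their weight is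
  infinite. The jump is paid at the weight of the point \<open>m\<close>.\<close>

lemma competitor:
  assumes P: "integrable lborel P" "\<And>t. 0 \<le> P t" "\<And>t. t \<notin> {2*m - 1<..<1} \<Longrightarrow> P t = 0"
    and J: "0 \<le> J" "(LINT t|lborel. P t) + J = s"
  shows "\<exists>v\<in>L1 (2*m - 1) 1. scG l Q \<omega> m s v =
     enn2ereal (\<integral>\<^sup>+t. ennreal (sqrt (th (reflect t) * (P t)\<^sup>2 + om (reflect t))) \<partial>lborel) + ereal (J * sqrt (\<theta> m))"
proof -
  let ?a = "2*m - 1"
  define \<nu> where "\<nu> = scale_measure (ennreal J) (return borel m)"
  define v where "v = primitive ?a P \<nu> (\<lambda>_. 1)"
  have mI: "m \<in> {?a<..<1}" and a1: "?a < 1" using m by auto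
  note \<nu> = dirac_finite_borel_on(1)[OF mI, of J, folded \<nu>_def] dirac_finite_borel_on(2)[OF mI]
    dirac_finite_borel_on(3)[OF mI, of J, folded \<nu>_def]
  have sg: "sign_fun (\<lambda>_. 1)" by (simp add: sign_fun_def)
  have vL: "v \<in> L1 ?a 1" and dec: "bv_decomp ?a 1 v P \<nu> (\<lambda>_. 1)"
    unfolding v_def using primitive_bv_decomp[OF P(1) \<nu>(1) sg \<nu>(2,3)] by auto
  have vBV: "v \<in> BV ?a 1" unfolding v_def by (rule primitive_nonneg_BV[OF P \<nu>(1)])
  have sv: "sing_var ?a 1 v = \<nu>" by (rule sing_var_eq[OF vL a1 dec])
  have ac: "AE t in lborel. t \<in> {?a<..<1} \<longrightarrow> ac_deriv ?a 1 v t = P t" by (rule ac_deriv_eq[OF vL a1 dec])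
  have ae: "AE x in lborel. x \<in> {?a<..<1} \<longrightarrow> v x = 0 + primitive ?a P \<nu> (\<lambda>_. 1) x" by (simp add: v_def)
  have tr: "trace_right v ?a = 0"
    using trace_right_bv[OF ae P(1) \<nu>(1) sg] a1 by (simp add: primitive_start)
  have "(LINT y:{?a<..<1}|\<nu>. (1::real)) = J"
    using J(1) mI by (simp add: \<nu>_def set_lebesgue_integral_def space_scale_measure measure_def enn2real_mult)
  moreover have "(LINT y:{?a<..<1}|lborel. P y) = (LINT y|lborel. P y)"
  proof -
    have "indicator {?a<..<1} y *\<^sub>R P y = P y" for y using P(3)[of y] by (cases "y \<in> {?a<..<1}") auto
    then show ?thesis by (simp only: set_lebesgue_integral_def)
  qed
  ultimately have tl: "trace_left v 1 = s"
    using trace_left_bv[OF ae P(1) \<nu>(1) sg] a1 J(2) by simp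
  have E: "eint ?a 1 (\<lambda>t. sqrt (theta_m l Q \<omega> m t * \<bar>ac_deriv ?a 1 v t\<bar>\<^sup>2 + omega_m \<omega> m (1 - t)))
      = enn2ereal (\<integral>\<^sup>+t. ennreal (sqrt (th (reflect t) * (P t)\<^sup>2 + om (reflect t))) \<partial>lborel)"
    unfolding eint_def
  proof (intro arg_cong[of _ _ enn2ereal] nn_integral_cong_AE, use ac in eventually_elim)
    case (elim t)
    then show ?case
      using theta_m_omega_m[of t] th_om_outside[of "reflect t"] reflect_in[of t]
      by (cases "t \<in> {?a<..<1}") auto
  qed
  have S: "(\<integral>\<^sup>+t\<in>{?a<..<1}. ennreal (sqrt (theta_m l Q \<omega> m t)) \<partial>\<nu>) = ennreal (J * sqrt (\<theta> m))"
  proof -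
    have "(\<integral>\<^sup>+t\<in>{?a<..<1}. ennreal (sqrt (theta_m l Q \<omega> m t)) \<partial>\<nu>) = (\<integral>\<^sup>+t. ennreal (sqrt (th (reflect t))) \<partial>\<nu>)"
    proof (intro nn_integral_cong)
      fix t show "ennreal (sqrt (theta_m l Q \<omega> m t)) * indicator {?a<..<1} t = ennreal (sqrt (th (reflect t)))"
        using theta_m_omega_m(1)[of t] th_om_outside(1)[of "reflect t"] reflect_in[of t]
        by (cases "t \<in> {?a<..<1}") auto
    qed
    also have "\<dots> = ennreal J * ennreal (sqrt (th (reflect m)))"
      unfolding \<nu>_def by (subst nn_integral_scale_measure) (auto simp: nn_integral_return)
    also have "th (reflect m) = \<theta> m" using m by (simp add: reflect_def th_def)
    finally show ?thesis using J(1) by (simp add: ennreal_mult')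
  qed
  have "scG l Q \<omega> m s v =
     enn2ereal (\<integral>\<^sup>+t. ennreal (sqrt (th (reflect t) * (P t)\<^sup>2 + om (reflect t))) \<partial>lborel) + ereal (J * sqrt (\<theta> m))"
    unfolding scG_def E sv S tr tl using vBV J(1) theta_pos[OF m] by (simp add: zero_ereal_def[symmetric])
  with vL show ?thesis by blast
qed

text \<open>The weight splits into its minimum, taken at \<open>m\<close>, and an excess that is
  positive elsewhere. Equality makes the excess integrate to 0, so only the point \<open>m\<close>
  can be charged.\<close>

lemma singular_lower_bound:
  assumes \<nu>: "finite_borel_on (2*m - 1) 1 \<nu>"
  defines "X \<equiv> \<integral>\<^sup>+t\<in>{2*m - 1<..<1}. ennreal (sqrt (theta_m l Q \<omega> m t)) \<partial>\<nu>"
  shows "ennreal (sqrt (\<theta> m)) * emeasure \<nu> {2*m - 1<..<1} \<le> X"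
    and "X = ennreal (sqrt (\<theta> m)) * emeasure \<nu> {2*m - 1<..<1} \<Longrightarrow> emeasure \<nu> ({2*m - 1<..<1} - {m}) = 0"
proof -
  let ?I = "{2*m - 1<..<1}" and ?q = "sqrt (\<theta> m)"
  let ?D = "\<lambda>t. ennreal (sqrt (th (reflect t)) - ?q) * indicator ?I t"
  interpret \<nu>: finite_measure \<nu> using \<nu> by (simp add: finite_borel_on_def)
  have s [measurable_cong]: "sets \<nu> = sets borel" using \<nu> by (simp add: finite_borel_on_def)
  have q: "0 \<le> ?q" using theta_pos[OF m] by simp
  have ge: "?q \<le> sqrt (th (reflect t))" if "t \<in> ?I" for t
    using th_ge[of "reflect t"] reflect_in[of t] that by simp
  have "X = (\<integral>\<^sup>+t. ennreal ?q * indicator ?I t + ?D t \<partial>\<nu>)"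
    unfolding X_def
  proof (intro nn_integral_cong)
    fix t show "ennreal (sqrt (theta_m l Q \<omega> m t)) * indicator ?I t = ennreal ?q * indicator ?I t + ?D t"
    proof (cases "t \<in> ?I")
      case True
      then show ?thesis using ge[OF True] q theta_m_omega_m(1)[OF True]
        by (simp add: ennreal_plus[symmetric] del: ennreal_plus)
    qed simp
  qed
  also have "\<dots> = (\<integral>\<^sup>+t. ennreal ?q * indicator ?I t \<partial>\<nu>) + (\<integral>\<^sup>+t. ?D t \<partial>\<nu>)"
    by (intro nn_integral_add) auto
  also have "(\<integral>\<^sup>+t. ennreal ?q * indicator ?I t \<partial>\<nu>) = ennreal ?q * emeasure \<nu> ?I"
    by (intro nn_integral_cmult_indicator) (simp add: s)
  finally have X: "X = ennreal ?q * emeasure \<nu> ?I + (\<integral>\<^sup>+t. ?D t \<partial>\<nu>)" .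
  then show "ennreal ?q * emeasure \<nu> ?I \<le> X" by simp
  assume "X = ennreal ?q * emeasure \<nu> ?I"
  \<comment> \<open>Cancellation in \<open>ennreal\<close> requires this summand to be
    finite.\<close>
  moreover have "ennreal ?q * emeasure \<nu> ?I \<noteq> top" by (simp add: ennreal_mult_eq_top_iff)
  moreover have "ennreal ?q * emeasure \<nu> ?I + (\<integral>\<^sup>+t. ?D t \<partial>\<nu>) = ennreal ?q * emeasure \<nu> ?I + 0"
    using X calculation(1) by simp
  ultimately have "(\<integral>\<^sup>+t. ?D t \<partial>\<nu>) = 0"
    unfolding ennreal_add_left_cancel by simp
  then have "AE t in \<nu>. ?D t = 0" by (subst (asm) nn_integral_0_iff_AE) auto
  moreover have "t \<notin> ?I - {m}" if "?D t = 0" for t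
  proof
    assume t: "t \<in> ?I - {m}"
    then have "reflect t \<in> {m<..<1}" using reflect_in[of t] reflect_eq_m[of t] by auto
    then have "?q < sqrt (th (reflect t))" using th_bounds(1) by simp
    with that t show False by (auto simp: ennreal_eq_0_iff)
  qed
  ultimately have "AE t in \<nu>. t \<notin> ?I - {m}" by (auto elim!: eventually_mono)
  moreover have "{t \<in> space \<nu>. \<not> t \<notin> ?I - {m}} = ?I - {m}" using sets_eq_imp_space_eq[OF s] by auto
  ultimately show "emeasure \<nu> (?I - {m}) = 0"
    using AE_iff_measurable[of "?I - {m}" \<nu> "\<lambda>t. t \<notin> ?I - {m}"] by (simp add: s)
qed

lemma reflect_set_integral:
  "(LINT t:{2*m - 1<..<1}|lborel. H lam (reflect t)) = slope lam"
proof -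
  have "indicator {2*m - 1<..<1} t *\<^sub>R H lam (reflect t) = H lam (reflect t)" for t
    using integrand_outside_reflect(1)[of t] by (cases "t \<in> {2*m - 1<..<1}") auto
  then show ?thesis by (simp only: set_lebesgue_integral_def slope_def)
qed

lemma lambda_bounds:
  assumes "is_lambda l Q \<omega> m w lam"
  shows "0 < lam" "lam \<le> sqrt (\<theta> m)" "lam\<^sup>2 \<le> \<theta> m"
proof -
  show *: "0 < lam" "lam \<le> sqrt (\<theta> m)" using assms by (auto simp: is_lambda_def)
  have "lam\<^sup>2 \<le> (sqrt (\<theta> m))\<^sup>2" using * by (intro power_mono) auto
  then show "lam\<^sup>2 \<le> \<theta> m" using theta_pos[OF m] by simp
qed

text \<open>Off \<open>BV\<close> the functional is infinite, whereas a pure jump of height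
  \<open>s\<close> at \<open>m\<close> has finite energy.\<close>

lemma minimizer_BV:
  assumes s: "0 < s" and min: "is_minimizer l Q \<omega> m s w"
  shows "w \<in> BV (2*m - 1) 1"
proof (rule ccontr)
  assume "w \<notin> BV (2*m - 1) 1"
  then have "scG l Q \<omega> m s w = \<infinity>" by (simp add: scG_def)
  moreover obtain v where "v \<in> L1 (2*m - 1) 1" "scG l Q \<omega> m s v =
     enn2ereal (\<integral>\<^sup>+t. ennreal (sqrt (th (reflect t) * 0\<^sup>2 + om (reflect t))) \<partial>lborel) + ereal (s * sqrt (\<theta> m))"
    using competitor[of "\<lambda>_. 0" s s] s by auto
  moreover have "enn2ereal (\<integral>\<^sup>+t. ennreal (sqrt (om (reflect t))) \<partial>lborel) = ereal (LINT t|lborel. sqrt (om (reflect t)))"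
    by (rule enn2ereal_nn_integral[OF sqrt_om_integrable]) (simp add: om_nonneg)
  ultimately show False using min by (auto simp: is_minimizer_def)
qed

text \<open>The conclusions depend on each other: b <= s makes the comparison with k = 1 legal, its
  equality case fixes the singular part and the boundary values, and only the resulting exact energy
  can be tested against k > 1.\<close>

lemma minimizer_structure:
  assumes s: "0 < s" and min: "is_minimizer l Q \<omega> m s w" and lambda: "is_lambda l Q \<omega> m w lam"
  shows "AE t in lborel. t \<in> {2*m - 1<..<1} \<longrightarrow> ac_deriv (2*m - 1) 1 w t = H lam (reflect t)"
    and "integrable lborel (\<lambda>t. H lam (reflect t))"
    and "slope lam \<le> s"
    and "scG l Q \<omega> m s w = ereal (bulk lam + lam * slope lam + sqrt (\<theta> m) * (s - slope lam))"
    and "w \<in> W11 (2*m - 1) 1 \<longleftrightarrow> s = slope lam"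
    and "slope lam < s \<Longrightarrow> lam = sqrt (\<theta> m)"
    and "slope lam < s \<Longrightarrow> w \<in> SBV (2*m - 1) 1"
    and "trace_right w m = s - slope lam / 2"
proof -
  let ?a = "2*m - 1" let ?I = "{?a<..<1}" let ?q = "sqrt (\<theta> m)" let ?b = "slope lam"
  let ?h = "\<lambda>t. H lam (reflect t)"
  note lam = lambda_bounds[OF lambda]
  have a1: "?a < 1" and am: "?a < m" using m by auto
  have q: "0 < ?q" using theta_pos[OF m] by simp
  have wL: "w \<in> L1 ?a 1" using min by (simp add: is_minimizer_def)
  have wBV: "w \<in> BV ?a 1" by (rule minimizer_BV[OF s min])
  have acw: "AE t in lborel. t \<in> ?I \<longrightarrow> ac_deriv ?a 1 w t = ?h t"
  proof -
    have "AE t in lborel. t \<in> ?I \<longrightarrow> ac_deriv ?a 1 w t =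
        sqrt (lam\<^sup>2 * omega_m \<omega> m (1 - t) / (theta_m l Q \<omega> m t * (theta_m l Q \<omega> m t - lam\<^sup>2)))"
      using lambda by (simp add: is_lambda_def)
    then show ?thesis by eventually_elim (simp add: theta_m_omega_m H_def)
  qed
  then show "AE t in lborel. t \<in> ?I \<longrightarrow> ac_deriv ?a 1 w t = ?h t" .
  obtain p0 \<nu> \<sigma> where dec: "bv_decomp ?a 1 w p0 \<nu> \<sigma>" using BV_bv_decomp[OF wBV] .
  then have \<nu>: "finite_borel_on ?a 1 \<nu>" and \<sigma>: "sign_fun \<sigma>" and p0: "p0 \<in> L1 ?a 1"
    by (auto simp: bv_decomp_def)
  interpret \<nu>: finite_measure \<nu> using \<nu> by (simp add: finite_borel_on_def)
  have s\<nu>: "sets \<nu> = sets borel" using \<nu> by (simp add: finite_borel_on_def)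
  have p0h: "AE t in lborel. t \<in> ?I \<longrightarrow> p0 t = ?h t"
    using ac_deriv_eq[OF wL a1 dec] acw by eventually_elim auto
  \<comment> \<open>Finiteness of B comes from \<open>w\<close> itself: its absolutely continuous
    density lies in \<open>L1\<close> and equals h almost everywhere.\<close>
  show Hint: "integrable lborel ?h"
  proof -
    obtain u where u: "integrable lborel u" "\<And>x. x \<notin> ?I \<Longrightarrow> u x = 0" "AE x in lborel. x \<in> ?I \<longrightarrow> p0 x = u x"
      using L1_borel[OF p0] by blast
    have "AE t in lborel. u t = ?h t"
      using p0h u(3)
    proof eventually_elim
      case (elim t)
      then show ?case using u(2)[of t] integrand_outside_reflect(1)[of t] by (cases "t \<in> ?I") auto
    qed
    then show ?thesis by (intro integrable_cong_AE_imp[OF u(1)]) auto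
  qed
  note ctx = lam(1,3) Hint
  have b: "0 < ?b" by (rule slope_pos[OF ctx])
  have upper: "scG l Q \<omega> m s w \<le> ereal (cost k lam + J * ?q)"
    if k: "0 \<le> k" "0 \<le> J" "k * ?b + J = s" for k J
  proof -
    have 1: "integrable lborel (\<lambda>t. k * ?h t)" using Hint by simp
    have 2: "(LINT t|lborel. k * ?h t) + J = s" using k(3) by (simp add: slope_def)
    have "\<exists>v\<in>L1 ?a 1. scG l Q \<omega> m s v =
      enn2ereal (\<integral>\<^sup>+t. ennreal (sqrt (th (reflect t) * (k * ?h t)\<^sup>2 + om (reflect t))) \<partial>lborel) + ereal (J * ?q)"
      using k integrand_nonneg(1)[OF lam(3)] integrand_outside_reflect(1)
      by (intro competitor[OF 1 _ _ k(2) 2]) auto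
    then obtain v where "v \<in> L1 ?a 1" "scG l Q \<omega> m s v = ereal (cost k lam) + ereal (J * ?q)"
      using cost_ereal[OF ctx k(1)] unfolding energy_def by auto
    then show ?thesis using min by (auto simp: is_minimizer_def)
  qed
  define X where "X = (\<integral>\<^sup>+t\<in>?I. ennreal (sqrt (theta_m l Q \<omega> m t)) \<partial>\<nu>)"
  define C where "C = sqrt_theta_end l Q \<omega>"
  have E: "eint ?a 1 (\<lambda>t. sqrt (theta_m l Q \<omega> m t * \<bar>ac_deriv ?a 1 w t\<bar>\<^sup>2 + omega_m \<omega> m (1 - t))) = ereal (cost 1 lam)"
  proof -
    have "eint ?a 1 (\<lambda>t. sqrt (theta_m l Q \<omega> m t * \<bar>ac_deriv ?a 1 w t\<bar>\<^sup>2 + omega_m \<omega> m (1 - t)))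
        = enn2ereal (\<integral>\<^sup>+t. ennreal (energy 1 lam (reflect t)) \<partial>lborel)"
      unfolding eint_def
    proof (intro arg_cong[of _ _ enn2ereal] nn_integral_cong_AE, use acw in eventually_elim)
      case (elim t)
      then show ?case
        using theta_m_omega_m[of t] integrand_outside_reflect(3)[of t 1 lam]
        by (cases "t \<in> ?I") (auto simp: energy_def)
    qed
    then show ?thesis using cost_ereal[OF ctx, of 1] by simp
  qed
  have G: "scG l Q \<omega> m s w = ereal (cost 1 lam) + enn2ereal X
      + C * ereal \<bar>trace_right w ?a\<bar> + C * ereal \<bar>trace_left w 1 - s\<bar>"
    unfolding scG_def E sing_var_eq[OF wL a1 dec] X_def C_def using wBV by simp
  obtain r where r: "?q < r" "ereal r \<le> C" unfolding C_def using sqrt_theta_end_ge by blast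
  \<comment> \<open>Also valid for infinite \<open>C\<close>, where the right-hand side is 0 or
    infinite.\<close>
  have C: "ereal (r * \<bar>d\<bar>) \<le> C * ereal \<bar>d\<bar>" for d
    using ereal_mult_right_mono[OF r(2), of "ereal \<bar>d\<bar>"] by simp
  have C0: "0 \<le> C * ereal \<bar>d\<bar>" for d
    using order_trans[OF _ C[of d], of 0] r(1) q by (simp add: less_imp_le)
  show bs: "?b \<le> s"
  proof (rule ccontr)
    assume "\<not> ?b \<le> s"
    then have k: "0 \<le> s / ?b" "s / ?b < 1" using s b by auto
    have "scG l Q \<omega> m s w \<le> ereal (cost (s / ?b) lam + 0 * ?q)" using k b by (intro upper) auto
    also have "\<dots> < ereal (cost 1 lam)" using cost_strict[OF ctx k] by simp
    also have "\<dots> \<le> scG l Q \<omega> m s w"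
      unfolding G by (simp add: add_increasing2 C0)
    finally show False by simp
  qed
  have G_le: "scG l Q \<omega> m s w \<le> ereal (cost 1 lam + (s - ?b) * ?q)"
    using bs by (intro upper) auto
  \<comment> \<open>Once the singular energy is known to be finite, the budget is computed in the
    reals.\<close>
  have "X \<noteq> top"
  proof
    assume "X = top"
    then have "scG l Q \<omega> m s w = \<infinity>" unfolding G using C0 by (simp add: ereal_plus_eq_PInfty)
    with G_le show False by simp
  qed
  then obtain x where x: "X = ennreal x" "0 \<le> x" by (cases X) auto
  define n where "n = measure \<nu> ?I"
  have n: "emeasure \<nu> ?I = ennreal n" "0 \<le> n" by (simp_all add: n_def \<nu>.emeasure_eq_measure)
  have qn: "?q * n \<le> x"
    using singular_lower_bound(1)[OF \<nu>] q n x unfolding X_def[symmetric]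
    by (simp add: ennreal_mult[symmetric])
  define z where "z = (LINT t:?I|\<nu>. \<sigma> t)"
  have z: "\<bar>z\<bar> \<le> n" unfolding z_def n_def by (rule polar_integral_bound[OF \<nu> \<sigma>]) simp
  obtain c where c: "AE t in lborel. t \<in> ?I \<longrightarrow> w t = c + primitive ?a ?h \<nu> \<sigma> t"
    using bv_decomp_primitive[OF wL dec Hint p0h] .
  have tr: "trace_right w ?a = c"
    using trace_right_bv[OF c Hint \<nu> \<sigma>, of ?a] a1 by (simp add: primitive_start)
  have tl: "trace_left w 1 = c + (?b + z)"
    using trace_left_bv[OF c Hint \<nu> \<sigma>, of 1] a1 by (simp add: reflect_set_integral z_def)
  define d where "d = \<bar>c + (?b + z) - s\<bar>"
  have "ereal (cost 1 lam + x + r * \<bar>c\<bar> + r * d) \<le> scG l Q \<omega> m s w"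
    unfolding G tr tl d_def plus_ereal.simps(1)[symmetric] using x
    by (intro add_mono C) auto
  from order_trans[OF this G_le] have le: "x + r * \<bar>c\<bar> + r * d \<le> ?q * (s - ?b)" by (simp add: algebra_simps)
  \<comment> \<open>The end value c + b + z misses \<open>s\<close> by \<open>d\<close>, and the
    signed singular mass \<open>z\<close> is at most \<open>n\<close>.\<close>
  have tri: "s - ?b \<le> n + \<bar>c\<bar> + d" using z unfolding d_def by linarith
  have "?q * (s - ?b) \<le> ?q * (n + \<bar>c\<bar> + d)" using tri q by (intro mult_left_mono) auto
  \<comment> \<open>Singular mass costs at least q per unit by \<open>qn\<close>, the boundary terms
    at least r > q; the surplus must vanish.\<close>
  then have "(r - ?q) * (\<bar>c\<bar> + d) \<le> 0" using le qn by (simp add: algebra_simps)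
  then have "\<bar>c\<bar> + d \<le> 0" using r(1) by (simp add: mult_le_0_iff)
  moreover have "0 \<le> d" by (simp add: d_def)
  ultimately have c0: "c = 0" and d0: "d = 0" by auto
  have "?q * n \<le> ?q * (s - ?b)" using le qn c0 d0 by simp
  then have "n \<le> s - ?b" using mult_le_cancel_left_pos[OF q] by blast
  then have ns: "n = s - ?b" using tri c0 d0 by simp
  have xn: "x = ?q * n" using le qn c0 d0 ns by simp
  have zs: "z = s - ?b" using d0 c0 by (simp add: d_def)
  show Gs: "scG l Q \<omega> m s w = ereal (bulk lam + lam * ?b + ?q * (s - ?b))"
    unfolding G tr tl using c0 zs x xn ns cost_one[OF ctx] by (simp add: zero_ereal_def[symmetric])
  show W: "w \<in> W11 ?a 1 \<longleftrightarrow> s = ?b"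
    using W11_iff_sing_var[OF wL a1 dec] n ns by auto
  \<comment> \<open>\<open>xn\<close> is the equality case of the weighted bound, which leaves only
    the point \<open>m\<close>.\<close>
  have conc: "emeasure \<nu> (?I - {m}) = 0"
    using singular_lower_bound(2)[OF \<nu>] q n x xn unfolding X_def[symmetric]
    by (simp add: ennreal_mult)
  have zm: "(LINT t:{?a<..m}|\<nu>. \<sigma> t) = z" and zm': "(LINT t:{?a<..<m}|\<nu>. \<sigma> t) = 0"
  proof -
    have sub: "emeasure \<nu> A = 0" if "A \<subseteq> ?I - {m}" for A
      using emeasure_mono[OF that, of \<nu>] conc s\<nu> by simp
    have "emeasure \<nu> {?a<..<m} = 0" using m by (intro sub) auto
    then show "(LINT t:{?a<..<m}|\<nu>. \<sigma> t) = 0" by (rule null_imp_set_integral_zero) (simp add: s\<nu>)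
    \<comment> \<open>The two sets differ by (m,1), which avoids \<open>m\<close>, so the whole
      singular mass has been collected at \<open>m\<close>.\<close>
    have "emeasure \<nu> (sym_diff {?a<..m} ?I) = 0" using m by (intro sub) auto
    then have "sym_diff {?a<..m} ?I \<in> null_sets \<nu>" by (intro null_setsI) (auto simp: s\<nu>)
    then show "(LINT t:{?a<..m}|\<nu>. \<sigma> t) = z"
      unfolding z_def by (intro set_integral_null_delta sign_fun_integrable[OF \<nu> \<sigma>]) (auto simp: s\<nu>)
  qed
  show trm: "trace_right w m = s - ?b / 2"
    using trace_right_bv[OF c Hint \<nu> \<sigma>, of m] am m c0 zm zs half_slope[OF ctx] by (simp add: primitive_def)
  show "lam = ?q" if "?b < s"
  proof (rule ccontr)
    assume "lam \<noteq> ?q"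
    then have "lam < ?q" using lam(2) by simp
    \<comment> \<open>k b < s keeps the remaining jump positive, and k lam < q makes additional rise
      through the density cheaper than through the jump.\<close>
    then have "1 < min (s / ?b) (?q / lam)" using that b lam(1) by simp
    then obtain k where k: "1 < k" "k < s / ?b" "k < ?q / lam" using dense by (metis min_less_iff_conj)
    have kb: "k * ?b < s" "k * lam < ?q" using k b lam(1) by (auto simp: field_simps)
    have "scG l Q \<omega> m s w \<le> ereal (cost k lam + (s - k * ?b) * ?q)"
      using k(1) kb by (intro upper) auto
    then have "cost 1 lam + ?q * (s - ?b) \<le> cost k lam + (s - k * ?b) * ?q"
      unfolding Gs cost_one[OF ctx] by simp
    also have "\<dots> \<le> cost 1 lam + k * lam * (k - 1) * ?b + (s - k * ?b) * ?q"
      using cost_upper[OF ctx, of k] k(1) by simp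
    finally have "?q * ((k - 1) * ?b) \<le> k * lam * ((k - 1) * ?b)" by (simp add: algebra_simps)
    then have "?q \<le> k * lam" using k(1) b by simp
    with kb(2) show False by simp
  qed
  show "w \<in> SBV ?a 1" if "?b < s"
  proof -
    have "(LINT t:{?a<..<m}|lborel. ?h t) = (LINT t:{?a<..m}|lborel. ?h t)"
      by (rule set_integral_discrete_difference[where X="{m}"]) auto
    then have "trace_left w m = ?b / 2"
      using trace_left_bv[OF c Hint \<nu> \<sigma>, of m] am m c0 zm' half_slope[OF ctx] by simp
    \<comment> \<open>The traces b/2 and s - b/2 differ because b < s, so the point that may carry
      singular mass is a genuine jump and no Cantor part remains.\<close>
    then have "m \<in> jump_set ?a 1 w" using trm that am m by (simp add: jump_set_def)
    then have "emeasure \<nu> (?I - jump_set ?a 1 w) \<le> emeasure \<nu> (?I - {m})"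
      by (intro emeasure_mono) (auto simp: s\<nu>)
    then show ?thesis using wBV conc by (simp add: SBV_def sing_var_eq[OF wL a1 dec])
  qed
qed

text \<open>A larger \<open>lam\<close> enlarges the numerator and shrinks the positive denominator.
  The comparison is made in \<open>ereal\<close> because B at the critical value may be
  infinite.\<close>

lemma B_fun_mono:
  assumes "0 < lam" "lam \<le> mu" "mu\<^sup>2 \<le> \<theta> m"
  shows "B_fun l Q \<omega> m lam \<le> B_fun l Q \<omega> m mu"
proof -
  have sq: "lam\<^sup>2 \<le> mu\<^sup>2" using assms by (intro power_mono) auto
  have "sqrt (lam\<^sup>2 * \<omega> (1 - t) / (\<theta> t * (\<theta> t - lam\<^sup>2))) \<le> sqrt (mu\<^sup>2 * \<omega> (1 - t) / (\<theta> t * (\<theta> t - mu\<^sup>2)))"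
    if t: "t \<in> {m<..<1}" for t
  proof (intro real_sqrt_le_mono frac_le mult_right_mono mult_left_mono mult_pos_pos)
    have "\<theta> m < \<theta> t" using theta_less[of m t] t m by simp
    then show "0 < \<theta> t - mu\<^sup>2" using assms(3) by simp
    show "0 < \<theta> t" "0 \<le> \<theta> t" using theta_pos[of t] t m by auto
    show "0 \<le> \<omega> (1 - t)" using omega_pos[of "1 - t"] t m by simp
    then show "0 \<le> mu\<^sup>2 * \<omega> (1 - t)" by simp
  qed (use sq in auto)
  then have "eint m 1 (\<lambda>t. sqrt (lam\<^sup>2 * \<omega> (1 - t) / (\<theta> t * (\<theta> t - lam\<^sup>2))))
      \<le> eint m 1 (\<lambda>t. sqrt (mu\<^sup>2 * \<omega> (1 - t) / (\<theta> t * (\<theta> t - mu\<^sup>2))))"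
    unfolding eint_def less_eq_ennreal.rep_eq[symmetric]
    by (intro nn_integral_mono) (auto intro!: ennreal_leI simp: indicator_def)
  then show ?thesis unfolding B_fun_def by (intro ereal_mult_left_mono) auto
qed

end

theorem corollary2p8:
  fixes l Q \<omega> \<phi> w :: "real \<Rightarrow> real" and m s lam :: real
  assumes "admissible l Q \<omega> \<phi>"
    and "0 < m" "m < 1"
    and "0 < s"
    and "is_minimizer l Q \<omega> m s w"
    and "is_lambda l Q \<omega> m w lam"
  shows
    "scG l Q \<omega> m s w =
       2 * eint m 1 (\<lambda>t. sqrt (theta l Q \<omega> t * \<bar>ac_deriv (2*m - 1) 1 w t\<bar>\<^sup>2 + \<omega> (1 - t)))
       + ereal (2 * sqrt (theta l Q \<omega> m) * (trace_right w m - s / 2))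
     \<and> (w \<in> W11 (2*m - 1) 1 \<longleftrightarrow> \<not> w \<in> SBV (2*m - 1) 1 - W11 (2*m - 1) 1)
     \<and> (w \<in> W11 (2*m - 1) 1 \<longleftrightarrow> ereal s = B_fun l Q \<omega> m lam)
     \<and> (w \<in> W11 (2*m - 1) 1 \<longrightarrow>
          scG l Q \<omega> m s w
            = 2 * eint m 1 (\<lambda>t. sqrt (theta l Q \<omega> t * \<omega> (1 - t) / (theta l Q \<omega> t - lam\<^sup>2)))
        \<and> scG l Q \<omega> m s w = scriptG l Q \<omega> m lam
        \<and> scG l Q \<omega> m s w = A_fun l Q \<omega> m lam + ereal (lam * s))
     \<and> (w \<in> SBV (2*m - 1) 1 - W11 (2*m - 1) 1
          \<longleftrightarrow> ereal s > B_fun l Q \<omega> m (sqrt (theta l Q \<omega> m)))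
     \<and> (w \<in> SBV (2*m - 1) 1 - W11 (2*m - 1) 1 \<longrightarrow>
          ereal (trace_right w m) = ereal s - B_fun l Q \<omega> m (sqrt (theta l Q \<omega> m)) / 2
        \<and> scG l Q \<omega> m s w
            = 2 * eint m 1 (\<lambda>t. sqrt (theta l Q \<omega> t * \<omega> (1 - t) / (theta l Q \<omega> t - theta l Q \<omega> m)))
              + ereal (sqrt (theta l Q \<omega> m)) * (ereal s - B_fun l Q \<omega> m (sqrt (theta l Q \<omega> m)))
        \<and> scG l Q \<omega> m s w
            = scriptG l Q \<omega> m (sqrt (theta l Q \<omega> m))
              + ereal (sqrt (theta l Q \<omega> m)) * (ereal s - B_fun l Q \<omega> m (sqrt (theta l Q \<omega> m)))
        \<and> scG l Q \<omega> m s w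
            = A_fun l Q \<omega> m (sqrt (theta l Q \<omega> m)) + ereal (sqrt (theta l Q \<omega> m) * s))"
proof -
  interpret admissible_data l Q \<omega> \<phi> m using assms(1-3) by unfold_locales
  let ?q = "sqrt (theta l Q \<omega> m)" and ?b = "slope lam" and ?a = "2*m - 1"
  note lam = lambda_bounds[OF assms(6)]
  note st = minimizer_structure[OF assms(4-6)]
  note ctx = lam(1,3) st(2)
  have q2: "?q\<^sup>2 = theta l Q \<omega> m" using theta_pos[OF m] by simp
  have B: "B_fun l Q \<omega> m lam = ereal ?b" by (rule B_fun_eq[OF ctx])
  have A: "A_fun l Q \<omega> m lam = ereal (bulk lam)" by (rule A_fun_eq[OF ctx])
  \<comment> \<open>Finiteness of B is known at \<open>lam\<close> only; at the critical value this
    inequality is all that is available until \<open>lam\<close> is shown to be critical.\<close>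
  have Bq: "ereal ?b \<le> B_fun l Q \<omega> m ?q"
    using B_fun_mono[OF lam(1,2)] q2 B by simp
  have "AE t in lborel. t \<in> {m<..<1} \<longrightarrow> sqrt (theta l Q \<omega> t * \<bar>ac_deriv ?a 1 w t\<bar>\<^sup>2 + \<omega> (1 - t)) = energy 1 lam t"
    using st(1)
  proof eventually_elim
    case (elim t)
    show ?case
    proof
      assume t: "t \<in> {m<..<1}"
      then have "ac_deriv ?a 1 w t = H lam t" using elim m reflect_right[OF ctx t] by simp
      then show "sqrt (theta l Q \<omega> t * \<bar>ac_deriv ?a 1 w t\<bar>\<^sup>2 + \<omega> (1 - t)) = energy 1 lam t"
        using t th_om_inside[of t] by (simp add: energy_def)
    qed
  qed
  note E1 = eint_energy[OF ctx this] and E2 = eint_explicit[OF ctx]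
  have G: "scG l Q \<omega> m s w = ereal (bulk lam + lam * ?b + ?q * (s - ?b))" by (rule st(4))
  \<comment> \<open>The dichotomy: since b <= s, failure of s = b means b < s, which already yields
    \<open>SBV\<close>.\<close>
  have sing: "w \<in> SBV ?a 1 - W11 ?a 1 \<longleftrightarrow> ?b < s"
    using st(3,5,7) by auto
  have critical: "lam = ?q" if "?b < s" using st(6) that .
  \<comment> \<open>The right trace minus s/2 is (s - b)/2, which the factor 2 turns into the jump
    height s - b.\<close>
  have 1: "scG l Q \<omega> m s w =
       2 * eint m 1 (\<lambda>t. sqrt (theta l Q \<omega> t * \<bar>ac_deriv ?a 1 w t\<bar>\<^sup>2 + \<omega> (1 - t)))
       + ereal (2 * ?q * (trace_right w m - s / 2))"
    unfolding E1 G st(8) by (simp add: algebra_simps)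
  \<comment> \<open>Forward by monotonicity of B; backward because b < s forces \<open>lam\<close>
    to be critical, so that the two values of B coincide.\<close>
  have 4: "ereal s > B_fun l Q \<omega> m ?q \<longleftrightarrow> ?b < s"
  proof
    assume "ereal s > B_fun l Q \<omega> m ?q"
    with Bq show "?b < s" by (metis ereal_less(2) ereal_less_eq(3) less_ereal.simps(1) order_le_less_trans)
  next
    assume "?b < s"
    then show "ereal s > B_fun l Q \<omega> m ?q" using critical B by simp
  qed
  have 3: "scG l Q \<omega> m s w = 2 * eint m 1 (\<lambda>t. sqrt (theta l Q \<omega> t * \<omega> (1 - t) / (theta l Q \<omega> t - lam\<^sup>2)))
      \<and> scG l Q \<omega> m s w = scriptG l Q \<omega> m lam
      \<and> scG l Q \<omega> m s w = A_fun l Q \<omega> m lam + ereal (lam * s)" if "s = ?b"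
    using that unfolding E2 scriptG_def A B G by simp
  have 5: "ereal (trace_right w m) = ereal s - B_fun l Q \<omega> m ?q / 2
      \<and> scG l Q \<omega> m s w = 2 * eint m 1 (\<lambda>t. sqrt (theta l Q \<omega> t * \<omega> (1 - t) / (theta l Q \<omega> t - theta l Q \<omega> m)))
          + ereal ?q * (ereal s - B_fun l Q \<omega> m ?q)
      \<and> scG l Q \<omega> m s w = scriptG l Q \<omega> m ?q + ereal ?q * (ereal s - B_fun l Q \<omega> m ?q)
      \<and> scG l Q \<omega> m s w = A_fun l Q \<omega> m ?q + ereal (?q * s)" if "?b < s"
  proof -
    have l: "lam = ?q" by (rule critical[OF that])
    then have l2: "lam\<^sup>2 = theta l Q \<omega> m" using q2 by simp
    show ?thesis
      unfolding E2[unfolded l2] scriptG_def A[unfolded l] B[unfolded l] G st(8)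
      by (simp add: l[symmetric] algebra_simps)
  qed
  show ?thesis using 1 3 4 5 sing st(3,5) B by auto
qed

end
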